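(* Assume $\Lambda>0$. Let initial data $g^0$ (symmetric positive definite), $K^0$ (symmetric), $F^0$ (antisymmetric), $E^0,U^0\in\mathbb{R}^3$, $\theta^0\in\mathbb{R}^4$, $\rho^0>0$, $e^0\ge0$ satisfy the constraints (C1)–(C4) at $t=0$, and assume the initial mean curvature satisfies $H(0)=g^{0,ij}K^0_{ij}<0$. Then the initial value problem for the evolution system (S) has a unique global $C^1$ solution $(g,K,F,E,u,\Theta,\rho,e)$ defined on $[0,+\infty)$ (with $g$ positive definite, $\rho>0$, $e\ge0$), under the standing model assumption $\Theta^{00}\ge0$ along the solution.
   Context: Setting. $G$ is a three-dimensional connected Lie group of Bianchi type I–VIII, $(e_i)_{i=1,2,3}$ a left-invariant frame with structure constants $C^k_{ij}$ defined by $[e_i,e_j]=C^k_{ij}e_k$ (so $C^k_{ij}=-C^k_{ji}$ and the Jacobi identity holds). $\Lambda\in\mathbb{R}$ is a constant. Latin indices run over $1,2,3$; repeated indices are summed. Unknowns (functions of $t$): a symmetric positive definite matrix $g=(g_{ij})$ with inverse $(g^{ij})$; a symmetric matrix $K=(K_{ij})$; an antisymmetric matrix $F=(F_{ij})$; vectors $E=(E^i)$, $u=(u^i)$; $\Theta=(\Theta^{00},\Theta^{0i})$; a function $\rho>0$; a function $e\ge0$. Derived quantities: $u^0=\sqrt{1+g_{ij}u^iu^j}$, $u_i=g_{ij}u^j$; $H=g^{ij}K_{ij}$; $K^i_j=g^{ik}K_{kj}$, $K^{ij}=g^{ik}g^{jl}K_{kl}$; $F^{ij}=g^{ik}g^{jl}F_{kl}$;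 $\gamma^l_{ij}=\tfrac12 g^{lk}(-C^m_{jk}g_{im}+C^m_{ki}g_{jm}+C^m_{ij}g_{km})$; $R_{ij}=\gamma^l_{lm}\gamma^m_{ji}-\gamma^m_{jl}\gamma^l_{mi}-C^l_{mj}\gamma^m_{li}$, $R=g^{ij}R_{ij}$; $\tau_{00}=\tfrac12 g_{ij}E^iE^j+\tfrac14 g^{ik}g^{jl}F_{kl}F_{ij}$, $\tau_{0j}=-E^kF_{jk}$, $\tau_{ij}=(\tfrac12 g_{ij}g_{kl}-g_{ik}g_{jl})E^kE^l-\tfrac14 g_{ij}g^{km}g^{nl}F_{kl}F_{mn}+g^{kl}F_{ik}F_{jl}$; $\Theta_{00}=\Theta^{00}$, $\Theta_{0j}=-g_{jk}\Theta^{0k}$; $T_{00}=\tfrac43\rho(u^0)^2+\Theta_{00}$, $T_{0j}=-\tfrac43\rho u^0u_j+\Theta_{0j}$, $T_{ij}=\tfrac43\rho u_iu_j+\tfrac13\rho g_{ij}$; $\nabla$ is the Levi-Civita connection of the left-invariant metric $g$, so for left-invariant tensors $\nabla_kK_{ij}=-\gamma^l_{ki}K_{lj}-\gamma^l_{kj}K_{il}$ and $\nabla^iK_{ij}=g^{ik}\nabla_kK_{ij}$. Evolution system (S) (dot $=d/dt$): $\dot g_{ij}=-2K_{ij}$; $\dot K_{ij}=R_{ij}+HK_{ij}-2K^l_jK_{il}-8\pi(\tau_{ij}+T_{ij})+4\pi(-T_{00}+g^{lm}T_{lm})g_{ij}-\Lambda g_{ij}$; $\dot F_{ij}=C^k_{ij}g_{kl}E^l$;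 $\dot E^i=HE^i-C^j_{jk}E^k\frac{u^i}{u^0}-C^j_{jk}g^{kl}g^{im}F_{lm}-\tfrac12 C^i_{jk}g^{jl}g^{km}F_{lm}$; $\dot u^i=2K^i_ju^j-\gamma^i_{jk}\frac{u^ju^k}{u^0}+\frac{3}{4\rho u^0}C^j_{jk}E^kE^i-\frac{3}{4\rho(u^0)^2}C^j_{jk}E^kg^{il}F_{ml}u^m$; $\dot\Theta^{00}=H\Theta^{00}-C^i_{ij}\Theta^{0j}+\tfrac13\rho H+\rho u^0$; $\dot\Theta^{0i}=H\Theta^{0i}+2K^i_j\Theta^{0j}-\tfrac{\rho}{3}(C^k_{kj}g^{ij}+\gamma^i_{jk}g^{jk})+\rho u^i$; $\dot\rho=-\big(\frac{3}{4u^0}+K_{ij}\frac{u^iu^j}{(u^0)^2}-H+C^i_{ij}\frac{u^j}{u^0}\big)\rho-\tfrac34 g_{il}C^j_{jk}E^kE^l\frac{u^i}{(u^0)^3}$; $\dot e=-\big(K_{ij}\frac{u^iu^j}{(u^0)^2}+C^i_{ik}\frac{u^k}{u^0}-H\big)e+\tfrac34 g_{ij}\frac{u^iE^j}{(u^0)^2}\frac{e^2}{\rho}$. Constraints: (C1) $R-K_{ij}K^{ij}+H^2=16\pi(\tau_{00}+T_{00})+2\Lambda$; (C2) $\nabla^iK_{ij}=-8\pi(\tau_{0j}+T_{0j})$; (C3) $C^l_{ij}F_{kl}+C^l_{jk}F_{il}+C^l_{ki}F_{jl}=0$; (C4) $C^i_{ik}E^k+eu^0=0$. Initial conditions: $g(0)=g^0$,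 $K(0)=K^0$, $F(0)=F^0$, $E(0)=E^0$, $u(0)=U^0$, $\Theta(0)=\theta^0$, $\rho(0)=\rho^0$, $e(0)=e^0$. Model assumption: $\Theta^{00}\ge0$ (in the model $\Theta_{00}=(z_0)^2$ for a future-pointing vector $z$). For Bianchi types I–VIII the scalar curvature satisfies $R\le0$. *)

theory Defs
  imports "HOL-Analysis.Analysis"
begin

text \<open>Indices 1,2,3 of the paper are represented by the three elements 0,1,2 of the
finite type 3.  Matrices are real^3^3 (entry (i,j) is M $ i $ j), vectors real^3.
Structure constants: C k i j stands for C^k_{ij}, i.e. [e_i,e_j] = sum_k C^k_{ij} e_k.\<close>

type_synonym sconst = "3 \<Rightarrow> 3 \<Rightarrow> 3 \<Rightarrow> real"

definition lie_structure :: "sconst \<Rightarrow> bool" where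
  "lie_structure C \<longleftrightarrow>
     (\<forall>k i j. C k i j = - C k j i) \<and>
     (\<forall>i j k l. (\<Sum>m\<in>UNIV. C m i j * C l m k + C m j k * C l m i + C m k i * C l m j) = 0)"

definition levi_civita :: "3 \<Rightarrow> 3 \<Rightarrow> 3 \<Rightarrow> real" where
  "levi_civita a b c =
     (if (a,b,c) \<in> {(0,1,2),(1,2,0),(2,0,1)} then 1
      else if (a,b,c) \<in> {(0,2,1),(2,1,0),(1,0,2)} then -1 else 0)"

text \<open>Bianchi type IX: the Lie algebra is isomorphic to so(3)=su(2), i.e. there is a new basis
e'_a = sum_i A_{a i} e_i with [e'_a,e'_b] = sum_c eps_{abc} e'_c.  Since Bianchi types I--IX
exhaust all real 3-dimensional Lie algebras, "Bianchi type I--VIII" means "not type IX".\<close>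

definition bianchi_IX :: "sconst \<Rightarrow> bool" where
  "bianchi_IX C \<longleftrightarrow> (\<exists>A :: real^3^3. invertible A \<and>
     (\<forall>a b k. (\<Sum>i\<in>UNIV. \<Sum>j\<in>UNIV. A $ a $ i * A $ b $ j * C k i j)
              = (\<Sum>c\<in>UNIV. levi_civita a b c * A $ c $ k)))"

definition bianchi_I_to_VIII :: "sconst \<Rightarrow> bool" where
  "bianchi_I_to_VIII C \<longleftrightarrow> lie_structure C \<and> \<not> bianchi_IX C"

definition symm :: "real^3^3 \<Rightarrow> bool" where
  "symm M \<longleftrightarrow> (\<forall>i j. M $ i $ j = M $ j $ i)"

definition antisymm :: "real^3^3 \<Rightarrow> bool" where
  "antisymm M \<longleftrightarrow> (\<forall>i j. M $ i $ j = - M $ j $ i)"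

definition posdef :: "real^3^3 \<Rightarrow> bool" where
  "posdef M \<longleftrightarrow> symm M \<and> (\<forall>x :: real^3. x \<noteq> 0 \<longrightarrow> (\<Sum>i\<in>UNIV. \<Sum>j\<in>UNIV. x $ i * M $ i $ j * x $ j) > 0)"

definition gi :: "real^3^3 \<Rightarrow> 3 \<Rightarrow> 3 \<Rightarrow> real" where
  "gi g i j = matrix_inv g $ i $ j"

definition uzero :: "real^3^3 \<Rightarrow> real^3 \<Rightarrow> real" where
  "uzero g u = sqrt (1 + (\<Sum>i\<in>UNIV. \<Sum>j\<in>UNIV. g $ i $ j * u $ i * u $ j))"

definition ulow :: "real^3^3 \<Rightarrow> real^3 \<Rightarrow> 3 \<Rightarrow> real" where
  "ulow g u i = (\<Sum>j\<in>UNIV. g $ i $ j * u $ j)"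

definition Hmean :: "real^3^3 \<Rightarrow> real^3^3 \<Rightarrow> real" where
  "Hmean g K = (\<Sum>i\<in>UNIV. \<Sum>j\<in>UNIV. gi g i j * K $ i $ j)"

definition Kmix :: "real^3^3 \<Rightarrow> real^3^3 \<Rightarrow> 3 \<Rightarrow> 3 \<Rightarrow> real" where
  "Kmix g K i j = (\<Sum>k\<in>UNIV. gi g i k * K $ k $ j)"

definition Kup :: "real^3^3 \<Rightarrow> real^3^3 \<Rightarrow> 3 \<Rightarrow> 3 \<Rightarrow> real" where
  "Kup g K i j = (\<Sum>k\<in>UNIV. \<Sum>l\<in>UNIV. gi g i k * gi g j l * K $ k $ l)"

definition gam :: "sconst \<Rightarrow> real^3^3 \<Rightarrow> 3 \<Rightarrow> 3 \<Rightarrow> 3 \<Rightarrow> real" where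
  "gam C g l i j = 1/2 * (\<Sum>k\<in>UNIV. gi g l k *
      (\<Sum>m\<in>UNIV. - C m j k * g $ i $ m + C m k i * g $ j $ m + C m i j * g $ k $ m))"

definition Ric :: "sconst \<Rightarrow> real^3^3 \<Rightarrow> 3 \<Rightarrow> 3 \<Rightarrow> real" where
  "Ric C g i j = (\<Sum>l\<in>UNIV. \<Sum>m\<in>UNIV. gam C g l l m * gam C g m j i - gam C g m j l * gam C g l m i
                              - C l m j * gam C g m l i)"

definition Rscal :: "sconst \<Rightarrow> real^3^3 \<Rightarrow> real" where
  "Rscal C g = (\<Sum>i\<in>UNIV. \<Sum>j\<in>UNIV. gi g i j * Ric C g i j)"

definition tau00 :: "real^3^3 \<Rightarrow> real^3^3 \<Rightarrow> real^3 \<Rightarrow> real" where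
  "tau00 g F E = 1/2 * (\<Sum>i\<in>UNIV. \<Sum>j\<in>UNIV. g $ i $ j * E $ i * E $ j)
     + 1/4 * (\<Sum>i\<in>UNIV. \<Sum>j\<in>UNIV. \<Sum>k\<in>UNIV. \<Sum>l\<in>UNIV. gi g i k * gi g j l * F $ k $ l * F $ i $ j)"

definition tau0 :: "real^3^3 \<Rightarrow> real^3 \<Rightarrow> 3 \<Rightarrow> real" where
  "tau0 F E j = - (\<Sum>k\<in>UNIV. E $ k * F $ j $ k)"

definition tauij :: "real^3^3 \<Rightarrow> real^3^3 \<Rightarrow> real^3 \<Rightarrow> 3 \<Rightarrow> 3 \<Rightarrow> real" where
  "tauij g F E i j =
     (\<Sum>k\<in>UNIV. \<Sum>l\<in>UNIV. (1/2 * g $ i $ j * g $ k $ l - g $ i $ k * g $ j $ l) * E $ k * E $ l)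
     - 1/4 * g $ i $ j * (\<Sum>k\<in>UNIV. \<Sum>m\<in>UNIV. \<Sum>n\<in>UNIV. \<Sum>l\<in>UNIV. gi g k m * gi g n l * F $ k $ l * F $ m $ n)
     + (\<Sum>k\<in>UNIV. \<Sum>l\<in>UNIV. gi g k l * F $ i $ k * F $ j $ l)"

definition Theta0low :: "real^3^3 \<Rightarrow> real^3 \<Rightarrow> 3 \<Rightarrow> real" where
  "Theta0low g th0 j = - (\<Sum>k\<in>UNIV. g $ j $ k * th0 $ k)"

definition T00 :: "real^3^3 \<Rightarrow> real^3 \<Rightarrow> real \<Rightarrow> real \<Rightarrow> real" where
  "T00 g u th00 rho = 4/3 * rho * (uzero g u)\<^sup>2 + th00"

definition T0 :: "real^3^3 \<Rightarrow> real^3 \<Rightarrow> real^3 \<Rightarrow> real \<Rightarrow> 3 \<Rightarrow> real" where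
  "T0 g u th0 rho j = - 4/3 * rho * uzero g u * ulow g u j + Theta0low g th0 j"

definition Tij :: "real^3^3 \<Rightarrow> real^3 \<Rightarrow> real \<Rightarrow> 3 \<Rightarrow> 3 \<Rightarrow> real" where
  "Tij g u rho i j = 4/3 * rho * ulow g u i * ulow g u j + 1/3 * rho * g $ i $ j"

definition divK :: "sconst \<Rightarrow> real^3^3 \<Rightarrow> real^3^3 \<Rightarrow> 3 \<Rightarrow> real" where
  "divK C g K j = (\<Sum>i\<in>UNIV. \<Sum>k\<in>UNIV. gi g i k *
      (- (\<Sum>l\<in>UNIV. gam C g l k i * K $ l $ j) - (\<Sum>l\<in>UNIV. gam C g l k j * K $ i $ l)))"

definition constraints ::
  "sconst \<Rightarrow> real \<Rightarrow> real^3^3 \<Rightarrow> real^3^3 \<Rightarrow> real^3^3 \<Rightarrow> real^3 \<Rightarrow> real^3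
   \<Rightarrow> real \<Rightarrow> real^3 \<Rightarrow> real \<Rightarrow> real \<Rightarrow> bool" where
  "constraints C \<Lambda> g K F E u th00 th0 rho e \<longleftrightarrow>
     \<comment> \<open>(C1)\<close>
     Rscal C g - (\<Sum>i\<in>UNIV. \<Sum>j\<in>UNIV. K $ i $ j * Kup g K i j) + (Hmean g K)\<^sup>2
        = 16 * pi * (tau00 g F E + T00 g u th00 rho) + 2 * \<Lambda> \<and>
     \<comment> \<open>(C2)\<close>
     (\<forall>j. divK C g K j = - 8 * pi * (tau0 F E j + T0 g u th0 rho j)) \<and>
     \<comment> \<open>(C3)\<close>
     (\<forall>i j k. (\<Sum>l\<in>UNIV. C l i j * F $ k $ l + C l j k * F $ i $ l + C l k i * F $ j $ l) = 0) \<and>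
     \<comment> \<open>(C4)\<close>
     (\<Sum>i\<in>UNIV. \<Sum>k\<in>UNIV. C i i k * E $ k) + e * uzero g u = 0"

definition trC :: "sconst \<Rightarrow> 3 \<Rightarrow> real" where
  "trC C k = (\<Sum>j\<in>UNIV. C j j k)"

definition rhs_g :: "real^3^3 \<Rightarrow> real^3^3" where
  "rhs_g K = (\<chi> i j. - 2 * K $ i $ j)"

definition rhs_K ::
  "sconst \<Rightarrow> real \<Rightarrow> real^3^3 \<Rightarrow> real^3^3 \<Rightarrow> real^3^3 \<Rightarrow> real^3 \<Rightarrow> real^3
   \<Rightarrow> real \<Rightarrow> real \<Rightarrow> real^3^3" where
  "rhs_K C \<Lambda> g K F E u th00 rho = (\<chi> i j.
      Ric C g i j + Hmean g K * K $ i $ j - 2 * (\<Sum>l\<in>UNIV. Kmix g K l j * K $ i $ l)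
      - 8 * pi * (tauij g F E i j + Tij g u rho i j)
      + 4 * pi * (- T00 g u th00 rho + (\<Sum>l\<in>UNIV. \<Sum>m\<in>UNIV. gi g l m * Tij g u rho l m)) * g $ i $ j
      - \<Lambda> * g $ i $ j)"

definition rhs_F :: "sconst \<Rightarrow> real^3^3 \<Rightarrow> real^3 \<Rightarrow> real^3^3" where
  "rhs_F C g E = (\<chi> i j. \<Sum>k\<in>UNIV. \<Sum>l\<in>UNIV. C k i j * g $ k $ l * E $ l)"

definition rhs_E :: "sconst \<Rightarrow> real^3^3 \<Rightarrow> real^3^3 \<Rightarrow> real^3^3 \<Rightarrow> real^3 \<Rightarrow> real^3 \<Rightarrow> real^3" where
  "rhs_E C g K F E u = (\<chi> i.
      Hmean g K * E $ i - (\<Sum>k\<in>UNIV. trC C k * E $ k) * u $ i / uzero g u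
      - (\<Sum>k\<in>UNIV. \<Sum>l\<in>UNIV. \<Sum>m\<in>UNIV. trC C k * gi g k l * gi g i m * F $ l $ m)
      - 1/2 * (\<Sum>j\<in>UNIV. \<Sum>k\<in>UNIV. \<Sum>l\<in>UNIV. \<Sum>m\<in>UNIV. C i j k * gi g j l * gi g k m * F $ l $ m))"

definition rhs_u ::
  "sconst \<Rightarrow> real^3^3 \<Rightarrow> real^3^3 \<Rightarrow> real^3^3 \<Rightarrow> real^3 \<Rightarrow> real^3 \<Rightarrow> real \<Rightarrow> real^3" where
  "rhs_u C g K F E u rho = (\<chi> i.
      2 * (\<Sum>j\<in>UNIV. Kmix g K i j * u $ j)
      - (\<Sum>j\<in>UNIV. \<Sum>k\<in>UNIV. gam C g i j k * u $ j * u $ k) / uzero g u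
      + 3 / (4 * rho * uzero g u) * (\<Sum>k\<in>UNIV. trC C k * E $ k) * E $ i
      - 3 / (4 * rho * (uzero g u)\<^sup>2) * (\<Sum>k\<in>UNIV. trC C k * E $ k)
          * (\<Sum>l\<in>UNIV. \<Sum>m\<in>UNIV. gi g i l * F $ m $ l * u $ m))"

definition rhs_th00 ::
  "sconst \<Rightarrow> real^3^3 \<Rightarrow> real^3^3 \<Rightarrow> real^3 \<Rightarrow> real \<Rightarrow> real^3 \<Rightarrow> real \<Rightarrow> real" where
  "rhs_th00 C g K u th00 th0 rho =
      Hmean g K * th00 - (\<Sum>i\<in>UNIV. \<Sum>j\<in>UNIV. C i i j * th0 $ j) + 1/3 * rho * Hmean g K + rho * uzero g u"

definition rhs_th0 ::
  "sconst \<Rightarrow> real^3^3 \<Rightarrow> real^3^3 \<Rightarrow> real^3 \<Rightarrow> real^3 \<Rightarrow> real \<Rightarrow> real^3" where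
  "rhs_th0 C g K u th0 rho = (\<chi> i.
      Hmean g K * th0 $ i + 2 * (\<Sum>j\<in>UNIV. Kmix g K i j * th0 $ j)
      - rho / 3 * ((\<Sum>j\<in>UNIV. trC C j * gi g i j) + (\<Sum>j\<in>UNIV. \<Sum>k\<in>UNIV. gam C g i j k * gi g j k))
      + rho * u $ i)"

definition rhs_rho ::
  "sconst \<Rightarrow> real^3^3 \<Rightarrow> real^3^3 \<Rightarrow> real^3 \<Rightarrow> real^3 \<Rightarrow> real \<Rightarrow> real" where
  "rhs_rho C g K E u rho =
      - (3 / (4 * uzero g u) + (\<Sum>i\<in>UNIV. \<Sum>j\<in>UNIV. K $ i $ j * u $ i * u $ j) / (uzero g u)\<^sup>2
         - Hmean g K + (\<Sum>i\<in>UNIV. \<Sum>j\<in>UNIV. C i i j * u $ j) / uzero g u) * rho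
      - 3/4 * (\<Sum>i\<in>UNIV. \<Sum>l\<in>UNIV. \<Sum>k\<in>UNIV. g $ i $ l * trC C k * E $ k * E $ l * u $ i) / (uzero g u) ^ 3"

definition rhs_e ::
  "sconst \<Rightarrow> real^3^3 \<Rightarrow> real^3^3 \<Rightarrow> real^3 \<Rightarrow> real^3 \<Rightarrow> real \<Rightarrow> real \<Rightarrow> real" where
  "rhs_e C g K E u rho e =
      - ((\<Sum>i\<in>UNIV. \<Sum>j\<in>UNIV. K $ i $ j * u $ i * u $ j) / (uzero g u)\<^sup>2
         + (\<Sum>i\<in>UNIV. \<Sum>k\<in>UNIV. C i i k * u $ k) / uzero g u - Hmean g K) * e
      + 3/4 * (\<Sum>i\<in>UNIV. \<Sum>j\<in>UNIV. g $ i $ j * u $ i * E $ j) / (uzero g u)\<^sup>2 * e\<^sup>2 / rho"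

text \<open>A solution on I: each unknown is differentiable (one-sided at endpoints, via
derivative within I) with derivative given by (S); since the right-hand sides are continuous,
such a solution is automatically C^1.  The unknowns are in their natural classes:
g symmetric positive definite, K symmetric, F antisymmetric, rho > 0, e >= 0.\<close>

definition solves_S ::
  "sconst \<Rightarrow> real \<Rightarrow> real set \<Rightarrow>
   (real \<Rightarrow> real^3^3) \<Rightarrow> (real \<Rightarrow> real^3^3) \<Rightarrow> (real \<Rightarrow> real^3^3) \<Rightarrow>
   (real \<Rightarrow> real^3) \<Rightarrow> (real \<Rightarrow> real^3) \<Rightarrow> (real \<Rightarrow> real) \<Rightarrow> (real \<Rightarrow> real^3) \<Rightarrow>
   (real \<Rightarrow> real) \<Rightarrow> (real \<Rightarrow> real) \<Rightarrow> bool" where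
  "solves_S C \<Lambda> I g K F E u th00 th0 rho e \<longleftrightarrow>
     (\<forall>t\<in>I.
        posdef (g t) \<and> symm (K t) \<and> antisymm (F t) \<and> rho t > 0 \<and> e t \<ge> 0 \<and>
        (g has_vector_derivative rhs_g (K t)) (at t within I) \<and>
        (K has_vector_derivative
           rhs_K C \<Lambda> (g t) (K t) (F t) (E t) (u t) (th00 t) (rho t)) (at t within I) \<and>
        (F has_vector_derivative rhs_F C (g t) (E t)) (at t within I) \<and>
        (E has_vector_derivative rhs_E C (g t) (K t) (F t) (E t) (u t)) (at t within I) \<and>
        (u has_vector_derivative
           rhs_u C (g t) (K t) (F t) (E t) (u t) (rho t)) (at t within I) \<and>
        (th00 has_vector_derivative
           rhs_th00 C (g t) (K t) (u t) (th00 t) (th0 t) (rho t)) (at t within I) \<and>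
        (th0 has_vector_derivative
           rhs_th0 C (g t) (K t) (u t) (th0 t) (rho t)) (at t within I) \<and>
        (rho has_vector_derivative
           rhs_rho C (g t) (K t) (E t) (u t) (rho t)) (at t within I) \<and>
        (e has_vector_derivative
           rhs_e C (g t) (K t) (E t) (u t) (rho t) (e t)) (at t within I))"

definition init_data ::
  "(real \<Rightarrow> real^3^3) \<Rightarrow> (real \<Rightarrow> real^3^3) \<Rightarrow> (real \<Rightarrow> real^3^3) \<Rightarrow>
   (real \<Rightarrow> real^3) \<Rightarrow> (real \<Rightarrow> real^3) \<Rightarrow> (real \<Rightarrow> real) \<Rightarrow> (real \<Rightarrow> real^3) \<Rightarrow>
   (real \<Rightarrow> real) \<Rightarrow> (real \<Rightarrow> real) \<Rightarrow>
   real^3^3 \<Rightarrow> real^3^3 \<Rightarrow> real^3^3 \<Rightarrow> real^3 \<Rightarrow> real^3 \<Rightarrow> real \<Rightarrow> real^3 \<Rightarrow> real \<Rightarrow> real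
   \<Rightarrow> bool" where
  "init_data g K F E u th00 th0 rho e g0 K0 F0 E0 U0 th00i th0i rho0 e0 \<longleftrightarrow>
     g 0 = g0 \<and> K 0 = K0 \<and> F 0 = F0 \<and> E 0 = E0 \<and> u 0 = U0 \<and>
     th00 0 = th00i \<and> th0 0 = th0i \<and> rho 0 = rho0 \<and> e 0 = e0"

end

theory Submission
  imports Defs
begin

text \<open>The constraints propagate: with \<open>a\<^sub>k = C\<^sup>i\<^sub>i\<^sub>k\<close>, the defect \<open>M\<close> of (C2) satisfies
  \<open>M' = H M\<close>, then the defect \<open>G\<close> of (C1) satisfies \<open>G' = 2 H G - 2 a \<cdot> M\<close>, and (C4)
  is a linear homogeneous equation as well. Outside type IX one has \<open>R \<le> 0\<close>, so (C1) gives
  \<open>H\<^sup>2 \<ge> 3 \<Lambda>\<close>; hence \<open>H\<close> stays negative, and it is nondecreasing, so \<open>\<bar>H\<bar> \<le> \<bar>H(0)\<bar>\<close>.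
  Through (C1) this bounds \<open>K\<close> relative to \<open>g\<close> and all the matter variables, on bounded time
  intervals. The quotient \<open>e / \<rho>\<close> satisfies a linear equation and is bounded; by (C4) the equation
  for \<open>\<rho>\<close> is then linear with bounded coefficient, which keeps \<open>\<rho>\<close> away from zero.
  A solution on a bounded interval therefore stays in a compact part of the phase space and
  can be continued.\<close>

subsection \<open>Autonomous ordinary differential equations\<close>

text \<open>The identities behind the propagation of the constraints are reduced to small matrix
  algebra. In dimension three the Lie algebra is a pair \<open>(S, a)\<close> with
  \<open>S a = 0\<close>, the Faraday tensor is \<open>sk f\<close> for a vector \<open>f\<close>,
  and in a \<open>g\<close>-orthonormal frame the Ricci tensor and its divergence become polynomials
  in the entries of \<open>S\<close> and \<open>a\<close>. The sign of \<open>R\<close> comes from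
  the same data: a definite \<open>S\<close> forces type IX, so otherwise \<open>S\<close> has an
  isotropic vector, and this sharpens Cauchy-Schwarz just enough to give
  \<open>(trace S)^2 <= 2 trace (S S)\<close>. The obstacle to continuation is \<open>rho\<close>,
  by which the system divides. Constraint (C1) controls only \<open>rho u0^2\<close>, so
  \<open>u\<close> is not bounded before \<open>rho\<close> is bounded below; and the equation for
  \<open>rho\<close> has an electric term without the factor \<open>rho\<close>. Until then only the
  ratios \<open>u / u0\<close> and \<open>e / rho\<close> are under control, and they suffice for
  the lower bound. The vector \<open>th0\<close> is read off from (C2) rather than from its
  evolution equation. (C3) enters as \<open>a . f = 0\<close>, which the propagation of (C2)
  needs.\<close>

text \<open>Picard iteration: the condition \<open>L * h <= 1/2\<close> makes the integral operator
  a contraction with factor 1/2, and boundedness of \<open>f\<close> keeps its values in the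
  complete space of bounded continuous curves.\<close>

lemma lipschitz_ode_short_time:
  fixes f :: "'a::euclidean_space \<Rightarrow> 'a"
  assumes lip: "L-lipschitz_on UNIV f" and bnd: "\<And>x. norm (f x) \<le> B"
    and h: "0 < h" "L * h \<le> 1/2"
  shows "\<exists>y. y 0 = x0 \<and> (\<forall>t\<in>{0..h}. (y has_vector_derivative f (y t)) (at t within {0..h}))"
proof -
  \<comment> \<open>Clamping time to \<open>{0..h}\<close> lets \<open>P\<close> act on curves
    defined on the whole line, so the Banach space \<open>bcontfun\<close> can be used as it is;
    outside \<open>{0..h}\<close> the image is constant.\<close>
  define c where "c = (\<lambda>t::real. max 0 (min h t))"
  have c_range: "c t \<in> {0..h}" for t using h by (auto simp: c_def)
  have cc: "continuous_on UNIV c" unfolding c_def by (intro continuous_intros)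
  have fc: "continuous_on UNIV f" by (rule lipschitz_on_continuous_on[OF lip])
  define P where "P = (\<lambda>(y::real \<Rightarrow>\<^sub>C 'a) t. x0 + integral {0..c t} (\<lambda>s. f (apply_bcontfun y s)))"
  have fy: "continuous_on S (\<lambda>s. f (apply_bcontfun y s))" for S y
    by (rule continuous_on_compose2[OF fc]) auto
  have iy: "(\<lambda>s. f (apply_bcontfun y s)) integrable_on {a..b}" for a b :: real and y
    by (rule integrable_continuous_real[OF fy])
  have P_cont: "continuous_on UNIV (P y)" for y
  proof -
    have "continuous_on {0..h} (\<lambda>u. integral {0..u} (\<lambda>s. f (apply_bcontfun y s)))"
      by (rule indefinite_integral_continuous_1[OF iy])
    then have "continuous_on UNIV (\<lambda>t. integral {0..c t} (\<lambda>s. f (apply_bcontfun y s)))"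
      by (rule continuous_on_compose2[OF _ cc]) (use c_range in auto)
    then show ?thesis unfolding P_def by (intro continuous_intros)
  qed
  have B0: "0 \<le> B" using bnd[of 0] norm_ge_zero order_trans by blast
  have P_bcont: "P y \<in> bcontfun" for y
  proof (rule bcontfun_normI[OF P_cont])
    fix t
    have "norm (integral {0..c t} (\<lambda>s. f (apply_bcontfun y s))) \<le> B * (c t - 0)"
      using c_range[of t] by (intro integral_bound fy bnd) auto
    also have "\<dots> \<le> B * h" using c_range[of t] B0 by (intro mult_left_mono) auto
    finally show "norm (P y t) \<le> norm x0 + B * h"
      unfolding P_def by (intro norm_triangle_le) simp
  qed
  have "\<exists>!y. Bcontfun (P y) = y"
  proof (rule banach_fix_type[of "1/2"]; (intro allI)?)
    fix y z :: "real \<Rightarrow>\<^sub>C 'a"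
    show "dist (Bcontfun (P y)) (Bcontfun (P z)) \<le> 1/2 * dist y z"
    proof (rule dist_bound)
      fix t
      have "P y t - P z t = integral {0..c t} (\<lambda>s. f (apply_bcontfun y s) - f (apply_bcontfun z s))"
        unfolding P_def by (simp add: integral_diff iy)
      also have "norm \<dots> \<le> (L * dist y z) * (c t - 0)"
      proof (rule integral_bound)
        fix s
        show "norm (f (apply_bcontfun y s) - f (apply_bcontfun z s)) \<le> L * dist y z"
          using lipschitz_onD[OF lip, of "apply_bcontfun y s" "apply_bcontfun z s"]
            mult_left_mono[OF dist_bounded[of y s z] lipschitz_on_nonneg[OF lip]]
          by (simp add: dist_norm)
      qed (use c_range[of t] in \<open>auto intro!: continuous_intros fy\<close>)
      also have "\<dots> \<le> (L * dist y z) * h"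
        using c_range[of t] lipschitz_on_nonneg[OF lip] by (intro mult_left_mono) auto
      also have "\<dots> \<le> 1/2 * dist y z"
        using mult_right_mono[OF h(2), of "dist y z"] by (simp add: algebra_simps)
      finally show "dist (apply_bcontfun (Bcontfun (P y)) t) (apply_bcontfun (Bcontfun (P z)) t) \<le> 1/2 * dist y z"
        by (simp add: Bcontfun_inverse P_bcont dist_norm)
    qed
  qed auto
  then obtain y where y: "Bcontfun (P y) = y" by auto
  have yP: "apply_bcontfun y t = x0 + integral {0..c t} (\<lambda>s. f (apply_bcontfun y s))" for t
    using Bcontfun_inverse[OF P_bcont[of y]] y unfolding P_def by metis
  have c_id: "c t = t" if "t \<in> {0..h}" for t using that by (auto simp: c_def)
  have "(apply_bcontfun y has_vector_derivative f (apply_bcontfun y t)) (at t within {0..h})"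
    if t: "t \<in> {0..h}" for t
  proof -
    have "((\<lambda>u. x0 + integral {0..u} (\<lambda>s. f (apply_bcontfun y s))) has_vector_derivative
        f (apply_bcontfun y t)) (at t within {0..h})"
      using integral_has_vector_derivative[OF fy t] by (auto intro!: derivative_eq_intros)
    then show ?thesis
      by (rule has_vector_derivative_transform[OF t, rotated])
        (metis yP c_id)
  qed
  moreover have "apply_bcontfun y 0 = x0" using yP[of 0] c_id[of 0] h by simp
  ultimately show ?thesis by blast
qed

lemma vector_derivative_bound_dist:
  fixes y :: "real \<Rightarrow> 'a::real_normed_vector"
  assumes "\<And>t. t \<in> {0..h} \<Longrightarrow> (y has_vector_derivative y' t) (at t within {0..h})"
    and "\<And>t. t \<in> {0..h} \<Longrightarrow> norm (y' t) \<le> B" and "t \<in> {0..h}"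
  shows "norm (y t - y 0) \<le> B * t"
proof -
  have "norm (y t - y 0) \<le> B * norm (t - 0)"
  proof (rule differentiable_bound[of "{0..h}" y "\<lambda>t u. u *\<^sub>R y' t"])
    show "onorm (\<lambda>u. u *\<^sub>R y' s) \<le> B" if "s \<in> {0..h}" for s
      using assms(2)[OF that] by (subst onorm_scaleR_left) (auto simp: onorm_id)
  qed (use assms in \<open>auto simp: has_vector_derivative_def\<close>)
  then show ?thesis using assms(3) by simp
qed

section \<open>Local solvability for locally Lipschitz vector fields\<close>

definition locally_lipschitz_on :: "'a::metric_space set \<Rightarrow> ('a \<Rightarrow> 'b::metric_space) \<Rightarrow> bool" where
  "locally_lipschitz_on U f \<longleftrightarrow> (\<forall>x\<in>U. \<exists>r>0. \<exists>L. L-lipschitz_on (cball x r \<inter> U) f)"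

lemma locally_lipschitz_on_ball:
  fixes f :: "'a::metric_space \<Rightarrow> 'b::metric_space"
  assumes "locally_lipschitz_on U f" "open U" "x \<in> U"
  obtains r L where "r > 0" "cball x r \<subseteq> U" "L-lipschitz_on (cball x r) f"
proof -
  obtain r L where 1: "r > 0" "L-lipschitz_on (cball x r \<inter> U) f"
    using assms unfolding locally_lipschitz_on_def by blast
  obtain s where 2: "s > 0" "cball x s \<subseteq> U"
    using assms open_contains_cball by blast
  show ?thesis
    by (rule that[of "min r s" L])
      (use 1 2 in \<open>auto intro!: lipschitz_on_subset[OF 1(2)]\<close>)
qed

text \<open>Composing with the nearest-point projection onto a ball makes a locally Lipschitz field
  globally Lipschitz and bounded without changing it on that ball.\<close>

lemma ode_uniform_short_time:
  fixes f :: "'a::euclidean_space \<Rightarrow> 'a"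
  assumes "locally_lipschitz_on U f" "open U" "p \<in> U"
  obtains d h where "d > 0" "h > 0"
    "\<And>q. q \<in> cball p d \<Longrightarrow> \<exists>y. y 0 = q \<and> (\<forall>t\<in>{0..h}. y t \<in> U \<and> (y has_vector_derivative f (y t)) (at t within {0..h}))"
proof -
  obtain r L where r: "r > 0" "cball p r \<subseteq> U" and L: "L-lipschitz_on (cball p r) f"
    by (rule locally_lipschitz_on_ball[OF assms])
  let ?K = "cball p r"
  have K: "convex ?K" "closed ?K" "?K \<noteq> {}" using r by auto
  define F where "F = f \<circ> closest_point ?K"
  have "continuous_on ?K f" by (rule lipschitz_on_continuous_on[OF L])
  then have "bounded (f ` ?K)"
    using compact_cball compact_continuous_image compact_imp_bounded by blast
  then obtain B where B: "B > 0" "\<And>x. x \<in> ?K \<Longrightarrow> norm (f x) \<le> B"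
    unfolding bounded_pos by auto
  have in_K: "closest_point ?K x \<in> ?K" for x
    by (rule closest_point_in_set[OF K(2,3)])
  have L0: "0 \<le> L" by (rule lipschitz_on_nonneg[OF L])
  have lipF: "L-lipschitz_on UNIV F"
  proof (rule lipschitz_onI[OF _ L0])
    fix x y :: 'a
    have "dist (F x) (F y) \<le> L * dist (closest_point ?K x) (closest_point ?K y)"
      unfolding F_def o_def by (rule lipschitz_onD[OF L in_K in_K])
    also have "\<dots> \<le> L * dist x y"
      by (intro mult_left_mono closest_point_lipschitz K L0)
    finally show "dist (F x) (F y) \<le> L * dist x y" .
  qed
  have bF: "norm (F x) \<le> B" for x using B(2)[OF in_K] by (simp add: F_def)
  \<comment> \<open>The first bound gives the contraction. The second keeps a curve of speed at most
    \<open>B\<close> within \<open>r / 2\<close> of its start, so from \<open>cball p (r/2)\<close>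
    it never leaves the ball on which \<open>F\<close> agrees with \<open>f\<close>. Neither depends
    on the starting point \<open>q\<close>.\<close>
  define h where "h = min (1 / (2 * (L + 1))) (r / (2 * B))"
  have h: "h > 0" unfolding h_def using L0 r B by auto
  have "L * h \<le> L * (1 / (2 * (L + 1)))" unfolding h_def using L0 by (intro mult_left_mono) auto
  also have "\<dots> \<le> 1/2" using L0 by (simp add: field_simps)
  finally have Lh: "L * h \<le> 1/2" .
  have Bh: "B * h \<le> r / 2"
    using mult_left_mono[of h "r / (2 * B)" B] B(1) unfolding h_def by simp
  show ?thesis
  proof (rule that[of "r/2" h])
    fix q assume q: "q \<in> cball p (r/2)"
    obtain y where y: "y 0 = q" "\<And>t. t \<in> {0..h} \<Longrightarrow> (y has_vector_derivative F (y t)) (at t within {0..h})"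
      using lipschitz_ode_short_time[OF lipF bF h Lh, of q] by blast
    have yK: "y t \<in> ?K" if "t \<in> {0..h}" for t
    proof -
      have "norm (y t - y 0) \<le> B * t"
        by (rule vector_derivative_bound_dist[OF y(2) bF that])
      also have "\<dots> \<le> B * h" using that B by (intro mult_left_mono) auto
      finally have "dist q (y t) \<le> r/2" using y(1) Bh by (simp add: dist_norm norm_minus_commute)
      then show ?thesis using q dist_triangle[of p "y t" q] by auto
    qed
    have "F (y t) = f (y t)" if "t \<in> {0..h}" for t
      using closest_point_self[OF yK[OF that]] by (simp add: F_def)
    then show "\<exists>y. y 0 = q \<and> (\<forall>t\<in>{0..h}. y t \<in> U \<and> (y has_vector_derivative f (y t)) (at t within {0..h}))"
      using y yK r by (intro exI[of _ y]) (auto simp: subset_iff)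
  qed (use r h in auto)
qed

section \<open>Differential inequalities for derivatives taken within an interval\<close>

lemma vderiv_nonpos_imp_antimono:
  fixes \<phi> :: "real \<Rightarrow> real"
  assumes I: "is_interval I" and d: "\<And>t. t \<in> I \<Longrightarrow> (\<phi> has_vector_derivative \<phi>' t) (at t within I)"
    and le: "\<And>t. t \<in> I \<Longrightarrow> \<phi>' t \<le> 0" and ab: "a \<in> I" "b \<in> I" "a \<le> b"
  shows "\<phi> b \<le> \<phi> a"
proof (cases "a = b")
  case False
  have sub: "{a..b} \<subseteq> I" using I ab unfolding is_interval_1 by (meson atLeastAtMost_iff subsetI)
  have "\<exists>x\<in>{a<..<b}. \<phi> b - \<phi> a = (\<lambda>u. u *\<^sub>R \<phi>' x) (b - a)"
  proof (rule mvt_simple)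
    show "(\<phi> has_derivative (\<lambda>u. u *\<^sub>R \<phi>' x)) (at x within {a..b})" if "a \<le> x" "x \<le> b" for x
      using has_vector_derivative_within_subset[OF d[of x] sub] sub that
      by (auto simp: has_vector_derivative_def)
  qed (use False ab in auto)
  then obtain x where x: "x \<in> {a<..<b}" "\<phi> b - \<phi> a = (b - a) * \<phi>' x" by auto
  then have "x \<in> I" using sub by auto
  then have "(b - a) * \<phi>' x \<le> 0" using le ab by (simp add: mult_nonneg_nonpos)
  then show ?thesis using x by simp
qed simp

lemma vderiv_nonneg_imp_mono:
  fixes \<phi> :: "real \<Rightarrow> real"
  assumes "is_interval I" "\<And>t. t \<in> I \<Longrightarrow> (\<phi> has_vector_derivative \<phi>' t) (at t within I)"
    and "\<And>t. t \<in> I \<Longrightarrow> \<phi>' t \<ge> 0" and "a \<in> I" "b \<in> I" "a \<le> b"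
  shows "\<phi> a \<le> \<phi> b"
proof -
  have "- \<phi> b \<le> - \<phi> a"
    by (rule vderiv_nonpos_imp_antimono[OF assms(1), of "\<lambda>t. - \<phi> t" "\<lambda>t. - \<phi>' t"])
      (use assms in \<open>auto intro: has_vector_derivative_minus\<close>)
  then show ?thesis by simp
qed

lemma exp_weight_vderiv:
  fixes \<phi> :: "real \<Rightarrow> real"
  assumes "(\<phi> has_vector_derivative d) (at t within I)"
  shows "((\<lambda>t. exp (k * t) * \<phi> t) has_vector_derivative exp (k * t) * (k * \<phi> t + d)) (at t within I)"
  using assms unfolding has_real_derivative_iff_has_vector_derivative[symmetric]
  by (auto intro!: derivative_eq_intros simp: algebra_simps)

lemma vderiv_ge_imp_exp_lower:
  fixes \<phi> :: "real \<Rightarrow> real"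
  assumes I: "is_interval I" and d: "\<And>t. t \<in> I \<Longrightarrow> (\<phi> has_vector_derivative \<phi>' t) (at t within I)"
    and ge: "\<And>t. t \<in> I \<Longrightarrow> \<phi>' t \<ge> - (k * \<phi> t)" and ab: "a \<in> I" "b \<in> I" "a \<le> b"
  shows "exp (k * a) * \<phi> a \<le> exp (k * b) * \<phi> b"
proof (rule vderiv_nonneg_imp_mono[OF I _ _ ab])
  show "exp (k * t) * (k * \<phi> t + \<phi>' t) \<ge> 0" if "t \<in> I" for t
    using ge[OF that] by simp
qed (rule exp_weight_vderiv[OF d])

lemma vderiv_le_imp_exp_upper:
  fixes \<phi> :: "real \<Rightarrow> real"
  assumes I: "is_interval I" and d: "\<And>t. t \<in> I \<Longrightarrow> (\<phi> has_vector_derivative \<phi>' t) (at t within I)"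
    and le: "\<And>t. t \<in> I \<Longrightarrow> \<phi>' t \<le> k * \<phi> t" and ab: "a \<in> I" "b \<in> I" "a \<le> b"
  shows "exp (- k * b) * \<phi> b \<le> exp (- k * a) * \<phi> a"
proof (rule vderiv_nonpos_imp_antimono[OF I _ _ ab])
  show "exp (- k * t) * (- k * \<phi> t + \<phi>' t) \<le> 0" if "t \<in> I" for t
    using le[OF that] by (simp add: mult_le_0_iff)
qed (rule exp_weight_vderiv[OF d])

text \<open>The bound is on the absolute value of \<open>D'\<close>, so vanishing spreads from
  \<open>a\<close> in both time directions: forward with the weight \<open>exp (- k * t)\<close>,
  backward with \<open>exp (k * t)\<close>.\<close>

lemma gronwall_zero:
  fixes D :: "real \<Rightarrow> real"
  assumes I: "is_interval I" and d: "\<And>t. t \<in> I \<Longrightarrow> (D has_vector_derivative D' t) (at t within I)"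
    and b: "\<And>t. t \<in> I \<Longrightarrow> \<bar>D' t\<bar> \<le> k * D t" and D: "\<And>t. t \<in> I \<Longrightarrow> 0 \<le> D t"
    and ab: "a \<in> I" "D a = 0" "t \<in> I"
  shows "D t = 0"
proof (cases "a \<le> t")
  case True
  have "exp (- k * t) * D t \<le> exp (- k * a) * D a"
    by (rule vderiv_le_imp_exp_upper[OF I d _ ab(1,3) True]) (use b in \<open>auto simp: abs_le_iff\<close>)
  then show ?thesis using D[OF ab(3)] ab(2) by (simp add: mult_le_0_iff)
next
  case False
  have "exp (k * t) * D t \<le> exp (k * a) * D a"
    by (rule vderiv_ge_imp_exp_lower[OF I d _ ab(3,1)]) (use False b in \<open>force simp: abs_le_iff\<close>)+
  then show ?thesis using D[OF ab(3)] ab(2) by (simp add: mult_le_0_iff)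
qed

section \<open>Uniqueness, continuation and global existence\<close>

definition ode_solution :: "('a::real_normed_vector \<Rightarrow> 'a) \<Rightarrow> 'a set \<Rightarrow> 'a \<Rightarrow> real set \<Rightarrow> (real \<Rightarrow> 'a) \<Rightarrow> bool" where
  "ode_solution f U x0 I x \<longleftrightarrow> x 0 = x0 \<and> (\<forall>t\<in>I. x t \<in> U \<and> (x has_vector_derivative f (x t)) (at t within I))"

lemma ode_solution_subset:
  assumes "ode_solution f U x0 I x" "J \<subseteq> I"
  shows "ode_solution f U x0 J x"
  using assms unfolding ode_solution_def by (meson has_vector_derivative_within_subset subsetD)

text \<open>The coincidence set is closed by continuity and relatively open by Gronwall applied to
  the squared distance, since near a common value both curves lie in a ball with a Lipschitz
  constant. Connectedness of the interval does the rest.\<close>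

lemma ode_solution_unique:
  fixes f :: "'a::euclidean_space \<Rightarrow> 'a"
  assumes ll: "locally_lipschitz_on U f" and U: "open U" and I: "is_interval I" "0 \<in> I"
    and x: "ode_solution f U x0 I x" and y: "ode_solution f U x0 I y" and t: "t \<in> I"
  shows "x t = y t"
proof -
  define D where "D = (\<lambda>t. (x t - y t) \<bullet> (x t - y t))"
  define D' where "D' = (\<lambda>t. 2 * ((x t - y t) \<bullet> (f (x t) - f (y t))))"
  have dx: "\<And>t. t \<in> I \<Longrightarrow> (x has_vector_derivative f (x t)) (at t within I)"
    and dy: "\<And>t. t \<in> I \<Longrightarrow> (y has_vector_derivative f (y t)) (at t within I)"
    and xU: "\<And>t. t \<in> I \<Longrightarrow> x t \<in> U" and xy0: "x 0 = y 0"
    using x y by (auto simp: ode_solution_def)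
  have D_d: "(D has_vector_derivative D' t) (at t within I)" if "t \<in> I" for t
  proof -
    have "((\<lambda>t. x t - y t) has_vector_derivative f (x t) - f (y t)) (at t within I)"
      by (intro has_vector_derivative_diff dx dy that)
    from bounded_bilinear.has_vector_derivative[OF bounded_bilinear_inner this this]
    show ?thesis unfolding D_def D'_def by (simp add: inner_commute)
  qed
  have cx: "continuous_on I x" and cy: "continuous_on I y"
    unfolding continuous_on_eq_continuous_within
    by (blast intro: has_vector_derivative_continuous dx dy)+
  define Z where "Z = {t\<in>I. D t = 0}"
  have D0: "D t = 0 \<longleftrightarrow> x t = y t" for t by (simp add: D_def)
  have "closedin (top_of_set I) Z"
  proof -
    have "continuous_on I D" unfolding D_def by (intro continuous_intros cx cy)
    from continuous_closedin_preimage_constant[OF this, of 0] show ?thesis by (simp add: Z_def)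
  qed
  moreover have "openin (top_of_set I) Z"
    unfolding openin_euclidean_subtopology_iff
  proof (intro conjI ballI)
    show "Z \<subseteq> I" by (auto simp: Z_def)
    fix s assume s: "s \<in> Z"
    then have sI: "s \<in> I" and xs: "x s = y s" by (auto simp: Z_def D0)
    obtain r L where r: "r > 0" and L: "L-lipschitz_on (cball (x s) r) f"
      using locally_lipschitz_on_ball[OF ll U xU[OF sI]] by metis
    obtain d1 where d1: "d1 > 0" "\<And>t. t \<in> I \<Longrightarrow> dist t s < d1 \<Longrightarrow> dist (x t) (x s) < r"
      using cx sI r unfolding continuous_on_iff by metis
    obtain d2 where d2: "d2 > 0" "\<And>t. t \<in> I \<Longrightarrow> dist t s < d2 \<Longrightarrow> dist (y t) (y s) < r"
      using cy sI r unfolding continuous_on_iff by metis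
    define J where "J = I \<inter> ball s (min d1 d2)"
    have J: "is_interval J" unfolding J_def
      by (intro is_interval_Int I(1)) (simp add: is_interval_ball_real)
    have "D t = 0" if "t \<in> J" for t
    proof (rule gronwall_zero[OF J, of D D' "2 * L" s])
      fix t assume t: "t \<in> J"
      then have tI: "t \<in> I" by (simp add: J_def)
      show "(D has_vector_derivative D' t) (at t within J)"
        by (rule has_vector_derivative_within_subset[OF D_d[OF tI]]) (simp add: J_def)
      have "x t \<in> cball (x s) r" "y t \<in> cball (x s) r"
        using d1(2)[OF tI] d2(2)[OF tI] t xs by (auto simp: J_def dist_commute)
      then have "norm (f (x t) - f (y t)) \<le> L * norm (x t - y t)"
        by (rule lipschitz_on_normD[OF L])
      then have "\<bar>(x t - y t) \<bullet> (f (x t) - f (y t))\<bar> \<le> norm (x t - y t) * (L * norm (x t - y t))"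
        using Cauchy_Schwarz_ineq2 mult_left_mono norm_ge_zero order_trans by meson
      then show "\<bar>D' t\<bar> \<le> 2 * L * D t"
        by (simp add: D_def D'_def abs_mult power2_norm_eq_inner[symmetric] power2_eq_square mult.left_commute)
    qed (use that sI d1 d2 s in \<open>auto simp: J_def Z_def D_def\<close>)
    then show "\<exists>e>0. \<forall>t\<in>I. dist t s < e \<longrightarrow> t \<in> Z"
      using d1 d2 by (intro exI[of _ "min d1 d2"]) (auto simp: J_def Z_def dist_commute)
  qed
  moreover have "0 \<in> Z" using I xy0 by (simp add: Z_def D0)
  ultimately have "Z = I"
    using is_interval_connected[OF I(1)] unfolding connected_clopen by blast
  then show ?thesis using t D0 by (auto simp: Z_def)
qed

lemma ode_solution_extend:
  fixes f :: "'a::euclidean_space \<Rightarrow> 'a"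
  assumes ll: "locally_lipschitz_on U f" and U: "open U" and T: "T > 0"
    and x: "ode_solution f U x0 {0..<T} x" and K: "compact K" "K \<subseteq> U" "x ` {0..<T} \<subseteq> K"
  shows "\<exists>T'>T. \<exists>y. ode_solution f U x0 {0..<T'} y"
proof -
  define \<tau> where "\<tau> = (\<lambda>n. T - T / real (Suc n))"
  have \<tau>: "\<tau> n \<in> {0..<T}" for n using T by (auto simp: \<tau>_def field_simps)
  have "(\<lambda>n. T / real (Suc n)) \<longlonglongrightarrow> 0"
    using tendsto_mult_right_zero[OF LIMSEQ_inverse_real_of_nat, of T] by (simp add: divide_inverse)
  then have \<tau>_lim: "\<tau> \<longlonglongrightarrow> T" unfolding \<tau>_def using tendsto_diff[OF tendsto_const, of _ 0 sequentially T] by fastforce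
  have "\<forall>n. x (\<tau> n) \<in> K" using \<tau> K by blast
  then obtain p \<sigma> where p: "p \<in> K" and \<sigma>: "strict_mono (\<sigma>::nat \<Rightarrow> nat)" "((\<lambda>n. x (\<tau> n)) \<circ> \<sigma>) \<longlonglongrightarrow> p"
    using K(1) unfolding compact_def by metis
  obtain d h where dh: "d > 0" "h > 0" and loc: "\<And>q. q \<in> cball p d \<Longrightarrow> \<exists>y. y 0 = q \<and>
      (\<forall>t\<in>{0..h}. y t \<in> U \<and> (y has_vector_derivative f (y t)) (at t within {0..h}))"
    using ode_uniform_short_time[OF ll U, of p] p K(2) by blast
  have "eventually (\<lambda>n. dist (((\<lambda>n. x (\<tau> n)) \<circ> \<sigma>) n) p < d) sequentially"
    using \<sigma>(2) dh(1) by (rule tendstoD)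
  moreover have "eventually (\<lambda>n. dist ((\<tau> \<circ> \<sigma>) n) T < h) sequentially"
    by (rule tendstoD[OF LIMSEQ_subseq_LIMSEQ[OF \<tau>_lim \<sigma>(1)] dh(2)])
  ultimately have "eventually (\<lambda>n. dist (((\<lambda>n. x (\<tau> n)) \<circ> \<sigma>) n) p < d \<and> dist ((\<tau> \<circ> \<sigma>) n) T < h) sequentially"
    by eventually_elim auto
  then obtain n where n: "dist (x (\<tau> (\<sigma> n))) p < d" "dist (\<tau> (\<sigma> n)) T < h"
    unfolding eventually_sequentially by auto
  define s where "s = \<tau> (\<sigma> n)"
  have s: "0 \<le> s" "s < T" "T < s + h" "x s \<in> cball p d"
    using n \<tau>[of "\<sigma> n"] by (auto simp: s_def dist_real_def dist_commute)
  obtain y where y0: "y 0 = x s" and y: "\<And>t. t \<in> {0..h} \<Longrightarrow> y t \<in> U"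
      "\<And>t. t \<in> {0..h} \<Longrightarrow> (y has_vector_derivative f (y t)) (at t within {0..h})"
    using loc[OF s(4)] by blast
  define z where "z = (\<lambda>t. if t \<in> {0..s} then x t else y (t - s))"
  have y': "((\<lambda>t. y (t - s)) has_vector_derivative f (y (t - s))) (at t within {s..<s+h})"
    if "t \<in> {s..s+h}" for t
  proof -
    have "(y has_vector_derivative f (y (t - s))) (at (t - s) within (\<lambda>t. t - s) ` {s..<s+h})"
      by (rule has_vector_derivative_within_subset[OF y(2)]) (use that in auto)
    moreover have "((\<lambda>t. t - s) has_vector_derivative 1) (at t within {s..<s+h})"
      by (auto intro!: derivative_eq_intros)
    ultimately show ?thesis
      using vector_diff_chain_within[of "\<lambda>t. t - s" 1 t "{s..<s+h}" y "f (y (t - s))"] by (simp add: o_def)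
  qed
  have xd: "(x has_vector_derivative f (x t)) (at t within {0..s})" if "t \<in> {0..s}" for t
  proof -
    have "(x has_vector_derivative f (x t)) (at t within {0..<T})"
      using x s that unfolding ode_solution_def by auto
    then show ?thesis by (rule has_vector_derivative_within_subset) (use s in auto)
  qed
  have zd: "(z has_vector_derivative (if t \<in> {0..s} then f (x t) else f (y (t - s)))) (at t within {0..<s+h})"
    if t: "t \<in> {0..<s+h}" for t
    unfolding z_def
  proof (rule has_vector_derivative_If_within_closures[where S="{0..s}" and T="{s<..<s+h}"])
    show "t \<in> {0..s} \<union> {s<..<s+h}" "{0..<s+h} = {0..s} \<union> {s<..<s+h}" using t s dh by auto
    show "((\<lambda>t. y (t - s)) has_vector_derivative f (y (t - s)))
        (at t within {s<..<s+h} \<union> closure {0..s} \<inter> closure {s<..<s+h})"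
      if "t \<in> {s<..<s+h} \<union> closure {0..s} \<inter> closure {s<..<s+h}"
      by (rule has_vector_derivative_within_subset[OF y']) (use that s dh in auto)
    show "(x has_vector_derivative f (x t)) (at t within {0..s} \<union> closure {0..s} \<inter> closure {s<..<s+h})"
      if "t \<in> {0..s} \<union> closure {0..s} \<inter> closure {s<..<s+h}"
      by (rule has_vector_derivative_within_subset[OF xd]) (use that s dh in auto)
    assume "t \<in> closure {0..s}" "t \<in> closure {s<..<s+h}"
    then have "t = s" using dh by auto
    then show "x t = y (t - s)" "f (x t) = f (y (t - s))" using y0 by auto
  qed
  have "ode_solution f U x0 {0..<s+h} z"
    unfolding ode_solution_def
  proof (intro conjI ballI)
    show "z 0 = x0" using x s by (simp add: z_def ode_solution_def)
    fix t assume t: "t \<in> {0..<s+h}"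
    show "z t \<in> U" using t x y(1)[of "t - s"] s by (auto simp: z_def ode_solution_def)
    show "(z has_vector_derivative f (z t)) (at t within {0..<s+h})"
      using zd[OF t] by (simp add: z_def if_distrib)
  qed
  then show ?thesis using s by blast
qed

lemma ode_solution_local:
  fixes f :: "'a::euclidean_space \<Rightarrow> 'a"
  assumes "locally_lipschitz_on U f" "open U" "x0 \<in> U"
  shows "\<exists>T>0. \<exists>x. ode_solution f U x0 {0..<T} x"
proof -
  obtain d h where "d > 0" "h > 0" and loc: "\<And>q. q \<in> cball x0 d \<Longrightarrow> \<exists>y. y 0 = q \<and>
      (\<forall>t\<in>{0..h}. y t \<in> U \<and> (y has_vector_derivative f (y t)) (at t within {0..h}))"
    using ode_uniform_short_time[OF assms] by blast
  then obtain y where "y 0 = x0"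
      "\<forall>t\<in>{0..h}. y t \<in> U \<and> (y has_vector_derivative f (y t)) (at t within {0..h})"
    using loc[of x0] by (meson centre_in_cball less_imp_le)
  then have "ode_solution f U x0 {0..h} y" by (simp add: ode_solution_def)
  then have "ode_solution f U x0 {0..<h} y" by (rule ode_solution_subset) auto
  then show ?thesis using \<open>h > 0\<close> by blast
qed

lemma ode_solution_glue:
  fixes f :: "'a::euclidean_space \<Rightarrow> 'a"
  assumes ll: "locally_lipschitz_on U f" and U: "open U"
    and S: "\<And>T. T \<in> S \<Longrightarrow> T > 0 \<and> ode_solution f U x0 {0..<T} (X T)"
    and I: "I = (\<Union>T\<in>S. {0..<T})" "S \<noteq> {}"
  shows "\<exists>x. ode_solution f U x0 I x"
proof -
  have eq: "X T t = X T' t" if "T \<in> S" "T' \<in> S" "t \<in> {0..<T}" "t \<in> {0..<T'}" for T T' t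
  proof (rule ode_solution_unique[OF ll U, of "{0..<min T T'}"])
    show "ode_solution f U x0 {0..<min T T'} (X T)" "ode_solution f U x0 {0..<min T T'} (X T')"
      using S[OF that(1)] S[OF that(2)] by (auto elim!: ode_solution_subset)
  qed (use that S in \<open>auto simp: is_interval_co\<close>)
  define \<theta> where "\<theta> = (\<lambda>t. SOME T. T \<in> S \<and> t \<in> {0..<T})"
  have \<theta>: "\<theta> t \<in> S" "t \<in> {0..<\<theta> t}" if "t \<in> I" for t
    using someI_ex[of "\<lambda>T. T \<in> S \<and> t \<in> {0..<T}"] that I unfolding \<theta>_def by auto
  define x where "x = (\<lambda>t. X (\<theta> t) t)"
  have xX: "x t = X T t" if "T \<in> S" "t \<in> {0..<T}" for T t
    unfolding x_def by (rule eq) (use that \<theta>[of t] I in auto)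
  obtain T0 where T0: "T0 \<in> S" using I by auto
  have "ode_solution f U x0 I x"
    unfolding ode_solution_def
  proof (intro conjI ballI)
    show "x 0 = x0" using xX[OF T0, of 0] S[OF T0] by (auto simp: ode_solution_def)
    fix t assume "t \<in> I"
    then obtain T where T: "T \<in> S" "t \<in> {0..<T}" using I by auto
    show "x t \<in> U" using xX[OF T] S[OF T(1)] T by (auto simp: ode_solution_def)
    have "(X T has_vector_derivative f (x t)) (at t within {0..<T})"
      using xX[OF T] S[OF T(1)] T by (auto simp: ode_solution_def)
    then have "(x has_vector_derivative f (x t)) (at t within {0..<T})"
      by (rule has_vector_derivative_transform[OF T(2), rotated]) (use xX[OF T(1)] in auto)
    \<comment> \<open>Both sets have the same points below \<open>T\<close>, and
      \<open>{..<T}\<close> is a neighbourhood of \<open>t\<close>.\<close>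
    moreover have "at t within {0..<T} = at t within I"
    proof (rule at_within_nhd[of t "{..<T}"])
      show "{0..<T} \<inter> {..<T} - {t} = I \<inter> {..<T} - {t}" using I T by force
    qed (use T in auto)
    ultimately show "(x has_vector_derivative f (x t)) (at t within I)" by simp
  qed
  then show ?thesis by blast
qed

text \<open>If the existence times were bounded, gluing would produce a solution up to their
  supremum, and the compact set supplied by \<open>apriori\<close> would allow it to be continued
  further.\<close>

theorem ode_solution_global:
  fixes f :: "'a::euclidean_space \<Rightarrow> 'a"
  assumes ll: "locally_lipschitz_on U f" and U: "open U" "x0 \<in> U"
    and apriori: "\<And>T x. T > 0 \<Longrightarrow> ode_solution f U x0 {0..<T} x \<Longrightarrow>
      \<exists>K. compact K \<and> K \<subseteq> U \<and> x ` {0..<T} \<subseteq> K"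
  shows "\<exists>x. ode_solution f U x0 {0..} x"
proof -
  define S where "S = {T. T > 0 \<and> (\<exists>x. ode_solution f U x0 {0..<T} x)}"
  define X where "X = (\<lambda>T. SOME x. ode_solution f U x0 {0..<T} x)"
  have X: "T > 0 \<and> ode_solution f U x0 {0..<T} (X T)" if "T \<in> S" for T
    using that someI_ex[of "ode_solution f U x0 {0..<T}"] unfolding S_def X_def by blast
  obtain T0 where T0: "T0 \<in> S" using ode_solution_local[OF ll U] unfolding S_def by blast
  then have S_ne: "S \<noteq> {}" by blast
  have "\<not> bdd_above S"
  proof
    assume bdd: "bdd_above S"
    define T where "T = Sup S"
    have UN: "{0..<T} = (\<Union>T\<in>S. {0..<T})"
    proof (intro set_eqI)
      show "t \<in> {0..<T} \<longleftrightarrow> t \<in> (\<Union>T\<in>S. {0..<T})" for t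
        using less_cSup_iff[OF S_ne bdd, of t] unfolding T_def by simp
    qed
    obtain x where x: "ode_solution f U x0 {0..<T} x"
      using ode_solution_glue[OF ll U(1) X UN S_ne] by blast
    have "T > 0" using cSup_upper[OF T0 bdd] X[OF T0] unfolding T_def by linarith
    then obtain K where "compact K" "K \<subseteq> U" "x ` {0..<T} \<subseteq> K"
      using apriori[OF _ x] by blast
    then obtain T' y where y: "T' > T" "ode_solution f U x0 {0..<T'} y"
      using ode_solution_extend[OF ll U(1) \<open>T > 0\<close> x] by blast
    then have "T' \<in> S" using \<open>T > 0\<close> unfolding S_def mem_Collect_eq by (meson order_less_trans)
    then show False using cSup_upper[OF _ bdd] y(1) unfolding T_def by (meson leD)
  qed
  have UN: "{0..} = (\<Union>T\<in>S. {0..<T})"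
  proof (intro set_eqI)
    show "t \<in> {0..} \<longleftrightarrow> t \<in> (\<Union>T\<in>S. {0..<T})" for t
      using \<open>\<not> bdd_above S\<close> unfolding bdd_above_def by (simp add: not_le)
  qed
  show ?thesis
    by (rule ode_solution_glue[OF ll U(1) X UN S_ne])
qed

text \<open>These simplification rules would turn \<open>transpose A *v x\<close> into
  \<open>x v* A\<close>; the calculations below keep the transposed matrix visible so that
  \<open>dot_transpose\<close> can move it across an inner product.\<close>

declare transpose_matrix_vector [simp del] vector_transpose_matrix [simp del]

subsection \<open>Matrix algebra\<close>

interpretation mm: bounded_bilinear "(**) :: real^3^3 \<Rightarrow> real^3^3 \<Rightarrow> real^3^3"
  unfolding bilinear_conv_bounded_bilinear[symmetric] bilinear_def linear_iff
  by (auto simp: matrix_add_ldistrib matrix_matrix_mult_def vec_eq_iff sum_distrib_left sum.distrib algebra_simps)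

interpretation mv: bounded_bilinear "(*v) :: real^3^3 \<Rightarrow> real^3 \<Rightarrow> real^3"
  unfolding bilinear_conv_bounded_bilinear[symmetric] bilinear_def linear_iff
  by (auto simp: matrix_vector_mult_def vec_eq_iff sum_distrib_left sum.distrib algebra_simps)

interpretation cr: bounded_bilinear "cross3"
  using bilinear_cross by (simp add: bilinear_conv_bounded_bilinear)

lemma linear_transpose: "linear (transpose :: real^3^3 \<Rightarrow> real^3^3)"
  by (auto simp: linear_iff transpose_def vec_eq_iff)

lemma linear_trace: "linear (trace :: real^3^3 \<Rightarrow> real)"
  by (auto simp: linear_iff trace_def sum.distrib sum_distrib_left)

text \<open>The cross-product matrix, that is, the usual identification of vectors with
  antisymmetric matrices of size three. It serves both the structure constants and the Faraday
  tensor.\<close>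

definition sk :: "real^3 \<Rightarrow> real^3^3" where
  "sk v = (\<chi> i j. cross3 v (axis j 1) $ i)"

lemmas comp3 = vec_eq_iff forall_3 sum_3 matrix_matrix_mult_def matrix_vector_mult_def transpose_def
  cross_components inner_vec_def trace_def det_3 sk_def axis_def mat_def

lemma sk_mult: "sk v *v w = cross3 v w"
  by (simp add: comp3 algebra_simps)

lemma linear_sk: "linear sk"
  by (simp add: linear_iff comp3 algebra_simps)

lemmas mat_linear = mm.add_left mm.add_right mm.diff_left mm.diff_right mm.minus_left mm.minus_right
  mm.scaleR_left mm.scaleR_right mv.add_left mv.add_right mv.diff_left mv.diff_right mv.minus_left
  mv.minus_right mv.scaleR_left mv.scaleR_right
  linear_add[OF linear_transpose] linear_diff[OF linear_transpose] linear_neg[OF linear_transpose]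
  linear_scale[OF linear_transpose] linear_add[OF linear_trace] linear_diff[OF linear_trace]
  linear_neg[OF linear_trace] linear_scale[OF linear_trace]
  linear_add[OF linear_sk] linear_diff[OF linear_sk] linear_neg[OF linear_sk] linear_scale[OF linear_sk]

lemma transpose_sk: "transpose (sk v) = - sk v"
  by (simp add: comp3)

lemma dot_transpose: "(transpose A *v x) \<bullet> y = x \<bullet> (A *v y)" for A :: "real^3^3"
  by (simp add: dot_lmul_matrix transpose_matrix_vector)

lemma dot_transpose': "x \<bullet> (transpose A *v y) = (A *v x) \<bullet> y" for A :: "real^3^3"
  by (metis dot_transpose inner_commute)

lemma trace_transpose: "trace (transpose A) = trace A" for A :: "real^3^3"
  by (simp add: trace_def transpose_def)

lemma trace_cyclic3: "trace (A ** B ** C) = trace (C ** A ** B)" for A B C :: "real^3^3"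
  by (metis matrix_mul_assoc trace_mul_sym)

lemma trace_sk_symmetric: "transpose A = A \<Longrightarrow> trace (sk v ** A) = 0"
  using trace_transpose[of "sk v ** A"] trace_mul_sym[of A "sk v"]
  by (simp add: matrix_transpose_mul transpose_sk mat_linear)

lemma matrix_inv_eqI:
  fixes A B :: "real^'n^'n"
  assumes "A ** B = mat 1" "B ** A = mat 1"
  shows "matrix_inv A = B"
proof -
  have "A ** matrix_inv A = mat 1 \<and> matrix_inv A ** A = mat 1"
    unfolding matrix_inv_def by (rule someI[of _ B]) (use assms in simp)
  then show ?thesis using assms by (metis matrix_mul_assoc matrix_mul_lid matrix_mul_rid)
qed

definition outer :: "real^3 \<Rightarrow> real^3 \<Rightarrow> real^3^3" where
  "outer x y = (\<chi> i j. x $ i * y $ j)"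

lemma outer_mult: "outer x y *v z = (y \<bullet> z) *\<^sub>R x"
  by (simp add: outer_def comp3 algebra_simps)

lemma trace_mult_outer: "trace (A ** outer x y) = y \<bullet> (A *v x)"
  by (simp add: outer_def comp3 algebra_simps)

lemma inner_outer: "A \<bullet> outer x y = x \<bullet> (A *v y)" for A :: "real^3^3"
  by (simp add: outer_def comp3 algebra_simps)

lemma sk_sk: "sk a ** sk b = outer b a - (a \<bullet> b) *\<^sub>R mat 1"
  by (simp add: comp3 outer_def algebra_simps)

text \<open>This is \<open>det (A x, A y, A z) = det A * det (x, y, z)\<close> read as an identity
  of bilinear forms in the two remaining vectors.\<close>

lemma transpose_sk_conj: "transpose A ** sk (A *v x) ** A = det A *\<^sub>R sk x"
  by (simp add: comp3 algebra_simps)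

lemma matrix_component: "A $ i $ j = axis i 1 \<bullet> (A *v axis j 1)" for A :: "real^3^3"
  by (simp add: matrix_vector_mult_basis column_def inner_axis')

lemma symm_iff_transpose: "symm M \<longleftrightarrow> transpose M = M"
  by (auto simp: symm_def transpose_def vec_eq_iff)

lemma antisymm_iff_transpose: "antisymm M \<longleftrightarrow> transpose M = - M"
  by (auto simp: antisymm_def transpose_def vec_eq_iff)

lemma quadratic_form_eq: "(\<Sum>i\<in>UNIV. \<Sum>j\<in>UNIV. x $ i * M $ i $ j * y $ j) = x \<bullet> (M *v y)"
  for M :: "real^3^3"
  by (simp add: comp3 algebra_simps)

lemma posdef_iff: "posdef M \<longleftrightarrow> transpose M = M \<and> (\<forall>x. x \<noteq> 0 \<longrightarrow> x \<bullet> (M *v x) > 0)"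
  by (simp add: posdef_def symm_iff_transpose quadratic_form_eq)

subsection \<open>Orthonormal frames\<close>

text \<open>\<open>P\<close> sends a vector to its coordinates in a \<open>g\<close>-orthonormal
  basis; the columns of \<open>Q\<close> are that basis.\<close>

definition frame :: "real^3^3 \<Rightarrow> real^3^3 \<Rightarrow> real^3^3 \<Rightarrow> bool" where
  "frame g P Q \<longleftrightarrow> g = transpose P ** P \<and> P ** Q = mat 1 \<and> Q ** P = mat 1"

text \<open>Cholesky factorization written out for size three; positivity on suitable test vectors
  makes each pivot positive.\<close>

lemma posdef_frame:
  assumes "posdef g"
  obtains P Q where "frame g P Q"
proof -
  have sym: "g $ 2 $ 1 = g $ 1 $ 2" "g $ 3 $ 1 = g $ 1 $ 3" "g $ 3 $ 2 = g $ 2 $ 3"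
    using assms by (auto simp: posdef_def symm_def)
  have q: "x \<noteq> 0 \<Longrightarrow> x \<bullet> (g *v x) > 0" for x using assms by (simp add: posdef_iff)
  define a where "a = sqrt (g $ 1 $ 1)"
  have "g $ 1 $ 1 > 0" using q[of "axis 1 1"] by (simp add: comp3)
  then have a: "a > 0" "a * a = g $ 1 $ 1" by (auto simp: a_def)
  define b where "b = g $ 1 $ 2 / a"
  define c where "c = g $ 1 $ 3 / a"
  have bc: "a * b = g $ 1 $ 2" "a * c = g $ 1 $ 3" using a by (auto simp: b_def c_def)
  \<comment> \<open>The first row of the intended triangular \<open>P\<close> annihilates this
    vector, so the form on it is \<open>a * a\<close> times the second pivot.\<close>
  have "vector [-b, a, 0] \<noteq> (0::real^3)" using a by (simp add: vec_eq_iff forall_3)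
  from q[OF this] have "a * a * (g $ 2 $ 2 - b * b) > 0"
    by (simp add: comp3 sym bc[symmetric] a(2)[symmetric] algebra_simps)
  then have "g $ 2 $ 2 - b * b > 0" by (rule zero_less_mult_pos) (simp add: a(1))
  define d where "d = sqrt (g $ 2 $ 2 - b * b)"
  have d: "d > 0" "d * d = g $ 2 $ 2 - b * b"
    using \<open>g $ 2 $ 2 - b * b > 0\<close> by (auto simp: d_def)
  define e where "e = (g $ 2 $ 3 - b * c) / d"
  have e: "d * e = g $ 2 $ 3 - b * c" using d by (simp add: e_def)
  have g22: "g $ 2 $ 2 = d * d + b * b" and g23: "g $ 2 $ 3 = d * e + b * c" using d e by auto
  \<comment> \<open>Annihilated by the first two rows of \<open>P\<close>, so that only the third
    pivot is seen.\<close>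
  have "vector [b * e - c * d, - (a * e), a * d] \<noteq> (0::real^3)" using a d by (simp add: vec_eq_iff forall_3)
  from q[OF this] have "(a * d) * (a * d) * (g $ 3 $ 3 - c * c - e * e) > 0"
    by (simp add: comp3 sym bc[symmetric] a(2)[symmetric] g22 g23 algebra_simps)
  then have "g $ 3 $ 3 - c * c - e * e > 0" by (rule zero_less_mult_pos) (simp add: a(1) d(1))
  define k where "k = sqrt (g $ 3 $ 3 - c * c - e * e)"
  have k: "k > 0" "k * k = g $ 3 $ 3 - c * c - e * e"
    using \<open>g $ 3 $ 3 - c * c - e * e > 0\<close> by (auto simp: k_def)
  define P where "P = (vector [vector [a, b, c], vector [0, d, e], vector [0, 0, k]] :: real^3^3)"
  have gP: "g = transpose P ** P"
    by (simp add: P_def comp3 sym bc a g22 g23 k algebra_simps)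
  have "det P = a * d * k" by (simp add: P_def det_3)
  then have "invertible P" using a d k by (simp add: invertible_det_nz)
  then obtain Q where "P ** Q = mat 1" "Q ** P = mat 1" by (auto simp: invertible_def)
  then show ?thesis using gP that by (simp add: frame_def)
qed

lemma frame_metric_inv:
  assumes "frame g P Q"
  shows "g ** (Q ** transpose Q) = mat 1" "Q ** transpose Q ** g = mat 1"
proof -
  have PQ: "P ** Q = mat 1" "Q ** P = mat 1" and g: "g = transpose P ** P"
    using assms by (auto simp: frame_def)
  have T: "transpose Q ** transpose P = mat 1" "transpose P ** transpose Q = mat 1"
    using PQ by (metis matrix_transpose_mul transpose_mat)+
  have "g ** (Q ** transpose Q) = transpose P ** (P ** Q) ** transpose Q"
    unfolding g by (simp only: matrix_mul_assoc)
  then show "g ** (Q ** transpose Q) = mat 1" by (simp add: PQ T)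
  have "Q ** transpose Q ** g = Q ** (transpose Q ** transpose P) ** P"
    unfolding g by (simp only: matrix_mul_assoc)
  then show "Q ** transpose Q ** g = mat 1" by (simp add: PQ T)
qed

lemma frame_inv: "frame g P Q \<Longrightarrow> matrix_inv g = Q ** transpose Q"
  by (rule matrix_inv_eqI) (rule frame_metric_inv; assumption)+

lemma frame_det:
  assumes "frame g P Q"
  shows "det g = (det P)\<^sup>2" "det P \<noteq> 0" "det Q = 1 / det P"
proof -
  have 1: "det P * det Q = 1" using assms by (metis frame_def det_mul det_I)
  then show "det P \<noteq> 0" by auto
  then show "det Q = 1 / det P" using 1 by (simp add: field_simps)
  show "det g = (det P)\<^sup>2" using assms by (simp add: frame_def det_mul det_transpose power2_eq_square)
qed

lemma posdef_det_pos: "posdef g \<Longrightarrow> det g > 0"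
  using posdef_frame frame_det by (metis zero_less_power2)

lemma frame_sk:
  assumes "frame g P Q"
  shows "sk (P *v z) = det P *\<^sub>R (transpose Q ** sk z ** Q)"
    "sk (transpose Q *v z) = (1 / det P) *\<^sub>R (P ** sk z ** transpose P)"
proof -
  have PQ: "P ** Q = mat 1" "Q ** P = mat 1" using assms by (auto simp: frame_def)
  have T: "transpose Q ** transpose P = mat 1" "transpose P ** transpose Q = mat 1"
    using PQ by (metis matrix_transpose_mul transpose_mat)+
  have "transpose Q ** (transpose P ** sk (P *v z) ** P) ** Q = sk (P *v z)"
    using T PQ by (metis matrix_mul_assoc matrix_mul_lid matrix_mul_rid)
  then show "sk (P *v z) = det P *\<^sub>R (transpose Q ** sk z ** Q)"
    by (simp add: transpose_sk_conj mat_linear)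
  have "P ** (Q ** sk (transpose Q *v z) ** transpose Q) ** transpose P = sk (transpose Q *v z)"
    using T PQ by (metis matrix_mul_assoc matrix_mul_lid matrix_mul_rid)
  moreover have "Q ** sk (transpose Q *v z) ** transpose Q = det Q *\<^sub>R sk z"
    using transpose_sk_conj[of "transpose Q" z] by (simp add: det_transpose)
  ultimately show "sk (transpose Q *v z) = (1 / det P) *\<^sub>R (P ** sk z ** transpose P)"
    using frame_det[OF assms] by (simp add: mat_linear)
qed

subsection \<open>Structure constants of a three-dimensional Lie algebra\<close>

text \<open>In dimension three the bracket factors through the cross product:
  \<open>[x, y] = (S + 1/2 sk a) (x \<times> y)\<close> with \<open>S\<close> symmetric and \<open>a\<close> the trace form
  \<open>C\<^sup>i\<^sub>i\<^sub>k\<close>; the Jacobi identity becomes \<open>S a = 0\<close>.\<close>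

definition str_mat :: "sconst \<Rightarrow> real^3^3" where
  "str_mat C = (\<chi> k l. if l = 1 then C k 2 3 else if l = 2 then C k 3 1 else C k 1 2)"

definition str_sym :: "sconst \<Rightarrow> real^3^3" where
  "str_sym C = (1/2) *\<^sub>R (str_mat C + transpose (str_mat C))"

definition str_vec :: "sconst \<Rightarrow> real^3" where
  "str_vec C = (\<chi> k. trC C k)"

abbreviation bmat :: "real^3^3 \<Rightarrow> real^3 \<Rightarrow> real^3^3" where
  "bmat S a \<equiv> S + (1/2) *\<^sub>R sk a"

context
  fixes C :: sconst
  assumes lie: "lie_structure C"
begin

lemma sconst_antisym: "C k i i = 0" "C k 2 1 = - C k 1 2" "C k 3 2 = - C k 2 3" "C k 1 3 = - C k 3 1"
proof -
  have A: "C k i j = - C k j i" for k i j using lie unfolding lie_structure_def by blast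
  show "C k i i = 0" using A[of k i i] by simp
  show "C k 2 1 = - C k 1 2" "C k 3 2 = - C k 2 3" "C k 1 3 = - C k 3 1"
    by (rule A)+
qed

lemma str_mat_eq: "str_mat C = bmat (str_sym C) (str_vec C)"
  by (simp add: str_sym_def str_vec_def trC_def str_mat_def comp3 sconst_antisym field_simps)

lemma sconst_eq: "C k i j = (bmat (str_sym C) (str_vec C) *v cross3 (axis i 1) (axis j 1)) $ k"
  unfolding str_mat_eq[symmetric]
  using exhaust_3[of i] exhaust_3[of j]
  by (elim disjE; simp add: str_mat_def cross_basis mv.minus_right matrix_vector_mult_basis column_def sconst_antisym)

lemma str_sym_transpose: "transpose (str_sym C) = str_sym C"
  by (simp add: str_sym_def mat_linear add.commute)

lemma str_sym_vec: "str_sym C *v str_vec C = 0"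
proof -
  have J: "(\<Sum>m\<in>UNIV. C m i j * C l m k + C m j k * C l m i + C m k i * C l m j) = 0" for i j k l
    using lie unfolding lie_structure_def by blast
  have "str_mat C *v str_vec C = 0"
    \<comment> \<open>The Jacobi identity for the basis triple 1, 2, 3, in its three components;
      these are the rows of \<open>str_mat C *v str_vec C\<close>. The antisymmetric part of
      \<open>str_mat C\<close> drops out because the cross product of \<open>str_vec C\<close> with
      itself is zero.\<close>
    using J[of 1 2 1 3] J[of 1 2 2 3] J[of 1 2 3 3]
    by (simp add: str_vec_def trC_def str_mat_def comp3 sconst_antisym algebra_simps)
  then show ?thesis
    by (simp add: str_mat_eq mat_linear sk_mult)
qed

end

subsection \<open>Levi-Civita connection and Ricci curvature\<close>

text \<open>\<open>nab S a g y\<close> is the endomorphism \<open>v \<mapsto> \<nabla>\<^sub>v y\<close>, by the Koszul formula.\<close>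

definition nab :: "real^3^3 \<Rightarrow> real^3 \<Rightarrow> real^3^3 \<Rightarrow> real^3 \<Rightarrow> real^3^3" where
  "nab S a g y = (1/2) *\<^sub>R (matrix_inv g **
     (- transpose (g ** bmat S a ** sk y) - g ** bmat S a ** sk y - sk (transpose (bmat S a) *v (g *v y))))"

text \<open>Two simplifications of the component formula are built in: the contracted connection
  coefficients are replaced by \<open>a\<close>, and the term with structure constants is absorbed
  by torsion-freeness.\<close>

definition ric :: "real^3^3 \<Rightarrow> real^3 \<Rightarrow> real^3^3 \<Rightarrow> real^3 \<Rightarrow> real^3 \<Rightarrow> real" where
  "ric S a g x y = a \<bullet> (nab S a g x *v y) - trace (nab S a g y ** nab S a g x)"

definition ric0 :: "real^3^3 \<Rightarrow> real^3 \<Rightarrow> real^3^3" where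
  "ric0 S a = 2 *\<^sub>R (S ** S) - trace S *\<^sub>R S
     - (trace (S ** S) - (trace S)\<^sup>2 / 2 + (a \<bullet> a) / 2) *\<^sub>R mat 1
     + (1/2) *\<^sub>R (S ** sk a - sk a ** S)"

text \<open>\<open>ric0 S a\<close> is the Ricci tensor of the metric \<open>mat 1\<close>; passing to a \<open>g\<close>-orthonormal frame \<open>P\<close>
  turns \<open>(S, a)\<close> into \<open>(frame_sym P S, transpose (matrix_inv P) a)\<close>.\<close>

definition frame_sym :: "real^3^3 \<Rightarrow> real^3^3 \<Rightarrow> real^3^3" where
  "frame_sym P S = (1 / det P) *\<^sub>R (P ** S ** transpose P)"

lemma mult_axis: "(X *v axis j 1) $ i = X $ i $ j" for X :: "real^3^3"
  by (simp add: matrix_vector_mult_basis column_def)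

lemma triple_swap: "x \<bullet> cross3 y z = - (y \<bullet> cross3 x z)"
  by (simp add: comp3 algebra_simps)

lemma matrix_inv_mat1: "matrix_inv (mat 1 :: real^3^3) = mat 1"
  by (rule matrix_inv_eqI) auto

text \<open>For the metric \<open>mat 1\<close> the connection is a part \<open>N1\<close> linear in
  \<open>S\<close> plus a part \<open>N2\<close> linear in \<open>a\<close>. The mixed traces
  cancel, so \<open>S\<close> and \<open>a\<close> interact only through
  \<open>a . (N1 x y)\<close>, where \<open>S a = 0\<close> removes the part antisymmetric in
  \<open>x\<close> and \<open>y\<close>.\<close>

lemma ric_mat1:
  assumes "transpose S = S" "S *v a = 0"
  shows "ric S a (mat 1) x y = x \<bullet> (ric0 S a *v y)"
proof -
  have s: "S $ 2 $ 1 = S $ 1 $ 2" "S $ 3 $ 1 = S $ 1 $ 3" "S $ 3 $ 2 = S $ 2 $ 3"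
    using assms(1) symm_iff_transpose[of S] by (auto simp: symm_def)
  define N1 where "N1 = (\<lambda>y. sk y ** S - S ** sk y - sk (S *v y))"
  define N2 where "N2 = (\<lambda>y. (a \<bullet> y) *\<^sub>R mat 1 - outer a y)"
  have nab: "nab S a (mat 1) y = (1/2) *\<^sub>R (N1 y + N2 y)" for y
  proof -
    have "- transpose (bmat S a ** sk y) - bmat S a ** sk y - sk (transpose (bmat S a) *v y) = N1 y + N2 y"
      unfolding N1_def N2_def
      by (simp add: comp3 outer_def s field_simps)
    then show ?thesis by (simp add: nab_def matrix_inv_mat1)
  qed
  have 11: "trace (N1 y ** N1 x) = x \<bullet> (((-8) *\<^sub>R (S ** S) + (4 * trace S) *\<^sub>R S
     + (4 * trace (S ** S) - 2 * (trace S)\<^sup>2) *\<^sub>R mat 1) *v y)"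
    unfolding N1_def by (simp add: comp3 s power2_eq_square) algebra
  have 12: "trace (N1 y ** N2 x) + trace (N2 y ** N1 x) = 0"
    unfolding N1_def N2_def by (simp add: comp3 s outer_def) algebra
  have 22: "trace (N2 y ** N2 x) = 2 * ((a \<bullet> x) * (a \<bullet> y))"
    unfolding N2_def by (simp add: comp3 outer_def) algebra
  have 0: "a \<bullet> (N2 x *v y) = (a \<bullet> x) * (a \<bullet> y) - (a \<bullet> a) * (x \<bullet> y)"
    unfolding N2_def by (simp add: mat_linear outer_mult inner_diff_right algebra_simps)
  have 1: "a \<bullet> (N1 x *v y) = x \<bullet> ((S ** sk a - sk a ** S) *v y) - (S *v a) \<bullet> cross3 x y"
    unfolding N1_def by (simp add: comp3 s) algebra
  have "ric S a (mat 1) x y = (a \<bullet> (N1 x *v y) + a \<bullet> (N2 x *v y)) / 2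
      - (trace (N1 y ** N1 x) + (trace (N1 y ** N2 x) + trace (N2 y ** N1 x)) + trace (N2 y ** N2 x)) / 4"
    unfolding ric_def nab by (simp add: mat_linear inner_add_right field_simps)
  also have "\<dots> = x \<bullet> (ric0 S a *v y)"
    unfolding 11 12 22 0 1 assms(2) ric0_def
    by (simp add: mat_linear inner_add_right inner_diff_right field_simps)
  finally show ?thesis .
qed

text \<open>Naturality of the Levi-Civita connection: in the frame the metric is
  \<open>mat 1\<close> and the bracket data are \<open>frame_sym P S\<close> and
  \<open>transpose Q *v a\<close>.\<close>

lemma nab_frame:
  assumes f: "frame g P Q"
  shows "nab S a g y = Q ** nab (frame_sym P S) (transpose Q *v a) (mat 1) (P *v y) ** P"
proof -
  define B where "B = bmat S a"
  have PQ: "P ** Q = mat 1" "Q ** P = mat 1" and g: "g = transpose P ** P"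
    using f by (auto simp: frame_def)
  have T: "transpose Q ** transpose P = mat 1" "transpose P ** transpose Q = mat 1"
    using PQ by (metis matrix_transpose_mul transpose_mat)+
  have c: "X ** P ** Q = X" "X ** Q ** P = X" "X ** transpose P ** transpose Q = X"
      "X ** transpose Q ** transpose P = X" for X
    using PQ T by (metis matrix_mul_assoc matrix_mul_rid)+
  \<comment> \<open>The factor \<open>1 / det P\<close> compensates the transformation of the cross
    product, \<open>P x\<close> times \<open>P y\<close> being \<open>det P\<close> times
    \<open>transpose Q\<close> of the old product.\<close>
  have B': "bmat (frame_sym P S) (transpose Q *v a) = (1 / det P) *\<^sub>R (P ** B ** transpose P)"
    by (simp add: B_def frame_sym_def frame_sk(2)[OF f] mat_linear scaleR_add_right)
  have d: "det P \<noteq> 0" using frame_det[OF f] by simp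
  have BY: "bmat (frame_sym P S) (transpose Q *v a) ** sk (P *v y) = P ** B ** sk y ** Q"
    unfolding B' frame_sk(1)[OF f] using d by (simp add: mat_linear matrix_mul_assoc c)
  have w: "sk (transpose (bmat (frame_sym P S) (transpose Q *v a)) *v (P *v y))
      = transpose Q ** sk (transpose B *v (g *v y)) ** Q"
  proof -
    have "transpose (bmat (frame_sym P S) (transpose Q *v a)) *v (P *v y)
        = (1 / det P) *\<^sub>R (P *v (transpose B *v (g *v y)))"
      unfolding B' by (simp add: mat_linear matrix_transpose_mul matrix_vector_mul_assoc g matrix_mul_assoc)
    then show ?thesis using d by (simp add: mat_linear frame_sk(1)[OF f])
  qed
  have "Q ** nab (frame_sym P S) (transpose Q *v a) (mat 1) (P *v y) ** P
      = (1/2) *\<^sub>R (- (Q ** transpose (P ** B ** sk y ** Q) ** P) - Q ** (P ** B ** sk y ** Q) ** P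
         - Q ** (transpose Q ** sk (transpose B *v (g *v y)) ** Q) ** P)"
    unfolding nab_def matrix_inv_mat1 matrix_mul_lid matrix_vector_mul_lid BY w
    by (simp only: mat_linear)
  also have "\<dots> = nab S a g y"
    unfolding nab_def frame_inv[OF f] B_def[symmetric]
    by (simp add: mat_linear g matrix_transpose_mul matrix_mul_assoc c PQ)
  finally show ?thesis by simp
qed

lemma ric_frame:
  assumes f: "frame g P Q" and "transpose S = S" "S *v a = 0"
  shows "ric S a g x y = (P *v x) \<bullet> (ric0 (frame_sym P S) (transpose Q *v a) *v (P *v y))"
proof -
  have PQ: "P ** Q = mat 1" "Q ** P = mat 1" using f by (auto simp: frame_def)
  have S': "transpose (frame_sym P S) = frame_sym P S"
    by (simp add: frame_sym_def mat_linear matrix_transpose_mul matrix_mul_assoc assms)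
  have "transpose P ** transpose Q = mat 1"
    using PQ by (metis matrix_transpose_mul transpose_mat)
  then have "transpose P *v (transpose Q *v a) = a" by (simp add: matrix_vector_mul_assoc)
  then have Sa': "frame_sym P S *v (transpose Q *v a) = 0"
    by (simp add: frame_sym_def mat_linear matrix_vector_mul_assoc[symmetric] assms(3))
  let ?n = "nab (frame_sym P S) (transpose Q *v a) (mat 1)"
  have "trace ((Q ** ?n (P *v y) ** P) ** (Q ** ?n (P *v x) ** P)) = trace (?n (P *v y) ** ?n (P *v x))"
  proof -
    have "(Q ** ?n (P *v y) ** P) ** (Q ** ?n (P *v x) ** P) = Q ** (?n (P *v y) ** (P ** Q) ** ?n (P *v x)) ** P"
      by (simp only: matrix_mul_assoc)
    then show ?thesis unfolding PQ
      using trace_cyclic3[of Q "?n (P *v y) ** ?n (P *v x)" P] by (simp add: PQ matrix_mul_assoc)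
  qed
  then have "ric S a g x y = ric (frame_sym P S) (transpose Q *v a) (mat 1) (P *v x) (P *v y)"
    unfolding ric_def nab_frame[OF f]
    by (simp add: matrix_vector_mul_assoc[symmetric] dot_transpose)
  then show ?thesis using ric_mat1[OF S' Sa'] by simp
qed

lemma metric_inv:
  assumes g: "posdef g"
  shows "g ** matrix_inv g = mat 1" "matrix_inv g ** g = mat 1"
proof -
  obtain P Q where f: "frame g P Q" using posdef_frame[OF g] .
  show "g ** matrix_inv g = mat 1" "matrix_inv g ** g = mat 1"
    using frame_metric_inv[OF f] by (auto simp: frame_inv[OF f])
qed

lemma metric_sym:
  assumes g: "posdef g"
  shows "transpose g = g" "transpose (matrix_inv g) = matrix_inv g"
proof -
  show "transpose g = g" using g by (simp add: posdef_iff)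
  obtain P Q where "frame g P Q" using posdef_frame[OF g] .
  then show "transpose (matrix_inv g) = matrix_inv g"
    by (simp add: frame_inv matrix_transpose_mul)
qed

context
  fixes C :: sconst and g :: "real^3^3"
  assumes lie: "lie_structure C" and g: "posdef g"
begin

text \<open>The three summands of \<open>gam\<close> are the three terms of the Koszul formula;
  \<open>i\<close> is the direction of differentiation and \<open>j\<close> the differentiated frame
  field.\<close>

lemma gam_eq_nab: "gam C g l i j = nab (str_sym C) (str_vec C) g (axis j 1) $ l $ i"
proof -
  let ?B = "bmat (str_sym C) (str_vec C)"
  let ?Y = "sk (axis j 1)"
  have BY: "(?B ** ?Y) $ m $ k = C m j k" for m k
    by (simp add: mult_axis[symmetric] sconst_eq[OF lie] matrix_vector_mul_assoc[symmetric] sk_mult del: matrix_vector_mul_assoc)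
  have anti: "C m j i = - C m i j" for m
    using lie unfolding lie_structure_def by blast
  have gs: "g $ p $ q = g $ q $ p" for p q using g by (simp add: posdef_def symm_def)
  have Z: "(- transpose (g ** ?B ** ?Y) - g ** ?B ** ?Y - sk (transpose ?B *v (g *v axis j 1))) $ k $ i
      = (\<Sum>m\<in>UNIV. - C m j k * g $ i $ m + C m k i * g $ j $ m + C m i j * g $ k $ m)" for k
  proof -
    have 1: "transpose (g ** ?B ** ?Y) $ k $ i = (\<Sum>m\<in>UNIV. C m j k * g $ i $ m)"
      unfolding matrix_mul_assoc[symmetric] transpose_def
      by (simp add: matrix_matrix_mult_def[of g] BY mult.commute)
    have 2: "(g ** ?B ** ?Y) $ k $ i = - (\<Sum>m\<in>UNIV. C m i j * g $ k $ m)"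
      unfolding matrix_mul_assoc[symmetric]
      by (simp add: matrix_matrix_mult_def[of g] BY anti mult.commute sum_negf)
    have "sk (transpose ?B *v (g *v axis j 1)) $ k $ i
        = axis k 1 \<bullet> cross3 (transpose ?B *v (g *v axis j 1)) (axis i 1)"
      by (simp add: matrix_component[of "sk _"] sk_mult)
    also have "\<dots> = - ((transpose ?B *v (g *v axis j 1)) \<bullet> cross3 (axis k 1) (axis i 1))"
      by (rule triple_swap)
    also have "\<dots> = - ((g *v axis j 1) \<bullet> (?B *v cross3 (axis k 1) (axis i 1)))"
      by (simp add: dot_transpose)
    also have "\<dots> = - (\<Sum>m\<in>UNIV. C m k i * g $ j $ m)"
      by (simp add: inner_vec_def sconst_eq[OF lie] mult_axis gs[of _ j] mult.commute)
    finally show ?thesis using 1 2 by (simp add: sum.distrib sum_negf sum_subtractf)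
  qed
  show ?thesis
    unfolding nab_def vector_scaleR_component matrix_matrix_mult_def[of "matrix_inv g"] vec_lambda_beta Z
    by (simp add: gam_def gi_def)
qed

text \<open>The divergence of a left-invariant field. Traces of a symmetric against an antisymmetric
  matrix vanish, so only the \<open>sk\<close> part of \<open>bmat\<close> contributes.\<close>

lemma trace_nab: "trace (nab (str_sym C) (str_vec C) g y) = str_vec C \<bullet> y"
proof -
  let ?B = "bmat (str_sym C) (str_vec C)" and ?G = "matrix_inv g"
  have 1: "trace (?G ** (g ** ?B ** sk y)) = trace (?B ** sk y)"
    by (simp add: matrix_mul_assoc metric_inv[OF g])
  have 2: "trace (?G ** transpose (g ** ?B ** sk y)) = trace (?B ** sk y)"
    using 1 trace_transpose[of "?G ** transpose (g ** ?B ** sk y)"] trace_mul_sym[of "g ** ?B ** sk y" ?G]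
    by (simp add: matrix_transpose_mul[of ?G] metric_sym[OF g])
  have 3: "trace (?G ** sk w) = 0" for w
    using trace_sk_symmetric[OF metric_sym(2)[OF g], of w] trace_mul_sym[of "sk w"] by simp
  have 4: "trace (?B ** sk y) = - (str_vec C \<bullet> y)"
  proof -
    have "trace (str_sym C ** sk y) = 0"
      using trace_sk_symmetric[OF str_sym_transpose[OF lie], of y] trace_mul_sym[of "sk y"] by simp
    moreover have "trace (sk (str_vec C) ** sk y) = - 2 * (str_vec C \<bullet> y)"
      by (simp add: comp3 algebra_simps)
    ultimately show ?thesis by (simp add: mat_linear)
  qed
  show ?thesis unfolding nab_def mm.diff_right mm.minus_right linear_diff[OF linear_trace]
      linear_neg[OF linear_trace] linear_scale[OF linear_trace] 1 2 3 4
    by simp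
qed

lemma nab_torsion: "nab (str_sym C) (str_vec C) g y *v x - nab (str_sym C) (str_vec C) g x *v y
    = bmat (str_sym C) (str_vec C) *v cross3 x y"
proof -
  define B where "B = bmat (str_sym C) (str_vec C)"
  have 1: "transpose (g ** B ** sk y) *v x = - cross3 y (transpose B *v (g *v x))" for x y
    by (simp add: matrix_transpose_mul transpose_sk mat_linear matrix_vector_mul_assoc[symmetric] sk_mult metric_sym[OF g])
  have 2: "(g ** B ** sk y) *v x = g *v (B *v cross3 y x)" for x y
    by (simp add: matrix_vector_mul_assoc[symmetric] sk_mult)
  have "(- transpose (g ** B ** sk y) - g ** B ** sk y - sk (transpose B *v (g *v y))) *v x
      - (- transpose (g ** B ** sk x) - g ** B ** sk x - sk (transpose B *v (g *v x))) *v y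
      = 2 *\<^sub>R (g *v (B *v cross3 x y))"
    unfolding mv.diff_left mv.minus_left 1 2 sk_mult
    by (simp add: cross_skew[of y x] cross_skew[of "transpose B *v (g *v y)"] cross_skew[of "transpose B *v (g *v x)"] mv.minus_right scaleR_2)
  then have "nab (str_sym C) (str_vec C) g y *v x - nab (str_sym C) (str_vec C) g x *v y
      = matrix_inv g *v (g *v (B *v cross3 x y))"
    unfolding nab_def B_def[symmetric] mv.scaleR_left matrix_vector_mul_assoc[symmetric]
    by (simp add: scaleR_diff_right[symmetric] mv.diff_right[symmetric] mv.scaleR_right)
  then show ?thesis by (metis B_def matrix_vector_mul_assoc metric_inv(2)[OF g] matrix_vector_mul_lid)
qed

text \<open>\<open>tr\<close> contracts the first term to \<open>str_vec C\<close>, and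
  \<open>tor\<close> (torsion-freeness) merges the other two into one trace.\<close>

lemma Ric_eq_ric: "Ric C g i j = ric (str_sym C) (str_vec C) g (axis i 1) (axis j 1)"
proof -
  let ?N = "nab (str_sym C) (str_vec C) g"
  have tr: "(\<Sum>l\<in>UNIV. gam C g l l m) = str_vec C $ m" for m
    using trace_nab[of "axis m 1"] by (simp add: gam_eq_nab trace_def inner_axis)
  have tor: "gam C g m j l + C m l j = gam C g m l j" for m l
    using arg_cong[OF nab_torsion[of "axis j 1" "axis l 1"], of "\<lambda>v. v $ m"]
    by (simp add: gam_eq_nab mult_axis sconst_eq[OF lie, symmetric])
  have "Ric C g i j = (\<Sum>m\<in>UNIV. (\<Sum>l\<in>UNIV. gam C g l l m) * gam C g m j i)
      - (\<Sum>l\<in>UNIV. \<Sum>m\<in>UNIV. gam C g m j l * gam C g l m i)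
      - (\<Sum>l\<in>UNIV. \<Sum>m\<in>UNIV. C l m j * gam C g m l i)"
    unfolding Ric_def sum_subtractf sum_distrib_right by (subst sum.swap) simp
  also have "(\<Sum>l\<in>UNIV. \<Sum>m\<in>UNIV. C l m j * gam C g m l i) = (\<Sum>l\<in>UNIV. \<Sum>m\<in>UNIV. C m l j * gam C g l m i)"
    by (rule sum.swap)
  finally have "Ric C g i j = (\<Sum>m\<in>UNIV. str_vec C $ m * gam C g m j i)
      - (\<Sum>l\<in>UNIV. \<Sum>m\<in>UNIV. gam C g m l j * gam C g l m i)"
    unfolding tr tor[symmetric] by (simp add: sum.distrib algebra_simps)
  also have "(\<Sum>m\<in>UNIV. str_vec C $ m * gam C g m j i) = str_vec C \<bullet> (?N (axis i 1) *v axis j 1)"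
    by (simp add: inner_vec_def mult_axis gam_eq_nab)
  also have "(\<Sum>l\<in>UNIV. \<Sum>m\<in>UNIV. gam C g m l j * gam C g l m i) = trace (?N (axis j 1) ** ?N (axis i 1))"
    unfolding trace_def matrix_matrix_mult_def gam_eq_nab by (subst sum.swap) simp
  finally show ?thesis by (simp add: ric_def)
qed

end

section \<open>Isotropic vectors of \<open>S\<close> and the characterization of type IX\<close>

lemma inner_mat1: "A \<bullet> mat 1 = trace A" for A :: "real^3^3"
  by (simp add: comp3)

lemma inner_symmetric: "transpose A = A \<Longrightarrow> A \<bullet> B = trace (A ** B)" for A B :: "real^3^3"
proof -
  have "A \<bullet> B = trace (transpose A ** B)" by (simp add: comp3)
  then show "transpose A = A \<Longrightarrow> A \<bullet> B = trace (A ** B)" by simp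
qed

text \<open>The isotropic unit vector \<open>u\<close> allows \<open>mat 1\<close> to be replaced by
  the projection \<open>R\<close> onto its orthogonal complement: the product with \<open>S\<close>
  is still \<open>trace S\<close>, but the squared norm drops from 3 to 2, which improves
  Cauchy-Schwarz.\<close>

lemma trace_square_le:
  fixes S :: "real^3^3"
  assumes S: "transpose S = S" and v: "v \<noteq> 0" "v \<bullet> (S *v v) = 0"
  shows "(trace S)\<^sup>2 \<le> 2 * trace (S ** S)"
proof -
  define u where "u = v /\<^sub>R norm v"
  have "norm u = 1" using v by (simp add: u_def)
  then have u: "u \<bullet> u = 1" by (simp add: norm_eq_1)
  have Su: "u \<bullet> (S *v u) = 0" using v by (simp add: u_def mat_linear)
  define R where "R = mat 1 - outer u u"
  have "S \<bullet> R = trace S"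
    using Su by (simp add: R_def inner_diff_right inner_mat1 inner_outer)
  moreover have "R \<bullet> R = 2"
  proof -
    have "trace (outer u u) = u \<bullet> u" by (simp add: comp3 outer_def)
    then show ?thesis using u
      by (simp add: R_def inner_diff_right inner_diff_left inner_mat1 inner_outer outer_mult mat_linear trace_I)
  qed
  moreover have "S \<bullet> S = trace (S ** S)" by (rule inner_symmetric[OF S])
  ultimately show ?thesis using Cauchy_Schwarz_ineq[of S R] by (simp add: mult.commute)
qed

text \<open>Intermediate value argument for the quadratic form on the connected unit sphere.\<close>

lemma isotropic_vector:
  fixes S :: "real^3^3"
  assumes "\<not> (\<forall>x. x \<noteq> 0 \<longrightarrow> x \<bullet> (S *v x) > 0)" "\<not> (\<forall>x. x \<noteq> 0 \<longrightarrow> x \<bullet> (S *v x) < 0)"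
  obtains v where "v \<noteq> 0" "v \<bullet> (S *v v) = 0"
proof -
  let ?q = "\<lambda>x. x \<bullet> (S *v x)"
  obtain x y where x: "x \<noteq> 0" "?q x \<le> 0" and y: "y \<noteq> 0" "?q y \<ge> 0"
    using assms unfolding not_all not_imp not_less by blast
  define X Y where "X = x /\<^sub>R norm x" and "Y = y /\<^sub>R norm y"
  have sph: "X \<in> sphere 0 1" "Y \<in> sphere 0 1" using x y by (auto simp: X_def Y_def)
  have "?q X \<le> 0" "?q Y \<ge> 0"
    using x y by (auto simp: X_def Y_def mat_linear mult_nonneg_nonpos)
  moreover have "connected (?q ` sphere 0 1)"
  proof (rule connected_continuous_image)
    show "continuous_on (sphere 0 1) ?q"
      by (intro continuous_on_inner continuous_on_id linear_continuous_on matrix_vector_mul_bounded_linear)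
    show "connected (sphere (0::real^3) 1)" by (rule connected_sphere) simp
  qed
  ultimately have "0 \<in> ?q ` sphere 0 1"
    using connectedD_interval[of "?q ` sphere 0 1" "?q X" "?q Y" 0] sph by blast
  then obtain v where "v \<in> sphere 0 1" "?q v = 0" by auto
  then show ?thesis by (intro that[of v]) auto
qed

lemma bracket_sum:
  assumes lie: "lie_structure C"
  shows "(\<Sum>i\<in>UNIV. \<Sum>j\<in>UNIV. x $ i * y $ j * C k i j) = (bmat (str_sym C) (str_vec C) *v cross3 x y) $ k"
  unfolding str_mat_eq[OF lie, symmetric]
  by (simp add: str_mat_def matrix_vector_mult_def sum_3 cross_components sconst_antisym[OF lie] algebra_simps)

lemma levi_civita_sum: "(\<Sum>c\<in>UNIV. levi_civita a b c * A $ c $ k) = (transpose A *v cross3 (axis a 1) (axis b 1)) $ k"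
  using exhaust_3[of a] exhaust_3[of b]
  by (elim disjE; simp add: levi_civita_def sum_3 matrix_vector_mult_def cross_components transpose_def axis_def)
text \<open>Definiteness and \<open>S a = 0\<close> force \<open>a = 0\<close>; a multiple of the
  Cholesky factor of \<open>s *\<^sub>R S\<close> is then a basis with the brackets of
  so(3).\<close>

lemma definite_imp_bianchi_IX:
  assumes lie: "lie_structure C" and s: "s = 1 \<or> s = -1"
    and def: "\<And>x. x \<noteq> 0 \<Longrightarrow> s * (x \<bullet> (str_sym C *v x)) > 0"
  shows "bianchi_IX C"
proof -
  let ?S = "str_sym C"
  have ss: "s * s = 1" using s by auto
  have "posdef (s *\<^sub>R ?S)"
    unfolding posdef_iff using def by (simp add: mat_linear str_sym_transpose[OF lie])
  then obtain P Q where f: "frame (s *\<^sub>R ?S) P Q" by (rule posdef_frame)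
  then have "s *\<^sub>R (s *\<^sub>R ?S) = s *\<^sub>R (transpose P ** P)" by (simp only: frame_def)
  then have SP: "?S = s *\<^sub>R (transpose P ** P)" by (simp add: ss)
  have d: "det P \<noteq> 0" using frame_det[OF f] by simp
  have a0: "str_vec C = 0"
    using def[of "str_vec C"] unfolding str_sym_vec[OF lie] by (cases "str_vec C = 0") auto
  \<comment> \<open>Forced by the requirement \<open>s / (k * k) * det A = s * k * det P = 1\<close>
    for \<open>A = k *\<^sub>R P\<close>.\<close>
  define k where "k = s / det P"
  define A where "A = k *\<^sub>R P"
  have k: "k \<noteq> 0" using d s by (auto simp: k_def)
  have detA: "det A = k ^ 3 * det P"
    by (simp add: A_def det_3 power3_eq_cube algebra_simps)
  have S_A: "?S = (s / (k * k)) *\<^sub>R (transpose A ** A)"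
    using k by (simp add: SP A_def mat_linear)
  have "invertible A" using k d detA by (simp add: invertible_det_nz)
  moreover have "?S *v cross3 (transpose A *v x) (transpose A *v y) = transpose A *v cross3 x y" for x y
  proof -
    have "A *v cross3 (transpose A *v x) (transpose A *v y) = det A *\<^sub>R cross3 x y"
      using cross_matrix_mult[of "transpose A"] by (simp add: det_transpose)
    then have "?S *v cross3 (transpose A *v x) (transpose A *v y) = (s / (k * k) * det A) *\<^sub>R (transpose A *v cross3 x y)"
      by (simp add: S_A mat_linear matrix_vector_mul_assoc[symmetric])
    also have "s / (k * k) * det A = 1"
    proof -
      have "s / (k * k) * det A = s * (k * det P)" using k by (simp add: detA power3_eq_cube)
      then show ?thesis using d ss by (simp add: k_def)
    qed
    finally show ?thesis by simp
  qed
  moreover have row: "transpose A *v axis a 1 = A $ a" for a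
    by (simp add: vec_eq_iff mult_axis transpose_def)
  ultimately have "?S *v cross3 (A $ a) (A $ b) = transpose A *v cross3 (axis a 1) (axis b 1)" for a b
    by (metis row)
  with \<open>invertible A\<close> show ?thesis
    unfolding bianchi_IX_def bracket_sum[OF lie] levi_civita_sum a0
    by (intro exI[of _ A]) (simp add: linear_0[OF linear_sk])
qed

section \<open>The mixed Ricci tensor, its trace and its divergence\<close>

definition Ric_mat :: "sconst \<Rightarrow> real^3^3 \<Rightarrow> real^3^3" where
  "Ric_mat C g = (\<chi> i j. Ric C g i j)"

context
  fixes C :: sconst and g :: "real^3^3"
  assumes lie: "lie_structure C" and g: "posdef g"
begin

lemma Ric_mat_frame:
  assumes "frame g P Q"
  shows "Ric_mat C g = transpose P ** ric0 (frame_sym P (str_sym C)) (transpose Q *v str_vec C) ** P"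
proof -
  let ?R = "ric0 (frame_sym P (str_sym C)) (transpose Q *v str_vec C)"
  have "Ric_mat C g $ i $ j = (transpose P ** ?R ** P) $ i $ j" for i j
    unfolding matrix_component[of "_ ** _"] matrix_vector_mul_assoc[symmetric] dot_transpose'
    by (simp add: Ric_mat_def Ric_eq_ric[OF lie g] ric_frame[OF assms str_sym_transpose[OF lie] str_sym_vec[OF lie]])
  then show ?thesis by (simp add: vec_eq_iff)
qed

lemma transpose_ric0: "transpose S = S \<Longrightarrow> transpose (ric0 S a) = ric0 S a"
  by (simp add: ric0_def mat_linear matrix_transpose_mul transpose_sk)

lemma transpose_frame_sym: "transpose S = S \<Longrightarrow> transpose (frame_sym P S) = frame_sym P S"
  by (simp add: frame_sym_def mat_linear matrix_transpose_mul matrix_mul_assoc)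

lemma Ric_mat_sym: "transpose (Ric_mat C g) = Ric_mat C g"
proof -
  obtain P Q where f: "frame g P Q" by (rule posdef_frame[OF g])
  show ?thesis
    by (simp add: Ric_mat_frame[OF f] matrix_transpose_mul matrix_mul_assoc transpose_ric0
        transpose_frame_sym str_sym_transpose[OF lie])
qed

lemma inv_Ric_mat_frame:
  assumes f: "frame g P Q"
  shows "matrix_inv g ** Ric_mat C g = Q ** ric0 (frame_sym P (str_sym C)) (transpose Q *v str_vec C) ** P"
proof -
  have "transpose Q ** transpose P = mat 1"
    using f by (metis frame_def matrix_transpose_mul transpose_mat)
  then have "Q ** (transpose Q ** transpose P) ** X = Q ** X" for X by simp
  then show ?thesis
    unfolding Ric_mat_frame[OF f] frame_inv[OF f] by (metis matrix_mul_assoc)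
qed

lemma Rscal_eq_trace: "Rscal C g = trace (matrix_inv g ** Ric_mat C g)"
proof -
  have "Ric C g i j = Ric C g j i" for i j
    using arg_cong[OF Ric_mat_sym, of "\<lambda>M. M $ j $ i"] by (simp add: transpose_def Ric_mat_def)
  then show ?thesis
    by (simp add: Rscal_def trace_def matrix_matrix_mult_def Ric_mat_def gi_def)
qed

text \<open>Conjugation by the frame turns \<open>frame_sym P S\<close> into \<open>S ** g\<close>
  and the frame version of \<open>sk a\<close> into \<open>sk a ** g\<close>, each divided by
  \<open>det P\<close>. The frame disappears, so the result can be differentiated in time without
  choosing frames smoothly.\<close>

lemma inv_Ric_mat:
  defines "S \<equiv> str_sym C" and "a \<equiv> str_vec C"
  shows "matrix_inv g ** Ric_mat C g = (1 / det g) *\<^sub>R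
      (2 *\<^sub>R (S ** g ** S ** g) - trace (S ** g) *\<^sub>R (S ** g)
       - (trace (S ** g ** S ** g) - (trace (S ** g))\<^sup>2 / 2) *\<^sub>R mat 1
       + (1/2) *\<^sub>R (S ** g ** sk a ** g - sk a ** g ** S ** g))
      - ((a \<bullet> (matrix_inv g *v a)) / 2) *\<^sub>R mat 1"
proof -
  obtain P Q where f: "frame g P Q" by (rule posdef_frame[OF g])
  have PQ: "P ** Q = mat 1" "Q ** P = mat 1" and gP: "g = transpose P ** P"
    using f by (auto simp: frame_def)
  define d where "d = det P"
  have d: "d \<noteq> 0" "det g = d * d" using frame_det[OF f] by (auto simp: d_def power2_eq_square)
  define c where "c = (\<lambda>X. Q ** X ** P)"
  have c_mult: "c (X ** Y) = c X ** c Y" for X Y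
  proof -
    have "c X ** c Y = Q ** X ** (P ** Q) ** Y ** P" by (simp add: c_def matrix_mul_assoc)
    then show ?thesis by (simp add: PQ c_def matrix_mul_assoc)
  qed
  have c_tr: "trace (c X) = trace X" for X
    using trace_cyclic3[of Q X P] by (simp add: c_def PQ)
  have c_lin: "c (X + Y) = c X + c Y" "c (X - Y) = c X - c Y" "c (r *\<^sub>R X) = r *\<^sub>R c X" for X Y r
    by (simp_all add: c_def mat_linear)
  have c1: "c (mat 1) = mat 1" by (simp add: c_def PQ)
  have cS: "c (frame_sym P S) = (1 / d) *\<^sub>R (S ** g)"
    by (simp add: c_def frame_sym_def gP mat_linear matrix_mul_assoc PQ d_def)
  have cA: "c (sk (transpose Q *v a)) = (1 / d) *\<^sub>R (sk a ** g)"
    by (simp add: c_def frame_sk(2)[OF f] gP mat_linear matrix_mul_assoc PQ d_def)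
  have tS: "trace (frame_sym P S) = (1 / d) * trace (S ** g)"
    using c_tr[of "frame_sym P S"] by (simp add: cS mat_linear)
  have tSS: "trace (frame_sym P S ** frame_sym P S) = (1 / (d * d)) * trace (S ** g ** S ** g)"
    using c_tr[of "frame_sym P S ** frame_sym P S"] by (simp add: c_mult cS mat_linear matrix_mul_assoc)
  have aa: "(transpose Q *v a) \<bullet> (transpose Q *v a) = a \<bullet> (matrix_inv g *v a)"
    by (simp add: frame_inv[OF f] dot_transpose matrix_vector_mul_assoc)
  have "matrix_inv g ** Ric_mat C g = c (ric0 (frame_sym P S) (transpose Q *v a))"
    using inv_Ric_mat_frame[OF f] by (simp add: c_def S_def a_def)
  also have "\<dots> = (1 / det g) *\<^sub>R
      (2 *\<^sub>R (S ** g ** S ** g) - trace (S ** g) *\<^sub>R (S ** g)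
       - (trace (S ** g ** S ** g) - (trace (S ** g))\<^sup>2 / 2) *\<^sub>R mat 1
       + (1/2) *\<^sub>R (S ** g ** sk a ** g - sk a ** g ** S ** g))
      - ((a \<bullet> (matrix_inv g *v a)) / 2) *\<^sub>R mat 1"
    unfolding ric0_def c_lin c_mult cS cA c1 tS tSS aa d(2)
    using d(1) by (simp add: mat_linear matrix_mul_assoc vec_eq_iff power2_eq_square field_simps)
  finally show ?thesis .
qed

lemma Rscal_formula:
  "Rscal C g = - (trace (str_sym C ** g ** str_sym C ** g) - (trace (str_sym C ** g))\<^sup>2 / 2) / det g
     - 3/2 * (str_vec C \<bullet> (matrix_inv g *v str_vec C))"
proof -
  have 1: "trace (str_sym C ** g ** sk a ** g) = trace (sk a ** g ** str_sym C ** g)" for a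
    by (metis matrix_mul_assoc trace_mul_sym)
  show ?thesis
    unfolding Rscal_eq_trace inv_Ric_mat using posdef_det_pos[OF g]
    by (simp add: mat_linear trace_I 1 power2_eq_square field_simps)
qed

text \<open>The left side is the divergence of the Ricci tensor, as \<open>divK_eq\<close> shows for
  \<open>K\<close>. It equals half the gradient of the scalar curvature, which is zero because that
  curvature is constant on the group.\<close>

lemma contracted_bianchi:
  "str_vec C \<bullet> (matrix_inv g ** Ric_mat C g *v z)
     + trace (bmat (str_sym C) (str_vec C) ** sk z ** (matrix_inv g ** Ric_mat C g)) = 0"
proof -
  obtain P Q where f: "frame g P Q" by (rule posdef_frame[OF g])
  have PQ: "P ** Q = mat 1" "Q ** P = mat 1" and gP: "g = transpose P ** P"
    using f by (auto simp: frame_def)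
  have d: "det P \<noteq> 0" using frame_det[OF f] by simp
  define S a where "S = frame_sym P (str_sym C)" and "a = transpose Q *v str_vec C"
  have S: "transpose S = S" by (simp add: S_def transpose_frame_sym str_sym_transpose[OF lie])
  have s: "S $ 2 $ 1 = S $ 1 $ 2" "S $ 3 $ 1 = S $ 1 $ 3" "S $ 3 $ 2 = S $ 2 $ 3"
    using S symm_iff_transpose[of S] by (auto simp: symm_def)
  have T: "transpose P ** transpose Q = mat 1"
    using PQ by (metis matrix_transpose_mul transpose_mat)
  then have "transpose P *v a = str_vec C" by (simp add: a_def matrix_vector_mul_assoc)
  then have Sa: "S *v a = 0"
    by (simp add: S_def frame_sym_def mat_linear matrix_vector_mul_assoc[symmetric] str_sym_vec[OF lie])
  \<comment> \<open>Obtained without \<open>S a = 0\<close>; its purpose is to exhibit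
    \<open>S a\<close> as a factor of every term on the right.\<close>
  have id: "a \<bullet> (ric0 S a *v y) + trace (bmat S a ** sk y ** ric0 S a)
      = 2 * ((S *v a) \<bullet> (S *v y)) - trace S * ((S *v a) \<bullet> y) + ((S *v a) \<bullet> cross3 a y) / 2
        - trace (sk y ** sk (S *v a) ** S) / 2 + ((S *v a) \<bullet> cross3 a y) / 4" for y
  proof -
    have 1: "trace (S ** sk y ** (S ** sk a)) - trace (S ** sk y ** (sk a ** S))
        + 2 * trace (sk a ** sk y ** (S ** S)) - trace S * trace (sk a ** sk y ** S)
        = - trace (sk y ** sk (S *v a) ** S)"
      by (simp add: comp3 s) algebra
    have 2: "trace (sk a ** sk y ** (S ** sk a)) = (S *v a) \<bullet> cross3 a y"
      by (simp add: comp3 s) algebra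
    have 3: "trace (sk a ** sk y ** (sk a ** S)) = 0" "trace (sk a ** sk y) = - 2 * (a \<bullet> y)"
      by (simp_all add: comp3 s algebra_simps)
    have 4: "trace (S ** sk y ** (S ** S)) = 0" "trace (S ** sk y ** S) = 0" "trace (S ** sk y) = 0"
      by (simp_all add: comp3 s algebra_simps)
    have 5: "a \<bullet> (S ** X *v y) = (S *v a) \<bullet> (X *v y)" "a \<bullet> (S *v y) = (S *v a) \<bullet> y" for X
      by (metis S dot_transpose matrix_vector_mul_assoc)+
    have 6: "a \<bullet> (sk a ** S *v y) = 0"
      by (simp add: matrix_vector_mul_assoc[symmetric] sk_mult dot_cross_self)
    show ?thesis
      using 1 unfolding ric0_def
      by (simp add: mat_linear inner_add_right inner_diff_right 2 3 4 5 6 sk_mult field_simps)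
  qed
  have "str_vec C \<bullet> (matrix_inv g ** Ric_mat C g *v z) = a \<bullet> (ric0 S a *v (P *v z))"
    unfolding inv_Ric_mat_frame[OF f] S_def[symmetric] a_def
    by (simp add: matrix_vector_mul_assoc[symmetric] dot_transpose)
  moreover have "bmat S a = (1 / det P) *\<^sub>R (P ** bmat (str_sym C) (str_vec C) ** transpose P)"
    by (simp add: S_def a_def frame_sym_def frame_sk(2)[OF f] mat_linear scaleR_add_right)
  then have "bmat S a ** sk (P *v z) = P ** bmat (str_sym C) (str_vec C) ** (transpose P ** transpose Q) ** sk z ** Q"
    unfolding frame_sk(1)[OF f] using d by (simp only: mat_linear matrix_mul_assoc) simp
  then have "bmat S a ** sk (P *v z) = P ** (bmat (str_sym C) (str_vec C) ** sk z) ** Q"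
    by (simp add: T matrix_mul_assoc)
  then have "trace (bmat (str_sym C) (str_vec C) ** sk z ** (matrix_inv g ** Ric_mat C g))
      = trace (bmat S a ** sk (P *v z) ** ric0 S a)"
    unfolding inv_Ric_mat_frame[OF f] S_def[symmetric] a_def[symmetric]
    using trace_mul_sym[of "bmat (str_sym C) (str_vec C) ** sk z ** Q ** ric0 S a" P]
    by (simp add: matrix_mul_assoc)
  ultimately show ?thesis using id[of "P *v z"] by (simp add: Sa linear_0[OF linear_sk] linear_0[OF linear_trace])
qed

text \<open>In the frame \<open>R\<close> is
  \<open>(trace S)^2 / 2 - trace (S S) - 3/2 (a . a)\<close>. Outside type IX
  \<open>str_sym C\<close> is indefinite or degenerate, so it has an isotropic vector, whose image
  in the frame makes \<open>trace_square_le\<close> applicable.\<close>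

lemma Rscal_nonpos:
  assumes "\<not> bianchi_IX C"
  shows "Rscal C g \<le> 0"
proof -
  obtain P Q where f: "frame g P Q" by (rule posdef_frame[OF g])
  have PQ: "P ** Q = mat 1" "Q ** P = mat 1" and gP: "g = transpose P ** P"
    using f by (auto simp: frame_def)
  define S a where "S = frame_sym P (str_sym C)" and "a = transpose Q *v str_vec C"
  have S: "transpose S = S" by (simp add: S_def transpose_frame_sym str_sym_transpose[OF lie])
  have "\<not> (\<forall>x. x \<noteq> 0 \<longrightarrow> x \<bullet> (str_sym C *v x) > 0)"
    using definite_imp_bianchi_IX[OF lie, of 1] assms by auto
  moreover have "\<not> (\<forall>x. x \<noteq> 0 \<longrightarrow> x \<bullet> (str_sym C *v x) < 0)"
    using definite_imp_bianchi_IX[OF lie, of "-1"] assms by auto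
  ultimately obtain v where v: "v \<noteq> 0" "v \<bullet> (str_sym C *v v) = 0"
    by (rule isotropic_vector)
  define w where "w = transpose Q *v v"
  have "transpose P ** transpose Q = mat 1"
    using PQ by (metis matrix_transpose_mul transpose_mat)
  then have Pw: "transpose P *v w = v" by (simp add: w_def matrix_vector_mul_assoc)
  have "w \<noteq> 0" using Pw v by auto
  moreover have "w \<bullet> (S *v w) = 0"
    using v Pw by (simp add: S_def frame_sym_def mat_linear matrix_vector_mul_assoc[symmetric])
      (metis dot_transpose)
  ultimately have "(trace S)\<^sup>2 \<le> 2 * trace (S ** S)" by (rule trace_square_le[OF S])
  moreover have "trace (Q ** ric0 S a ** P) = trace (ric0 S a)"
    using trace_cyclic3[of Q "ric0 S a" P] by (simp add: PQ)
  moreover have "trace (ric0 S a) = - (trace (S ** S) - (trace S)\<^sup>2 / 2) - 3/2 * (a \<bullet> a)"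
    unfolding ric0_def using trace_mul_sym[of S "sk a"]
    by (simp add: mat_linear trace_I power2_eq_square field_simps)
  ultimately show ?thesis
    unfolding Rscal_eq_trace inv_Ric_mat_frame[OF f] S_def[symmetric] a_def[symmetric]
    by (simp add: field_simps) (smt (verit) inner_ge_zero)
qed

end

subsection \<open>Vector form of the evolution system\<close>

lemma symmetric_entry: "transpose A = A \<Longrightarrow> A $ i $ j = A $ j $ i" for A :: "real^3^3"
  unfolding symm_iff_transpose[symmetric] symm_def by blast

lemma trace_sk_sk: "trace (sk a ** sk b) = - 2 * (a \<bullet> b)"
  by (simp add: comp3 algebra_simps)

definition axial :: "real^3^3 \<Rightarrow> real^3" where
  "axial F = vector [F $ 3 $ 2, F $ 1 $ 3, F $ 2 $ 1]"

lemma sk_axial: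
  assumes "antisymm F"
  shows "sk (axial F) = F"
proof -
  have A: "F $ i $ j = - F $ j $ i" for i j using assms unfolding antisymm_def by blast
  have "F $ 1 $ 1 = 0" "F $ 2 $ 2 = 0" "F $ 3 $ 3 = 0"
    using A[of 1 1] A[of 2 2] A[of 3 3] by auto
  then show ?thesis using A[of 1 2] A[of 2 3] A[of 3 1] by (simp add: axial_def comp3)
qed

lemma axial_sk [simp]: "axial (sk f) = f"
  by (simp add: axial_def comp3)

text \<open>Such a sum is, up to sign, twice the axial vector of the antisymmetric part of
  \<open>U ** transpose V\<close>, hence depends on that product only.\<close>

lemma sum_cross_basis_transpose:
  fixes U V :: "real^3^3"
  shows "(\<Sum>k\<in>UNIV. cross3 (U *v axis k 1) (V *v axis k 1))
     = (\<Sum>k\<in>UNIV. cross3 ((U ** transpose V) *v axis k 1) (axis k 1))"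
  by (simp add: sum_3 vec_eq_iff forall_3 cross_components matrix_vector_mult_def matrix_matrix_mult_def transpose_def axis_def algebra_simps)

lemma sum_cross_basis_symmetric:
  fixes A :: "real^3^3"
  assumes "transpose A = A"
  shows "(\<Sum>k\<in>UNIV. cross3 (A *v axis k 1) (axis k 1)) = 0"
proof -
  have "A $ 2 $ 1 = A $ 1 $ 2" "A $ 3 $ 1 = A $ 1 $ 3" "A $ 3 $ 2 = A $ 2 $ 3"
    using assms symm_iff_transpose[of A] by (auto simp: symm_def)
  then show ?thesis by (simp add: comp3)
qed

lemma sum_cross_basis_sk: "(\<Sum>k\<in>UNIV. cross3 (sk a *v axis k 1) (axis k 1)) = - 2 *\<^sub>R a"
  by (simp add: comp3 algebra_simps)

lemma uzero_eq: "uzero g u = sqrt (1 + u \<bullet> (g *v u))"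
  unfolding uzero_def by (simp add: comp3 algebra_simps)

lemma ulow_eq: "ulow g u = ($) (g *v u)"
  by (simp add: ulow_def matrix_vector_mult_def fun_eq_iff)

lemma Kmix_eq: "Kmix g K i j = (matrix_inv g ** K) $ i $ j"
  by (simp add: Kmix_def matrix_matrix_mult_def gi_def)

lemma tau0_eq: "tau0 F E j = - (F *v E) $ j"
  by (simp add: tau0_def matrix_vector_mult_def mult.commute)

lemma sum_trC: "(\<Sum>k\<in>UNIV. trC C k * E $ k) = str_vec C \<bullet> E"
  by (simp add: inner_vec_def str_vec_def)

lemma sum_trC': "(\<Sum>i\<in>UNIV. \<Sum>j\<in>UNIV. C i i j * v $ j) = str_vec C \<bullet> v"
  unfolding sum_trC[symmetric] trC_def sum_distrib_right by (rule sum.swap)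

lemma rhs_g_eq: "rhs_g K = (- 2) *\<^sub>R K"
  by (simp add: rhs_g_def vec_eq_iff)

lemma sum_double_form: "(\<Sum>i\<in>UNIV. \<Sum>j\<in>UNIV. M $ i $ j * x $ i * y $ j) = x \<bullet> (M *v y)"
  for M :: "real^3^3"
  by (simp add: comp3 algebra_simps)

lemma sum_trace: "(\<Sum>i\<in>UNIV. \<Sum>j\<in>UNIV. A $ i $ j * B $ i $ j) = trace (A ** transpose B)"
  for A B :: "real^3^3"
  by (simp add: trace_def matrix_matrix_mult_def transpose_def)

definition stress :: "real^3^3 \<Rightarrow> real^3^3 \<Rightarrow> real^3 \<Rightarrow> real^3 \<Rightarrow> real \<Rightarrow> real^3^3" where
  "stress g F E u rho = (\<chi> i j. tauij g F E i j + Tij g u rho i j)"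

context
  fixes g :: "real^3^3"
  assumes g: "posdef g"
begin

text \<open>Raising both indices of the Faraday tensor. This is the origin of the vector
  \<open>(1 / det g) *\<^sub>R (g *v f)\<close> that accompanies \<open>f\<close> from here
  on.\<close>

lemma inv_sk_inv: "matrix_inv g ** sk f ** matrix_inv g = sk ((1 / det g) *\<^sub>R (g *v f))"
proof -
  have "matrix_inv g ** sk (matrix_inv g *v (g *v f)) ** matrix_inv g = det (matrix_inv g) *\<^sub>R sk (g *v f)"
    using transpose_sk_conj[of "matrix_inv g" "g *v f"] by (simp add: metric_sym[OF g])
  moreover have "det (matrix_inv g) * det g = 1"
    using metric_inv[OF g] by (metis det_I det_mul)
  then have "det (matrix_inv g) = 1 / det g"
    using posdef_det_pos[OF g] by (simp add: field_simps)
  ultimately show ?thesis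
    by (simp add: matrix_vector_mul_assoc metric_inv[OF g] mat_linear)
qed

lemma sk_vector_inv: "sk (matrix_inv g *v y) = (1 / det g) *\<^sub>R (g ** sk y ** g)"
proof -
  have "transpose g ** sk (g *v (matrix_inv g *v y)) ** g = det g *\<^sub>R sk (matrix_inv g *v y)"
    by (rule transpose_sk_conj)
  then show ?thesis
    using posdef_det_pos[OF g]
    by (simp add: matrix_vector_mul_assoc metric_inv[OF g] metric_sym[OF g])
qed

lemma Hmean_eq: "symm K \<Longrightarrow> Hmean g K = trace (matrix_inv g ** K)"
  unfolding Hmean_def gi_def sum_trace by (simp add: symm_iff_transpose)

lemma Kup_eq: "symm K \<Longrightarrow> (\<Sum>i\<in>UNIV. \<Sum>j\<in>UNIV. K $ i $ j * Kup g K i j)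
    = trace (matrix_inv g ** K ** matrix_inv g ** K)"
proof -
  assume K: "symm K"
  have "Kup g K i j = (matrix_inv g ** K ** transpose (matrix_inv g)) $ i $ j" for i j
    by (simp add: Kup_def gi_def sum_3 matrix_matrix_mult_def transpose_def algebra_simps)
  then have "(\<Sum>i\<in>UNIV. \<Sum>j\<in>UNIV. K $ i $ j * Kup g K i j)
      = trace (K ** transpose (matrix_inv g ** K ** matrix_inv g))"
    by (simp add: sum_trace metric_sym[OF g])
  also have "\<dots> = trace (K ** matrix_inv g ** K ** matrix_inv g)"
    using K by (simp add: matrix_transpose_mul metric_sym[OF g] symm_iff_transpose matrix_mul_assoc)
  also have "\<dots> = trace (matrix_inv g ** K ** matrix_inv g ** K)"
    using trace_mul_sym[of "K ** matrix_inv g ** K" "matrix_inv g"] by (simp add: matrix_mul_assoc)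
  finally show ?thesis .
qed

end

context
  fixes C :: sconst and g :: "real^3^3"
  assumes lie: "lie_structure C" and g: "posdef g"
begin

text \<open>The Koszul formula contracted with the inverse metric: symmetric matrices drop out of
  sums over the basis of cross products, and the \<open>sk\<close> half of \<open>bmat\<close>
  appears twice.\<close>

lemma sum_gam_contract: "(\<Sum>j\<in>UNIV. \<Sum>k\<in>UNIV. gam C g i j k * gi g j k) = - (matrix_inv g *v str_vec C) $ i"
proof -
  let ?G = "matrix_inv g"
  define a where "a = str_vec C"
  define B where "B = bmat (str_sym C) a"
  let ?N = "nab (str_sym C) a g"
  have Gs: "?G $ j $ k = ?G $ k $ j" for j k
    by (rule symmetric_entry[OF metric_sym(2)[OF g]])
  have "(\<Sum>j\<in>UNIV. \<Sum>k\<in>UNIV. gam C g i j k * gi g j k) = (\<Sum>k\<in>UNIV. \<Sum>j\<in>UNIV. gam C g i j k * gi g j k)"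
    by (rule sum.swap)
  also have "\<dots> = (\<Sum>k\<in>UNIV. (?N (axis k 1) *v (?G *v axis k 1)) $ i)"
    by (simp add: gam_eq_nab[OF lie g] a_def gi_def mult_axis matrix_vector_mult_def[of "nab _ _ _ _"])
  also have "\<dots> = (\<Sum>k\<in>UNIV. ?N (axis k 1) *v (?G *v axis k 1)) $ i"
    by simp
  also have "(\<Sum>k\<in>UNIV. ?N (axis k 1) *v (?G *v axis k 1)) = - (?G *v a)"
  proof -
    have 1: "transpose (g ** B ** sk y) *v (?G *v x) = - cross3 y (transpose B *v x)" for x y
    proof -
      have "transpose (g ** B ** sk y) *v (?G *v x) = - (sk y *v (transpose B *v ((g ** ?G) *v x)))"
        by (simp add: matrix_transpose_mul transpose_sk mat_linear matrix_vector_mul_assoc metric_sym[OF g] matrix_mul_assoc)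
      then show ?thesis by (simp add: metric_inv[OF g] sk_mult)
    qed
    have e: "?N y *v (?G *v x) = (1/2) *\<^sub>R (?G *v (cross3 y (transpose B *v x)
        - g *v (B *v cross3 y (?G *v x)) - cross3 ((transpose B ** g) *v y) (?G *v x)))" for x y
      unfolding nab_def B_def[symmetric]
      by (simp add: mv.scaleR_left matrix_vector_mul_assoc[symmetric] del: matrix_vector_mul_assoc)
        (simp add: mv.diff_left mv.minus_left 1 sk_mult matrix_vector_mul_assoc[symmetric])
    have s1: "(\<Sum>k\<in>UNIV. cross3 (axis k 1) (transpose B *v axis k 1)) = - a"
    proof -
      have "(\<Sum>k\<in>UNIV. cross3 (axis k 1) (transpose B *v axis k 1)) = (\<Sum>k\<in>UNIV. cross3 (B *v axis k 1) (axis k 1))"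
        using sum_cross_basis_transpose[of "mat 1" "transpose B"] by simp
      also have "\<dots> = - a"
        unfolding B_def mv.add_left cr.add_left sum.distrib mv.scaleR_left cr.scaleR_left scaleR_sum_right[symmetric]
          sum_cross_basis_symmetric[OF str_sym_transpose[OF lie]] sum_cross_basis_sk by simp
      finally show ?thesis .
    qed
    have s2: "(\<Sum>k\<in>UNIV. cross3 (axis k 1) (?G *v axis k 1)) = 0"
      using sum_cross_basis_transpose[of "mat 1" ?G] sum_cross_basis_symmetric[OF metric_sym(2)[OF g]]
      by (simp add: metric_sym[OF g])
    have s3: "(\<Sum>k\<in>UNIV. cross3 ((transpose B ** g) *v axis k 1) (?G *v axis k 1)) = a"
    proof -
      have "(\<Sum>k\<in>UNIV. cross3 ((transpose B ** g) *v axis k 1) (?G *v axis k 1)) =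
          (\<Sum>k\<in>UNIV. cross3 (transpose B *v axis k 1) (axis k 1))"
        using sum_cross_basis_transpose[of "transpose B ** g" ?G]
        by (simp add: metric_sym[OF g] matrix_mul_assoc[symmetric] metric_inv[OF g])
      also have "\<dots> = - (\<Sum>k\<in>UNIV. cross3 (axis k 1) (transpose B *v axis k 1))"
        unfolding sum_negf[symmetric] by (rule sum.cong[OF refl]) (rule cross_skew)
      finally show ?thesis using s1 by simp
    qed
    have "(\<Sum>k\<in>UNIV. ?N (axis k 1) *v (?G *v axis k 1)) = (1/2) *\<^sub>R (?G *v (- a - g *v (B *v 0) - a))"
      unfolding e scaleR_sum_right[symmetric] mv.sum_right[symmetric] sum_subtractf s1 s2 s3 ..
    moreover have "- a - g *v (B *v 0) - a = (- 2) *\<^sub>R a" by (simp add: vec_eq_iff)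
    ultimately show ?thesis by (simp only: mv.scaleR_right scaleR_scaleR) simp
  qed
  finally show ?thesis by (simp add: a_def)
qed

text \<open>The first Christoffel term is \<open>sum_gam_contract\<close>. In the second, two Koszul
  terms have equal traces because \<open>K\<close> and the metric are symmetric, and the
  \<open>sk\<close> term is traced against a symmetric matrix.\<close>

lemma divK_eq:
  assumes K: "symm K"
  shows "divK C g K j = (matrix_inv g *v str_vec C) \<bullet> (K *v axis j 1)
    + trace (bmat (str_sym C) (str_vec C) ** sk (axis j 1) ** (matrix_inv g ** K))"
proof -
  let ?G = "matrix_inv g" and ?B = "bmat (str_sym C) (str_vec C)" and ?Y = "sk (axis j 1)"
  let ?N = "nab (str_sym C) (str_vec C) g (axis j 1)"
  have Kt: "transpose K = K" using K by (simp add: symm_iff_transpose)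
  have Gt: "transpose ?G = ?G" by (rule metric_sym[OF g])
  have Gs: "gi g i k = gi g k i" for i k
    unfolding gi_def by (rule symmetric_entry[OF Gt])
  have "(\<Sum>i\<in>UNIV. \<Sum>k\<in>UNIV. gi g i k * (\<Sum>l\<in>UNIV. gam C g l k i * K $ l $ j))
      = (\<Sum>l\<in>UNIV. K $ l $ j * (\<Sum>k\<in>UNIV. \<Sum>i\<in>UNIV. gam C g l k i * gi g k i))"
    by (simp add: sum_3 Gs[of 2 1] Gs[of 3 1] Gs[of 3 2]) algebra
  also have "\<dots> = - ((?G *v str_vec C) \<bullet> (K *v axis j 1))"
    unfolding sum_gam_contract by (simp add: inner_vec_def mult_axis sum_negf mult.commute)
  finally have 1: "(\<Sum>i\<in>UNIV. \<Sum>k\<in>UNIV. gi g i k * (\<Sum>l\<in>UNIV. gam C g l k i * K $ l $ j))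
      = - ((?G *v str_vec C) \<bullet> (K *v axis j 1))" .
  have "(\<Sum>i\<in>UNIV. \<Sum>k\<in>UNIV. gi g i k * (\<Sum>l\<in>UNIV. gam C g l k j * K $ i $ l))
      = (\<Sum>i\<in>UNIV. \<Sum>k\<in>UNIV. ?G $ i $ k * (K ** ?N) $ i $ k)"
    by (simp add: matrix_matrix_mult_def gam_eq_nab[OF lie g] gi_def mult.commute)
  also have "\<dots> = trace (?G ** (K ** ?N))"
  proof -
    have "trace (?G ** transpose (K ** ?N)) = trace (K ** ?N ** ?G)"
      using trace_transpose[of "?G ** transpose (K ** ?N)"] by (simp add: matrix_transpose_mul[of ?G] Gt)
    then show ?thesis using trace_mul_sym[of ?G] by (simp add: sum_trace)
  qed
  also have "\<dots> = trace (?N ** ?G ** K)"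
    using trace_mul_sym[of "?G ** K" ?N] by (simp add: matrix_mul_assoc)
  also have "\<dots> = - trace (?B ** ?Y ** (?G ** K))"
  proof -
    let ?X = "g ** ?B ** ?Y" and ?w = "transpose ?B *v (g *v axis j 1)"
    have "trace (?G ** transpose ?X ** ?G ** K) = trace (transpose (?G ** transpose ?X ** ?G ** K))"
      by (simp only: trace_transpose)
    also have "transpose (?G ** transpose ?X ** ?G ** K) = K ** (?G ** ?X ** ?G)"
      by (simp only: matrix_transpose_mul Kt Gt transpose_transpose matrix_mul_assoc)
    also have "trace \<dots> = trace (?G ** ?X ** ?G ** K)" by (rule trace_mul_sym)
    finally have a: "trace (?G ** transpose ?X ** ?G ** K) = trace (?G ** ?X ** ?G ** K)" .
    have b: "?G ** ?X ** ?G ** K = ?B ** ?Y ** (?G ** K)"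
      by (simp only: matrix_mul_assoc metric_inv[OF g] matrix_mul_lid)
    have "trace (sk ?w ** (?G ** K ** ?G)) = 0"
      by (rule trace_sk_symmetric) (simp only: matrix_transpose_mul Kt Gt matrix_mul_assoc)
    then have c: "trace (?G ** sk ?w ** ?G ** K) = 0"
      using trace_mul_sym[of "sk ?w ** ?G ** K" ?G] by (simp add: matrix_mul_assoc)
    have "trace (?N ** ?G ** K) = (1/2) * (- trace (?G ** transpose ?X ** ?G ** K)
        - trace (?G ** ?X ** ?G ** K) - trace (?G ** sk ?w ** ?G ** K))"
      unfolding nab_def by (simp only: mm.diff_right mm.diff_left mm.minus_right mm.minus_left
          mm.scaleR_left linear_scale[OF linear_trace] linear_diff[OF linear_trace] linear_neg[OF linear_trace]) simp
    then show ?thesis unfolding a b c by simp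
  qed
  finally have 2: "(\<Sum>i\<in>UNIV. \<Sum>k\<in>UNIV. gi g i k * (\<Sum>l\<in>UNIV. gam C g l k j * K $ i $ l))
      = - trace (?B ** ?Y ** (?G ** K))" .
  have "divK C g K j = - (\<Sum>i\<in>UNIV. \<Sum>k\<in>UNIV. gi g i k * (\<Sum>l\<in>UNIV. gam C g l k i * K $ l $ j))
     - (\<Sum>i\<in>UNIV. \<Sum>k\<in>UNIV. gi g i k * (\<Sum>l\<in>UNIV. gam C g l k j * K $ i $ l))"
    by (simp add: divK_def right_diff_distrib sum_subtractf sum_negf)
  then show ?thesis unfolding 1 2 by simp
qed

end

section \<open>Maxwell stress and the right-hand sides of the system in vector form\<close>

lemma sum_conj: "(\<Sum>k\<in>UNIV. \<Sum>l\<in>UNIV. A $ i $ k * A $ j $ l * F $ k $ l) = (A ** F ** transpose A) $ i $ j"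
  for A F :: "real^3^3"
  by (simp add: sum_3 matrix_matrix_mult_def transpose_def algebra_simps)

lemma nab_add: "nab S a g (y + z) = nab S a g y + nab S a g z"
  by (simp add: nab_def mat_linear vec_eq_iff algebra_simps)

lemma nab_scaleR: "nab S a g (r *\<^sub>R y) = r *\<^sub>R nab S a g y"
  by (simp add: nab_def mat_linear vec_eq_iff algebra_simps)

lemma vec3_eq_axis: "u = (u $ 1) *\<^sub>R axis 1 1 + (u $ 2) *\<^sub>R axis 2 1 + (u $ 3) *\<^sub>R axis 3 1"
  for u :: "real^3"
  by (simp add: vec_eq_iff forall_3 axis_def)

context
  fixes g :: "real^3^3" and f :: "real^3" and \<phi> :: "real^3"
  assumes g: "posdef g" and phi: "\<phi> = (1 / det g) *\<^sub>R (g *v f)"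
begin

lemma inv_sk_inv': "matrix_inv g ** sk f ** matrix_inv g = sk \<phi>"
  unfolding phi by (rule inv_sk_inv[OF g])

lemma trace_faraday: "trace (matrix_inv g ** sk f ** matrix_inv g ** transpose (sk f)) = 2 * (\<phi> \<bullet> f)"
  unfolding inv_sk_inv' transpose_sk mm.minus_right linear_neg[OF linear_trace] trace_sk_sk by simp

lemma tau00_eq: "tau00 g (sk f) E = (E \<bullet> (g *v E) + \<phi> \<bullet> f) / 2"
proof -
  have "(\<Sum>i\<in>UNIV. \<Sum>j\<in>UNIV. \<Sum>k\<in>UNIV. \<Sum>l\<in>UNIV. gi g i k * gi g j l * sk f $ k $ l * sk f $ i $ j)
      = (\<Sum>i\<in>UNIV. \<Sum>j\<in>UNIV. (matrix_inv g ** sk f ** transpose (matrix_inv g)) $ i $ j * sk f $ i $ j)"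
    unfolding sum_conj[symmetric] by (simp add: gi_def sum_distrib_right)
  also have "\<dots> = 2 * (\<phi> \<bullet> f)"
    unfolding sum_trace metric_sym[OF g] trace_faraday ..
  finally show ?thesis by (simp add: tau00_def sum_double_form[of g])
qed

text \<open>By the double cross product \<open>sk_sk\<close> the quadratic term in \<open>F\<close>
  is a multiple of \<open>g\<close> minus \<open>outer (g *v f) \<phi>\<close>, so the magnetic part
  takes the same shape as the electric one.\<close>

lemma stress_eq: "stress g (sk f) E u rho = (tau00 g (sk f) E + rho / 3) *\<^sub>R g
    - outer (g *v E) (g *v E) - outer (g *v f) \<phi> + (4/3 * rho) *\<^sub>R outer (g *v u) (g *v u)"
proof -
  let ?F = "sk f" and ?G = "matrix_inv g"
  have gs: "g $ j $ l = g $ l $ j" for j l by (rule symmetric_entry[OF metric_sym(1)[OF g]])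
  have "(\<Sum>k\<in>UNIV. \<Sum>m\<in>UNIV. \<Sum>n\<in>UNIV. \<Sum>l\<in>UNIV. gi g k m * gi g n l * ?F $ k $ l * ?F $ m $ n)
      = (\<Sum>k\<in>UNIV. \<Sum>m\<in>UNIV. ?G $ k $ m * (\<Sum>n\<in>UNIV. \<Sum>l\<in>UNIV. ?G $ n $ l * ?F $ k $ l * ?F $ m $ n))"
    by (simp add: gi_def sum_distrib_left mult.assoc)
  also have "\<dots> = (\<Sum>k\<in>UNIV. \<Sum>m\<in>UNIV. ?G $ k $ m * (?F ** transpose ?G ** transpose ?F) $ k $ m)"
    by (simp add: matrix_matrix_mult_def transpose_def sum_distrib_left sum_distrib_right ac_simps)
  also have "\<dots> = trace (?G ** transpose (?F ** transpose ?G ** transpose ?F))" by (rule sum_trace)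
  also have "\<dots> = trace (?G ** ?F ** ?G ** transpose ?F)"
    by (simp add: matrix_transpose_mul metric_sym[OF g] matrix_mul_assoc)
  finally have 4: "(\<Sum>k\<in>UNIV. \<Sum>m\<in>UNIV. \<Sum>n\<in>UNIV. \<Sum>l\<in>UNIV. gi g k m * gi g n l * ?F $ k $ l * ?F $ m $ n) = 2 * (\<phi> \<bullet> f)"
    unfolding trace_faraday .
  have "?F ** ?G ** transpose ?F = (\<phi> \<bullet> f) *\<^sub>R g - outer (g *v f) \<phi>"
  proof -
    have "?F = g ** sk \<phi> ** g"
      unfolding inv_sk_inv'[symmetric] by (simp add: matrix_mul_assoc metric_inv[OF g])
        (simp add: matrix_mul_assoc[symmetric] metric_inv[OF g])
    then have "?F ** ?G ** transpose ?F = - (g ** sk \<phi> ** (g ** ?G) ** sk f)"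
      by (metis matrix_mul_assoc mm.minus_right transpose_sk)
    also have "\<dots> = - (g ** (sk \<phi> ** sk f))" by (simp add: metric_inv[OF g] matrix_mul_assoc)
    also have "\<dots> = (\<phi> \<bullet> f) *\<^sub>R g - g ** outer f \<phi>"
      by (simp add: sk_sk mat_linear)
    also have "g ** outer f \<phi> = outer (g *v f) \<phi>"
      by (simp add: vec_eq_iff outer_def matrix_matrix_mult_def matrix_vector_mult_def sum_distrib_right mult.assoc)
    finally show ?thesis .
  qed
  moreover have "(\<Sum>k\<in>UNIV. \<Sum>l\<in>UNIV. gi g k l * ?F $ i $ k * ?F $ j $ l) = (?F ** ?G ** transpose ?F) $ i $ j" for i j
    by (simp add: gi_def sum_3 matrix_matrix_mult_def transpose_def algebra_simps)
  ultimately have 5: "(\<Sum>k\<in>UNIV. \<Sum>l\<in>UNIV. gi g k l * ?F $ i $ k * ?F $ j $ l)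
      = (\<phi> \<bullet> f) * g $ i $ j - (g *v f) $ i * \<phi> $ j" for i j
    by (simp add: outer_def)
  have 6: "(\<Sum>k\<in>UNIV. \<Sum>l\<in>UNIV. (1/2 * g $ i $ j * g $ k $ l - g $ i $ k * g $ j $ l) * E $ k * E $ l)
      = (E \<bullet> (g *v E)) / 2 * g $ i $ j - (g *v E) $ i * (g *v E) $ j" for i j
    by (simp add: inner_vec_def matrix_vector_mult_def sum_3 field_simps)
  show ?thesis
    unfolding vec_eq_iff
  proof (intro allI)
    fix i j
    show "stress g ?F E u rho $ i $ j = ((tau00 g ?F E + rho / 3) *\<^sub>R g
        - outer (g *v E) (g *v E) - outer (g *v f) \<phi> + (4/3 * rho) *\<^sub>R outer (g *v u) (g *v u)) $ i $ j"
      unfolding stress_def vec_lambda_beta tauij_def 4 5 6 Tij_def ulow_eq tau00_eq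
      by (simp add: outer_def field_simps)
  qed
qed

lemma stress_sym: "transpose (stress g (sk f) E u rho) = stress g (sk f) E u rho"
proof -
  have "transpose (outer x y) = outer y x" for x y
    by (simp add: transpose_def outer_def vec_eq_iff mult.commute)
  moreover have "outer \<phi> (g *v f) = outer (g *v f) \<phi>"
    by (simp add: phi outer_def vec_eq_iff)
  ultimately show ?thesis by (simp add: stress_eq mat_linear metric_sym[OF g])
qed

lemma inv_stress: "matrix_inv g ** stress g (sk f) E u rho = (tau00 g (sk f) E + rho / 3) *\<^sub>R mat 1
    - outer E (g *v E) - outer f \<phi> + (4/3 * rho) *\<^sub>R outer u (g *v u)"
proof -
  have "matrix_inv g ** outer (g *v x) y = outer x y" for x y
  proof -
    have "matrix_inv g ** outer (g *v x) y = outer (matrix_inv g *v (g *v x)) y"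
      by (simp add: vec_eq_iff outer_def matrix_matrix_mult_def matrix_vector_mult_def[of "matrix_inv g"] sum_distrib_right mult.assoc)
    then show ?thesis by (simp add: matrix_vector_mul_assoc metric_inv[OF g])
  qed
  then show ?thesis by (simp add: stress_eq mat_linear metric_inv[OF g])
qed

lemma trace_Tij: "(\<Sum>l\<in>UNIV. \<Sum>m\<in>UNIV. gi g l m * Tij g u rho l m) = 4/3 * rho * (u \<bullet> (g *v u)) + rho"
proof -
  have "(\<Sum>l\<in>UNIV. \<Sum>m\<in>UNIV. gi g l m * Tij g u rho l m)
      = trace (matrix_inv g ** transpose ((4/3 * rho) *\<^sub>R outer (g *v u) (g *v u) + (rho/3) *\<^sub>R g))"
    unfolding sum_trace[symmetric] by (simp add: gi_def Tij_def ulow_eq outer_def mult.assoc)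
  also have "\<dots> = 4/3 * rho * trace (matrix_inv g ** outer (g *v u) (g *v u)) + rho"
  proof -
    have "transpose (outer (g *v u) (g *v u)) = outer (g *v u) (g *v u)"
      by (simp add: transpose_def outer_def vec_eq_iff mult.commute)
    then show ?thesis by (simp add: mat_linear metric_sym[OF g] metric_inv[OF g] trace_I)
  qed
  also have "trace (matrix_inv g ** outer (g *v u) (g *v u)) = u \<bullet> (g *v u)"
    by (simp add: trace_mult_outer matrix_vector_mul_assoc metric_inv[OF g] inner_commute)
  finally show ?thesis .
qed

lemma rhs_K_eq:
  assumes K: "symm K"
  defines "G \<equiv> matrix_inv g"
  shows "rhs_K C \<Lambda> g K (sk f) E u th00 rho = Ric_mat C g + trace (G ** K) *\<^sub>R K - 2 *\<^sub>R (K ** G ** K)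
     - (8 * pi) *\<^sub>R stress g (sk f) E u rho
     + (4 * pi * (- T00 g u th00 rho + 4/3 * rho * (u \<bullet> (g *v u)) + rho) - \<Lambda>) *\<^sub>R g"
proof -
  have "(\<Sum>l\<in>UNIV. Kmix g K l j * K $ i $ l) = (K ** G ** K) $ i $ j" for i j
    unfolding Kmix_eq G_def matrix_mul_assoc[symmetric]
    by (simp add: matrix_matrix_mult_def[of K "matrix_inv g ** K"] mult.commute)
  then show ?thesis
    unfolding rhs_K_def trace_Tij Hmean_eq[OF g K] G_def[symmetric]
    by (simp add: vec_eq_iff Ric_mat_def stress_def algebra_simps)
qed

end

context
  fixes C :: sconst and g :: "real^3^3"
  assumes lie: "lie_structure C" and g: "posdef g"
begin

lemma rhs_F_eq: "rhs_F C g E = - sk (transpose (bmat (str_sym C) (str_vec C)) *v (g *v E))"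
proof -
  let ?B = "bmat (str_sym C) (str_vec C)"
  have "rhs_F C g E $ i $ j = - sk (transpose ?B *v (g *v E)) $ i $ j" for i j
  proof -
    have "rhs_F C g E $ i $ j = (g *v E) \<bullet> (?B *v cross3 (axis i 1) (axis j 1))"
    proof -
      have "rhs_F C g E $ i $ j = (\<Sum>k\<in>UNIV. C k i j * (g *v E) $ k)"
        by (simp add: rhs_F_def matrix_vector_mult_def sum_distrib_left mult.assoc)
      then show ?thesis using sconst_eq[OF lie, of _ i j] by (simp add: inner_vec_def mult.commute)
    qed
    also have "\<dots> = (transpose ?B *v (g *v E)) \<bullet> cross3 (axis i 1) (axis j 1)" by (simp add: dot_transpose)
    also have "\<dots> = - (axis i 1 \<bullet> (sk (transpose ?B *v (g *v E)) *v axis j 1))"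
      unfolding sk_mult by (rule triple_swap)
    finally show ?thesis by (simp only: matrix_component[of "sk _"])
  qed
  then show ?thesis by (simp only: vec_eq_iff vector_uminus_component) simp
qed

text \<open>The contraction with the trace form reverses the antisymmetric half of
  \<open>bmat\<close>, turning \<open>bmat\<close> into its transpose; \<open>rhs_F_eq\<close> has
  the same operator, which is what makes the curl terms cancel later.\<close>

lemma rhs_E_eq:
  assumes phi: "\<phi> = (1 / det g) *\<^sub>R (g *v f)" and K: "symm K"
  shows "rhs_E C g K (sk f) E u = trace (matrix_inv g ** K) *\<^sub>R E
    - (str_vec C \<bullet> E / uzero g u) *\<^sub>R u + transpose (bmat (str_sym C) (str_vec C)) *v \<phi>"
proof -
  let ?G = "matrix_inv g" and ?B = "bmat (str_sym C) (str_vec C)" and ?a = "str_vec C"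
  have GFG: "?G ** sk f ** transpose ?G = sk \<phi>"
    by (simp add: metric_sym[OF g] inv_sk_inv'[OF g phi])
  have 1: "(\<Sum>k\<in>UNIV. \<Sum>l\<in>UNIV. \<Sum>m\<in>UNIV. trC C k * gi g k l * gi g i m * sk f $ l $ m) = - cross3 \<phi> ?a $ i" for i
  proof -
    have "(\<Sum>k\<in>UNIV. \<Sum>l\<in>UNIV. \<Sum>m\<in>UNIV. trC C k * gi g k l * gi g i m * sk f $ l $ m)
        = (\<Sum>k\<in>UNIV. ?a $ k * (?G ** sk f ** transpose ?G) $ k $ i)"
      unfolding sum_conj[symmetric] by (simp add: gi_def str_vec_def sum_distrib_left ac_simps)
    also have "\<dots> = (transpose (sk \<phi>) *v ?a) $ i"
      unfolding GFG matrix_vector_mult_def[of "transpose (sk \<phi>)"] by (simp add: transpose_def mult.commute)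
    finally show ?thesis by (simp add: transpose_sk mat_linear sk_mult)
  qed
  have 2: "(\<Sum>j\<in>UNIV. \<Sum>k\<in>UNIV. \<Sum>l\<in>UNIV. \<Sum>m\<in>UNIV. C i j k * gi g j l * gi g k m * sk f $ l $ m) = - 2 * (?B *v \<phi>) $ i" for i
  proof -
    have "(\<Sum>j\<in>UNIV. \<Sum>k\<in>UNIV. \<Sum>l\<in>UNIV. \<Sum>m\<in>UNIV. C i j k * gi g j l * gi g k m * sk f $ l $ m)
        = (\<Sum>j\<in>UNIV. \<Sum>k\<in>UNIV. C i j k * (?G ** sk f ** transpose ?G) $ j $ k)"
      unfolding sum_conj[symmetric] by (simp add: gi_def sum_distrib_left ac_simps)
    also have "\<dots> = - 2 * (?B *v \<phi>) $ i"
      unfolding GFG str_mat_eq[OF lie, symmetric]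
      by (simp add: sum_3 sk_def cross_components axis_def sconst_antisym[OF lie] str_mat_def matrix_vector_mult_def algebra_simps)
    finally show ?thesis .
  qed
  have "?B *v \<phi> + cross3 \<phi> ?a = transpose ?B *v \<phi>"
    by (simp add: mat_linear transpose_sk sk_mult str_sym_transpose[OF lie] cross_skew[of \<phi>] vec_eq_iff)
  then have 3: "(?B *v \<phi>) $ i + cross3 \<phi> ?a $ i = (transpose ?B *v \<phi>) $ i" for i
    by (metis vector_add_component)
  show ?thesis
    unfolding rhs_E_def 1 2 sum_trC Hmean_eq[OF g K]
    using 3 by (simp add: vec_eq_iff algebra_simps)
qed

lemma rhs_u_eq:
  fixes K f u E
  defines "w \<equiv> transpose (bmat (str_sym C) (str_vec C)) *v (g *v u)"
    and "G \<equiv> matrix_inv g" and "aE \<equiv> str_vec C \<bullet> E" and "u0 \<equiv> uzero g u"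
  shows "rhs_u C g K (sk f) E u rho = G *v (2 *\<^sub>R (K *v u) - (1 / u0) *\<^sub>R cross3 u w)
    + (3 / (4 * rho * u0) * aE) *\<^sub>R E + (3 / (4 * rho * u0\<^sup>2) * aE) *\<^sub>R (G *v cross3 f u)"
proof -
  let ?N = "nab (str_sym C) (str_vec C) g"
  define B where "B = bmat (str_sym C) (str_vec C)"
  have Nu: "?N u = (u $ 1) *\<^sub>R ?N (axis 1 1) + (u $ 2) *\<^sub>R ?N (axis 2 1) + (u $ 3) *\<^sub>R ?N (axis 3 1)"
    by (subst vec3_eq_axis[of u]) (simp only: nab_add nab_scaleR)
  have 1: "(\<Sum>j\<in>UNIV. \<Sum>k\<in>UNIV. gam C g i j k * u $ j * u $ k) = (?N u *v u) $ i" for i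
    unfolding Nu by (simp add: gam_eq_nab[OF lie g] sum_3 matrix_vector_mult_def algebra_simps)
  have wB: "w = transpose B *v (g *v u)" by (simp only: w_def B_def)
  \<comment> \<open>The covariant derivative of \<open>u\<close> along itself: one Koszul term
    contains the cross product of \<open>u\<close> with itself, the other two agree.\<close>
  have "?N u *v u = G *v cross3 u w"
  proof -
    have "transpose (g ** B ** sk u) *v u = - cross3 u w"
      by (simp add: matrix_transpose_mul transpose_sk mat_linear metric_sym[OF g] matrix_vector_mul_assoc[symmetric] sk_mult wB)
    moreover have "(g ** B ** sk u) *v u = 0"
      by (simp add: matrix_vector_mul_assoc[symmetric] sk_mult)
    moreover have "sk w *v u = - cross3 u w" by (simp add: sk_mult cross_skew[of w])
    ultimately have "(- transpose (g ** B ** sk u) - g ** B ** sk u - sk w) *v u = 2 *\<^sub>R cross3 u w"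
      by (simp add: mv.diff_left mv.minus_left scaleR_2)
    then show ?thesis
      unfolding nab_def w_def[symmetric] B_def[symmetric] G_def[symmetric]
      by (simp add: mv.scaleR_left matrix_vector_mul_assoc[symmetric] mv.scaleR_right wB[symmetric])
  qed
  then have 2: "(\<Sum>j\<in>UNIV. \<Sum>k\<in>UNIV. gam C g i j k * u $ j * u $ k) = (G *v cross3 u w) $ i" for i
    unfolding 1 by simp
  have 3: "(\<Sum>l\<in>UNIV. \<Sum>m\<in>UNIV. gi g i l * sk f $ m $ l * u $ m) = - (G *v cross3 f u) $ i" for i
  proof -
    have "(\<Sum>l\<in>UNIV. \<Sum>m\<in>UNIV. gi g i l * sk f $ m $ l * u $ m) = (G *v (transpose (sk f) *v u)) $ i"
      by (simp add: matrix_vector_mult_def gi_def G_def transpose_def sum_distrib_left ac_simps)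
    then show ?thesis by (simp add: transpose_sk mat_linear sk_mult)
  qed
  have 4: "(\<Sum>j\<in>UNIV. Kmix g K i j * u $ j) = (G *v (K *v u)) $ i" for i
    by (simp add: Kmix_eq G_def matrix_vector_mult_def[of "_ ** _"] matrix_vector_mul_assoc)
  show ?thesis
    unfolding rhs_u_def 2 3 4 sum_trC aE_def u0_def
    by (simp add: vec_eq_iff mv.diff_right mv.scaleR_right)
qed

text \<open>The two terms with the factor \<open>rho / 3\<close> cancel by
  \<open>sum_gam_contract\<close>.\<close>

lemma rhs_th0_eq:
  "symm K \<Longrightarrow> rhs_th0 C g K u th0 rho = trace (matrix_inv g ** K) *\<^sub>R th0
     + 2 *\<^sub>R (matrix_inv g *v (K *v th0)) + rho *\<^sub>R u"
proof -
  assume K: "symm K"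
  have "(\<Sum>j\<in>UNIV. trC C j * gi g i j) = (matrix_inv g *v str_vec C) $ i" for i
    by (simp add: matrix_vector_mult_def gi_def str_vec_def mult.commute)
  moreover have "(\<Sum>j\<in>UNIV. Kmix g K i j * th0 $ j) = (matrix_inv g *v (K *v th0)) $ i" for i
    by (simp add: Kmix_eq matrix_vector_mult_def[of "_ ** _"] matrix_vector_mul_assoc)
  ultimately show ?thesis
    by (simp add: rhs_th0_def sum_gam_contract[OF lie g] Hmean_eq[OF g K] vec_eq_iff)
qed

end

lemma rhs_th00_eq: "posdef g \<Longrightarrow> symm K \<Longrightarrow> rhs_th00 C g K u th00 th0 rho = trace (matrix_inv g ** K) * th00
    - str_vec C \<bullet> th0 + 1/3 * rho * trace (matrix_inv g ** K) + rho * uzero g u"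
  by (simp add: rhs_th00_def sum_trC' Hmean_eq)

lemma rhs_rho_eq: "posdef g \<Longrightarrow> symm K \<Longrightarrow> rhs_rho C g K E u rho =
    - (3 / (4 * uzero g u) + (u \<bullet> (K *v u)) / (uzero g u)\<^sup>2 - trace (matrix_inv g ** K)
       + (str_vec C \<bullet> u) / uzero g u) * rho
    - 3/4 * (str_vec C \<bullet> E) * (u \<bullet> (g *v E)) / (uzero g u) ^ 3"
proof -
  assume "posdef g" "symm K"
  have "(\<Sum>i\<in>UNIV. \<Sum>l\<in>UNIV. \<Sum>k\<in>UNIV. g $ i $ l * trC C k * E $ k * E $ l * u $ i)
      = (\<Sum>k\<in>UNIV. trC C k * E $ k) * (\<Sum>i\<in>UNIV. \<Sum>l\<in>UNIV. g $ i $ l * u $ i * E $ l)"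
    by (simp add: sum_3) algebra
  then show ?thesis
    unfolding rhs_rho_def sum_trC sum_trC' sum_double_form
    by (simp add: Hmean_eq \<open>posdef g\<close> \<open>symm K\<close>)
qed

lemma rhs_e_eq: "posdef g \<Longrightarrow> symm K \<Longrightarrow> rhs_e C g K E u rho e =
    - ((u \<bullet> (K *v u)) / (uzero g u)\<^sup>2 + (str_vec C \<bullet> u) / uzero g u - trace (matrix_inv g ** K)) * e
    + 3/4 * (u \<bullet> (g *v E)) / (uzero g u)\<^sup>2 * e\<^sup>2 / rho"
  by (simp add: rhs_e_def Hmean_eq sum_trC' sum_double_form)

subsection \<open>Derivatives of matrix-valued curves\<close>

text \<open>The adjugate, expressed through products and traces by Cayley-Hamilton, so that the
  product rules alone can differentiate it.\<close>

definition adj3 :: "real^3^3 \<Rightarrow> real^3^3" where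
  "adj3 g = g ** g - trace g *\<^sub>R g + (((trace g)\<^sup>2 - trace (g ** g)) / 2) *\<^sub>R mat 1"

lemma adj3_mult: "g ** adj3 g = det g *\<^sub>R mat 1" "adj3 g ** g = det g *\<^sub>R mat 1"
  unfolding adj3_def by (simp_all add: comp3 power2_eq_square field_simps)

lemma matrix_inv_adj3: "det g \<noteq> 0 \<Longrightarrow> matrix_inv g = (1 / det g) *\<^sub>R adj3 g" for g :: "real^3^3"
  by (rule matrix_inv_eqI) (simp_all add: adj3_mult mat_linear)

lemmas hvd_trace = bounded_linear.has_vector_derivative[OF linear_conv_bounded_linear[THEN iffD1, OF linear_trace]]
lemmas hvd_rules = mm.has_vector_derivative mv.has_vector_derivative cr.has_vector_derivative
  bounded_bilinear.has_vector_derivative[OF bounded_bilinear_inner]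
  bounded_bilinear.has_vector_derivative[OF bounded_bilinear_scaleR]
  bounded_bilinear.has_vector_derivative[OF bounded_bilinear_mult]
  hvd_trace has_vector_derivative_add has_vector_derivative_diff has_vector_derivative_minus

lemma vderiv_divide:
  fixes p q :: "real \<Rightarrow> real"
  assumes "(p has_vector_derivative p') (at t within I)" "(q has_vector_derivative q') (at t within I)" "q t \<noteq> 0"
  shows "((\<lambda>t. p t / q t) has_vector_derivative (p' * q t - p t * q') / (q t * q t)) (at t within I)"
  using assms DERIV_divide[of p p' t I q q']
  by (simp add: has_real_derivative_iff_has_vector_derivative)

lemma vderiv_adj3:
  fixes g :: "real \<Rightarrow> real^3^3"
  assumes "(g has_vector_derivative g') (at t within I)"
  shows "\<exists>D. ((\<lambda>t. adj3 (g t)) has_vector_derivative D) (at t within I)"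
  unfolding adj3_def power2_eq_square divide_inverse
  by (rule exI, (rule hvd_rules assms has_vector_derivative_const)+)

text \<open>Newton's identity for the third elementary symmetric function of the eigenvalues; it
  makes the determinant accessible to \<open>hvd_rules\<close>.\<close>

lemma det_eq_traces:
  "det g = ((trace g) ^ 3 - 3 * trace g * trace (g ** g) + 2 * trace (g ** g ** g)) * (1/6)" for g :: "real^3^3"
  by (simp add: comp3 power3_eq_cube) algebra

lemma vderiv_det:
  fixes g :: "real \<Rightarrow> real^3^3"
  assumes g: "(g has_vector_derivative g') (at t within I)"
  shows "((\<lambda>t. det (g t)) has_vector_derivative trace (adj3 (g t) ** g')) (at t within I)"
proof -
  let ?D = "\<lambda>t. (trace (g t) * (trace (g t) * trace (g t)) - 3 * (trace (g t) * trace (g t ** g t))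
    + 2 * trace (g t ** g t ** g t)) * (1/6)"
  have "(\<lambda>t. det (g t)) = ?D"
    by (simp add: det_eq_traces power3_eq_cube fun_eq_iff algebra_simps)
  moreover have "(?D has_vector_derivative trace (adj3 (g t) ** g')) (at t within I)"
    by (rule has_vector_derivative_eq_rhs, (rule hvd_rules g has_vector_derivative_const)+)
      (use trace_mul_sym[of g' "g t ** g t"] trace_mul_sym[of "g t ** g'" "g t"] trace_mul_sym[of g' "g t"] in
        \<open>simp add: adj3_def mat_linear power2_eq_square matrix_mul_assoc field_simps\<close>)
  ultimately show ?thesis by simp
qed

text \<open>Differentiability comes from Cramer's rule with some derivative \<open>D2\<close>; its
  value follows by differentiating the product of the inverse with \<open>g\<close>. Comparing
  derivatives requires their uniqueness, hence \<open>nt\<close>.\<close>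

lemma vderiv_matrix_inv:
  fixes g :: "real \<Rightarrow> real^3^3"
  assumes g: "(g has_vector_derivative g') (at t within I)" and t: "t \<in> I"
    and nt: "at t within I \<noteq> bot" and d: "\<And>s. s \<in> I \<Longrightarrow> det (g s) \<noteq> 0"
  shows "((\<lambda>t. matrix_inv (g t)) has_vector_derivative - (matrix_inv (g t) ** g' ** matrix_inv (g t))) (at t within I)"
proof -
  obtain D where D: "((\<lambda>t. adj3 (g t)) has_vector_derivative D) (at t within I)"
    using vderiv_adj3[OF g] by blast
  have "((\<lambda>t. 1 / det (g t)) has_vector_derivative (0 * det (g t) - 1 * trace (adj3 (g t) ** g')) / (det (g t) * det (g t))) (at t within I)"
    by (rule vderiv_divide[OF has_vector_derivative_const vderiv_det[OF g] d[OF t]])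
  from bounded_bilinear.has_vector_derivative[OF bounded_bilinear_scaleR this D]
  obtain D2 where "((\<lambda>t. (1 / det (g t)) *\<^sub>R adj3 (g t)) has_vector_derivative D2) (at t within I)" by blast
  then have D2: "((\<lambda>t. matrix_inv (g t)) has_vector_derivative D2) (at t within I)"
    by (rule has_vector_derivative_transform[OF t, rotated]) (simp add: matrix_inv_adj3 d)
  have inv: "g s ** matrix_inv (g s) = mat 1" "matrix_inv (g s) ** g s = mat 1" if "s \<in> I" for s
    using d[OF that] by (simp_all add: matrix_inv_adj3 adj3_mult mat_linear)
  have "((\<lambda>t. matrix_inv (g t) ** g t) has_vector_derivative matrix_inv (g t) ** g' + D2 ** g t) (at t within I)"
    by (rule mm.has_vector_derivative[OF D2 g])
  then have "((\<lambda>t. mat 1 :: real^3^3) has_vector_derivative matrix_inv (g t) ** g' + D2 ** g t) (at t within I)"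
    by (rule has_vector_derivative_transform[OF t, rotated]) (simp add: inv)
  from vector_derivative_unique_within[OF nt this has_vector_derivative_const]
  have "D2 ** g t = - (matrix_inv (g t) ** g')" by (simp add: eq_neg_iff_add_eq_0 add.commute)
  then have "D2 ** (g t ** matrix_inv (g t)) = - (matrix_inv (g t) ** g') ** matrix_inv (g t)"
    by (simp add: matrix_mul_assoc)
  then show ?thesis using D2 by (simp add: inv[OF t] mat_linear)
qed

subsection \<open>Evolution along a solution\<close>

locale ebs_solution =
  fixes C :: sconst and \<Lambda> T :: real
    and g K F :: "real \<Rightarrow> real^3^3" and E u :: "real \<Rightarrow> real^3" and th00 :: "real \<Rightarrow> real"
    and th0 :: "real \<Rightarrow> real^3" and rho e :: "real \<Rightarrow> real"
  assumes lie: "lie_structure C" and T: "T > 0"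
    and sol: "solves_S C \<Lambda> {0..<T} g K F E u th00 th0 rho e"
begin

abbreviation "I \<equiv> {0..<T}"
abbreviation "S \<equiv> str_sym C"
abbreviation "a \<equiv> str_vec C"
definition "B = bmat S a"
definition "G t = matrix_inv (g t)"
definition "f t = axial (F t)"
definition "\<phi> t = (1 / det (g t)) *\<^sub>R (g t *v f t)"
definition "H t = trace (G t ** K t)"
definition "u0 t = uzero (g t) (u t)"
text \<open>\<open>tau\<close> is the electromagnetic energy density, \<open>Km\<close> the mixed
  tensor of \<open>K\<close>, \<open>st\<close> the total stress with lower indices, and
  \<open>Td\<close> the component \<open>T_00\<close>.\<close>

definition "tau t = (E t \<bullet> (g t *v E t) + \<phi> t \<bullet> f t) / 2"
definition "Km t = G t ** K t"
definition "st t = stress (g t) (F t) (E t) (u t) (rho t)"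
definition "Td t = 4/3 * rho t * (u0 t)\<^sup>2 + th00 t"
definition "w t = transpose B *v (g t *v u t)"

lemma I: "0 \<in> I" "is_interval I"
  using T by (auto simp: is_interval_co)

text \<open>\<open>I\<close> has no isolated point, so derivatives within \<open>I\<close> are
  unique.\<close>

lemma at_I: "t \<in> I \<Longrightarrow> at t within I \<noteq> bot"
proof -
  assume t: "t \<in> I"
  have "0 \<in> I" "T/2 \<in> I" "(0::real) \<noteq> T/2" using T by auto
  then have "\<not> (\<exists>x. I = {x})" by (metis singletonD)
  then have "t islimpt I"
    using t by (intro connected_imp_perfect) auto
  then show ?thesis by (simp add: trivial_limit_within)
qed

context
  fixes t assumes t: "t \<in> I"
begin

lemma posdef_g: "posdef (g t)" and symm_K: "symm (K t)" and antisymm_F: "antisymm (F t)"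
  and rho_pos: "rho t > 0" and e_nonneg: "e t \<ge> 0"
  using sol t unfolding solves_S_def by blast+

lemma F_eq: "F t = sk (f t)"
  using sk_axial[OF antisymm_F] by (simp add: f_def)

lemma K_sym: "transpose (K t) = K t"
  using symm_K by (simp add: symm_iff_transpose)

lemma gs: "transpose (g t) = g t" and Gs: "transpose (G t) = G t"
  using metric_sym[OF posdef_g] by (auto simp: G_def)

lemma gG: "g t ** G t = mat 1" "G t ** g t = mat 1"
  using metric_inv[OF posdef_g] by (auto simp: G_def)

lemma det_pos: "det (g t) > 0"
  by (rule posdef_det_pos[OF posdef_g])

lemma g_quad_nonneg: "0 \<le> x \<bullet> (g t *v x)"
  using posdef_g unfolding posdef_iff by (cases "x = 0") (auto intro: less_imp_le)

lemma u0_sq: "(u0 t)\<^sup>2 = 1 + u t \<bullet> (g t *v u t)" and u0_ge: "u0 t \<ge> 1"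
  using g_quad_nonneg[of "u t"] by (auto simp: u0_def uzero_eq)

lemma u0_pos: "u0 t > 0"
  using u0_ge by linarith

lemma Bt: "B *v x = S *v x + (1/2) *\<^sub>R cross3 a x" "transpose B *v x = S *v x - (1/2) *\<^sub>R cross3 a x"
  by (simp_all add: B_def mat_linear transpose_sk sk_mult str_sym_transpose[OF lie])

lemma Ba: "B *v a = 0" "transpose B *v a = 0"
  unfolding Bt by (simp_all add: str_sym_vec[OF lie])

lemma derivs:
  "(g has_vector_derivative (- 2) *\<^sub>R K t) (at t within I)"
  "(K has_vector_derivative Ric_mat C (g t) + H t *\<^sub>R K t - 2 *\<^sub>R (K t ** G t ** K t) - (8 * pi) *\<^sub>R st t
     + (4 * pi * (- Td t + 4/3 * rho t * (u t \<bullet> (g t *v u t)) + rho t) - \<Lambda>) *\<^sub>R g t) (at t within I)"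
  "(E has_vector_derivative H t *\<^sub>R E t - (a \<bullet> E t / u0 t) *\<^sub>R u t + transpose B *v \<phi> t) (at t within I)"
  "(u has_vector_derivative G t *v (2 *\<^sub>R (K t *v u t) - (1 / u0 t) *\<^sub>R cross3 (u t) (w t))
     + (3 / (4 * rho t * u0 t) * (a \<bullet> E t)) *\<^sub>R E t
     + (3 / (4 * rho t * (u0 t)\<^sup>2) * (a \<bullet> E t)) *\<^sub>R (G t *v cross3 (f t) (u t))) (at t within I)"
  "(th00 has_vector_derivative H t * th00 t - a \<bullet> th0 t + 1/3 * rho t * H t + rho t * u0 t) (at t within I)"
  "(th0 has_vector_derivative H t *\<^sub>R th0 t + 2 *\<^sub>R (G t *v (K t *v th0 t)) + rho t *\<^sub>R u t) (at t within I)"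
  "(rho has_vector_derivative - (3 / (4 * u0 t) + (u t \<bullet> (K t *v u t)) / (u0 t)\<^sup>2 - H t + (a \<bullet> u t) / u0 t) * rho t
     - 3/4 * (a \<bullet> E t) * (u t \<bullet> (g t *v E t)) / (u0 t) ^ 3) (at t within I)"
  "(e has_vector_derivative - ((u t \<bullet> (K t *v u t)) / (u0 t)\<^sup>2 + (a \<bullet> u t) / u0 t - H t) * e t
     + 3/4 * (u t \<bullet> (g t *v E t)) / (u0 t)\<^sup>2 * (e t)\<^sup>2 / rho t) (at t within I)"
proof -
  note raw = sol[unfolded solves_S_def, rule_format, OF t]
  note [simp] = B_def G_def H_def u0_def st_def Td_def T00_def \<phi>_def w_def F_eq
  show "(g has_vector_derivative (- 2) *\<^sub>R K t) (at t within I)"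
    using raw by (simp only: rhs_g_eq)
  have "(K has_vector_derivative rhs_K C \<Lambda> (g t) (K t) (sk (f t)) (E t) (u t) (th00 t) (rho t)) (at t within I)"
    using raw by (simp only: F_eq)
  then show "(K has_vector_derivative Ric_mat C (g t) + H t *\<^sub>R K t - 2 *\<^sub>R (K t ** G t ** K t) - (8 * pi) *\<^sub>R st t
     + (4 * pi * (- Td t + 4/3 * rho t * (u t \<bullet> (g t *v u t)) + rho t) - \<Lambda>) *\<^sub>R g t) (at t within I)"
    unfolding rhs_K_eq[OF posdef_g refl symm_K] by simp
  have "(E has_vector_derivative rhs_E C (g t) (K t) (sk (f t)) (E t) (u t)) (at t within I)"
    using raw by (simp only: F_eq)
  then show "(E has_vector_derivative H t *\<^sub>R E t - (a \<bullet> E t / u0 t) *\<^sub>R u t + transpose B *v \<phi> t) (at t within I)"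
    unfolding rhs_E_eq[OF lie posdef_g refl symm_K] by simp
  have "(u has_vector_derivative rhs_u C (g t) (K t) (sk (f t)) (E t) (u t) (rho t)) (at t within I)"
    using raw by (simp only: F_eq)
  then show "(u has_vector_derivative G t *v (2 *\<^sub>R (K t *v u t) - (1 / u0 t) *\<^sub>R cross3 (u t) (w t))
     + (3 / (4 * rho t * u0 t) * (a \<bullet> E t)) *\<^sub>R E t
     + (3 / (4 * rho t * (u0 t)\<^sup>2) * (a \<bullet> E t)) *\<^sub>R (G t *v cross3 (f t) (u t))) (at t within I)"
    unfolding rhs_u_eq[OF lie posdef_g] by simp
  show "(th00 has_vector_derivative H t * th00 t - a \<bullet> th0 t + 1/3 * rho t * H t + rho t * u0 t) (at t within I)"
    using raw rhs_th00_eq[OF posdef_g symm_K] by simp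
  show "(th0 has_vector_derivative H t *\<^sub>R th0 t + 2 *\<^sub>R (G t *v (K t *v th0 t)) + rho t *\<^sub>R u t) (at t within I)"
    using raw rhs_th0_eq[OF lie posdef_g symm_K] by simp
  show "(rho has_vector_derivative - (3 / (4 * u0 t) + (u t \<bullet> (K t *v u t)) / (u0 t)\<^sup>2 - H t + (a \<bullet> u t) / u0 t) * rho t
     - 3/4 * (a \<bullet> E t) * (u t \<bullet> (g t *v E t)) / (u0 t) ^ 3) (at t within I)"
    using raw rhs_rho_eq[OF posdef_g symm_K] by simp
  show "(e has_vector_derivative - ((u t \<bullet> (K t *v u t)) / (u0 t)\<^sup>2 + (a \<bullet> u t) / u0 t - H t) * e t
     + 3/4 * (u t \<bullet> (g t *v E t)) / (u0 t)\<^sup>2 * (e t)\<^sup>2 / rho t) (at t within I)"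
    using raw rhs_e_eq[OF posdef_g symm_K] by simp
qed

lemma deriv_F: "(F has_vector_derivative - sk (transpose B *v (g t *v E t))) (at t within I)"
  using sol[unfolded solves_S_def, rule_format, OF t] rhs_F_eq[OF lie posdef_g] unfolding B_def by simp

lemma deriv_f: "(f has_vector_derivative - (transpose B *v (g t *v E t))) (at t within I)"
proof -
  have "linear axial" by (simp add: linear_iff axial_def vec_eq_iff forall_3)
  then have "bounded_linear axial" by (simp add: linear_conv_bounded_linear)
  from bounded_linear.has_vector_derivative[OF this deriv_F]
  show ?thesis by (simp add: f_def[abs_def] linear_neg[OF linear_sk, symmetric])
qed

lemma deriv_G: "(G has_vector_derivative 2 *\<^sub>R (G t ** K t ** G t)) (at t within I)"
proof -
  have "det (g s) \<noteq> 0" if "s \<in> I" for s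
    using sol that posdef_det_pos unfolding solves_S_def by (metis less_irrefl)
  from vderiv_matrix_inv[OF derivs(1) t at_I[OF t] this]
  show ?thesis by (simp add: G_def[abs_def] mat_linear)
qed

lemma deriv_det: "((\<lambda>t. det (g t)) has_vector_derivative - 2 * H t * det (g t)) (at t within I)"
proof -
  have "adj3 (g t) = det (g t) *\<^sub>R G t"
    using det_pos by (simp add: G_def matrix_inv_adj3)
  then show ?thesis
    using vderiv_det[OF derivs(1)] by (simp add: H_def mat_linear mult.commute mult.left_commute)
qed

text \<open>In mixed form the quadratic term \<open>- 2 K G K\<close> is cancelled by the derivative
  of the inverse metric.\<close>

lemma deriv_Km: "(Km has_vector_derivative G t ** Ric_mat C (g t) + H t *\<^sub>R Km t - (8 * pi) *\<^sub>R (G t ** st t)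
     + (4 * pi * (- Td t + 4/3 * rho t * (u t \<bullet> (g t *v u t)) + rho t) - \<Lambda>) *\<^sub>R mat 1) (at t within I)"
  unfolding Km_def[abs_def]
  by (rule has_vector_derivative_eq_rhs[OF mm.has_vector_derivative[OF deriv_G derivs(2)]])
    (simp add: mat_linear gG matrix_mul_assoc)

lemma G_st: "G t ** st t = (tau t + rho t / 3) *\<^sub>R mat 1 - outer (E t) (g t *v E t) - outer (f t) (\<phi> t)
    + (4/3 * rho t) *\<^sub>R outer (u t) (g t *v u t)"
  unfolding st_def F_eq G_def
  using inv_stress[OF posdef_g, of "\<phi> t" "f t"] tau00_eq[OF posdef_g, of "\<phi> t" "f t" "E t"]
  by (simp add: \<phi>_def tau_def)

lemma H_Km: "H t = trace (Km t)"
  by (simp add: H_def Km_def)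

lemma trace_G_st: "trace (G t ** st t) = tau t + rho t + 4/3 * rho t * (u t \<bullet> (g t *v u t))"
proof -
  have "trace (outer x y) = x \<bullet> y" for x y by (simp add: comp3 outer_def)
  then show ?thesis
    unfolding G_st by (simp add: mat_linear trace_I tau_def inner_commute[of "f t"] field_simps)
qed

lemma deriv_H: "(H has_vector_derivative Rscal C (g t) + (H t)\<^sup>2 - 8 * pi * tau t
    + 4 * pi * (rho t + 4/3 * rho t * (u t \<bullet> (g t *v u t))) - 12 * pi * Td t - 3 * \<Lambda>) (at t within I)"
proof -
  have "(\<lambda>t. H t) = (\<lambda>t. trace (Km t))" by (simp add: H_def Km_def fun_eq_iff)
  moreover have "((\<lambda>t. trace (Km t)) has_vector_derivative Rscal C (g t) + (H t)\<^sup>2 - 8 * pi * tau t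
    + 4 * pi * (rho t + 4/3 * rho t * (u t \<bullet> (g t *v u t))) - 12 * pi * Td t - 3 * \<Lambda>) (at t within I)"
    by (rule has_vector_derivative_eq_rhs[OF hvd_trace[OF deriv_Km]])
      (simp add: mat_linear trace_G_st trace_I H_Km[symmetric] Rscal_eq_trace[OF lie posdef_g] G_def[symmetric]
        power2_eq_square algebra_simps)
  ultimately show ?thesis by simp
qed

text \<open>Lowering the index removes the \<open>K\<close>-term of the equation for
  \<open>u\<close>.\<close>

lemma deriv_gu: "((\<lambda>t. g t *v u t) has_vector_derivative (- (1 / u0 t)) *\<^sub>R cross3 (u t) (w t)
     + (3 / (4 * rho t * u0 t) * (a \<bullet> E t)) *\<^sub>R (g t *v E t)
     + (3 / (4 * rho t * (u0 t)\<^sup>2) * (a \<bullet> E t)) *\<^sub>R cross3 (f t) (u t)) (at t within I)"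
  by (rule has_vector_derivative_eq_rhs[OF mv.has_vector_derivative[OF derivs(1,4)]])
    (simp add: mat_linear matrix_vector_mul_assoc matrix_mul_assoc gG)

lemma g_swap: "(g t *v x) \<bullet> y = x \<bullet> (g t *v y)" "(G t *v x) \<bullet> y = x \<bullet> (G t *v y)"
  using dot_transpose[of "g t" x y] dot_transpose[of "G t" x y] by (simp_all only: gs Gs)

lemma gG_vec: "g t *v (G t *v x) = x" "G t *v (g t *v x) = x"
  by (simp_all add: matrix_vector_mul_assoc gG)

text \<open>Differentiates \<open>u0^2 = 1 + u . g u\<close>; the geodesic term and the magnetic
  force are cross products with \<open>u\<close> and do no work.\<close>

lemma deriv_u0: "(u0 has_vector_derivative (u t \<bullet> (K t *v u t)) / u0 t
     + 3 / (4 * rho t * (u0 t)\<^sup>2) * (a \<bullet> E t) * (u t \<bullet> (g t *v E t))) (at t within I)"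
proof -
  let ?q = "\<lambda>t. 1 + u t \<bullet> (g t *v u t)"
  let ?aE = "a \<bullet> E t" and ?uE = "u t \<bullet> (g t *v E t)"
  have "(?q has_vector_derivative 2 * (u t \<bullet> (K t *v u t)) + 3 / (2 * rho t * u0 t) * ?aE * ?uE) (at t within I)"
    by (rule has_vector_derivative_eq_rhs[OF has_vector_derivative_add[OF has_vector_derivative_const
        bounded_bilinear.has_vector_derivative[OF bounded_bilinear_inner derivs(4) deriv_gu]]])
      (simp add: inner_add_left inner_add_right inner_diff_left inner_diff_right g_swap gG_vec dot_cross_self
        mat_linear inner_commute[of "K t *v u t"] inner_commute[of "E t"] field_simps)
  then have q: "(?q has_real_derivative 2 * (u t \<bullet> (K t *v u t)) + 3 / (2 * rho t * u0 t) * ?aE * ?uE) (at t within I)"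
    by (simp add: has_real_derivative_iff_has_vector_derivative)
  have pos: "?q t > 0" using g_quad_nonneg[of "u t"] by linarith
  have "((\<lambda>t. sqrt (?q t)) has_real_derivative
      (2 * (u t \<bullet> (K t *v u t)) + 3 / (2 * rho t * u0 t) * ?aE * ?uE) * (inverse (sqrt (?q t)) / 2)) (at t within I)"
    using DERIV_chain2[OF DERIV_real_sqrt[OF pos] q] by (simp add: mult.commute)
  moreover have "sqrt (?q t) = u0 t" by (simp add: u0_def uzero_eq)
  moreover have "(\<lambda>t. sqrt (?q t)) = u0" by (simp add: u0_def uzero_eq fun_eq_iff)
  ultimately show ?thesis
    using u0_pos rho_pos unfolding has_real_derivative_iff_has_vector_derivative
    by (auto elim!: has_vector_derivative_eq_rhs simp: field_simps power2_eq_square)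
qed

text \<open>The terms with \<open>K(u, u)\<close> and with \<open>E\<close> in the two factors
  cancel, which leaves the form needed in the momentum and energy balances.\<close>

lemma deriv_rho_u0: "((\<lambda>t. rho t * u0 t) has_vector_derivative - 3/4 * rho t + H t * (rho t * u0 t) - (a \<bullet> u t) * rho t) (at t within I)"
  by (rule has_vector_derivative_eq_rhs[OF bounded_bilinear.has_vector_derivative[OF bounded_bilinear_mult derivs(7) deriv_u0]])
    (use u0_pos rho_pos in \<open>simp add: field_simps power2_eq_square power3_eq_cube\<close>)

lemma deriv_gth: "((\<lambda>t. g t *v th0 t) has_vector_derivative H t *\<^sub>R (g t *v th0 t) + rho t *\<^sub>R (g t *v u t)) (at t within I)"
  by (rule has_vector_derivative_eq_rhs[OF mv.has_vector_derivative[OF derivs(1,6)]])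
    (simp add: mat_linear matrix_vector_mul_assoc gG matrix_mul_assoc)

end

end

text \<open>On the half-open interval \<open>c\<close> may be unbounded, so Gronwall is applied to
  \<open>q^2\<close> on the compact interval \<open>{0..t}\<close>.\<close>

lemma linear_vderiv_zero:
  fixes q c :: "real \<Rightarrow> real"
  assumes I: "I = {0..<T}" and d: "\<And>t. t \<in> I \<Longrightarrow> (q has_vector_derivative c t * q t) (at t within I)"
    and c: "continuous_on I c" and q0: "q 0 = 0" and t: "t \<in> I"
  shows "q t = 0"
proof -
  have sub: "{0..t} \<subseteq> I" using t I by auto
  have "bounded (c ` {0..t})"
    by (intro compact_imp_bounded compact_continuous_image continuous_on_subset[OF c sub]) auto
  then obtain k where k: "\<And>s. s \<in> {0..t} \<Longrightarrow> \<bar>c s\<bar> \<le> k" unfolding bounded_iff real_norm_def by blast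
  have "q t * q t = 0"
  proof (rule gronwall_zero[of "{0..t}" "\<lambda>t. q t * q t" "\<lambda>t. 2 * (c t * (q t * q t))" "2 * k" 0])
    fix s assume s: "s \<in> {0..t}"
    then have "(q has_vector_derivative c s * q s) (at s within {0..t})"
      using d sub by (meson has_vector_derivative_within_subset subsetD)
    from bounded_bilinear.has_vector_derivative[OF bounded_bilinear_mult this this]
    show "((\<lambda>t. q t * q t) has_vector_derivative 2 * (c s * (q s * q s))) (at s within {0..t})"
      by (simp add: mult.commute mult.left_commute)
    have "\<bar>c s\<bar> * (q s * q s) \<le> k * (q s * q s)" by (intro mult_right_mono k s) simp
    then show "\<bar>2 * (c s * (q s * q s))\<bar> \<le> 2 * k * (q s * q s)" by (simp add: abs_mult)
  qed (use t I q0 in \<open>auto simp: is_interval_cc\<close>)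
  then show ?thesis by simp
qed

lemma trace_mult_sk_outer: "trace (X ** sk z ** outer x y) = y \<bullet> (X *v cross3 z x)"
  by (simp add: trace_mult_outer matrix_vector_mul_assoc[symmetric] sk_mult)

context ebs_solution
begin

lemma cont: "continuous_on I g" "continuous_on I K" "continuous_on I E" "continuous_on I u"
  "continuous_on I rho" "continuous_on I e" "continuous_on I H" "continuous_on I u0"
  unfolding continuous_on_eq_continuous_within
  by (blast intro: has_vector_derivative_continuous derivs deriv_H deriv_u0)+

lemma cont_nonzero: "\<forall>t\<in>I. u0 t \<noteq> 0" "\<forall>t\<in>I. rho t \<noteq> 0"
  using u0_pos rho_pos by force+

subsubsection \<open>Gauss law\<close>

definition "gauss t = a \<bullet> E t + e t * u0 t"

lemma a_dot_B: "a \<bullet> (transpose B *v x) = 0" if "t \<in> I" for t x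
  by (simp add: dot_transpose' Ba[OF that])

text \<open>The curl term does not contribute to \<open>a . E\<close>, because
  \<open>B a = 0\<close> by the Jacobi identity; what remains is proportional to the defect of
  (C4).\<close>

lemma deriv_gauss:
  assumes t: "t \<in> I"
  shows "(gauss has_vector_derivative
    (H t - (a \<bullet> u t) / u0 t + 3 * e t * (u t \<bullet> (g t *v E t)) / (4 * rho t * (u0 t)\<^sup>2)) * gauss t) (at t within I)"
proof -
  have 1: "((\<lambda>t. a \<bullet> E t) has_vector_derivative H t * (a \<bullet> E t) - (a \<bullet> E t / u0 t) * (a \<bullet> u t)) (at t within I)"
    by (rule has_vector_derivative_eq_rhs[OF bounded_bilinear.has_vector_derivative[OF bounded_bilinear_inner
        has_vector_derivative_const derivs(3)[OF t]]])
      (simp add: inner_add_right inner_diff_right a_dot_B[OF t])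
  have "u0 t > 0" "rho t > 0" by (fact u0_pos[OF t] rho_pos[OF t])+
  then show ?thesis
    unfolding gauss_def[abs_def]
    by (intro has_vector_derivative_eq_rhs[OF has_vector_derivative_add[OF 1
        bounded_bilinear.has_vector_derivative[OF bounded_bilinear_mult derivs(8)[OF t] deriv_u0[OF t]]]])
      (simp add: field_simps power2_eq_square)
qed

text \<open>In dimension three (C3) is totally antisymmetric in its indices and amounts to the
  single equation \<open>a . f = 0\<close>. The factor 0 brings the derivative into the form
  expected by \<open>linear_vderiv_zero\<close>.\<close>

lemma deriv_af:
  assumes t: "t \<in> I"
  shows "((\<lambda>t. a \<bullet> f t) has_vector_derivative 0 * (a \<bullet> f t)) (at t within I)"
  by (rule has_vector_derivative_eq_rhs[OF bounded_bilinear.has_vector_derivative[OF bounded_bilinear_inner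
        has_vector_derivative_const deriv_f[OF t]]])
    (simp add: a_dot_B[OF t])

subsubsection \<open>Momentum constraint\<close>

text \<open>The covector with components \<open>- (tau_0j + T_0j)\<close>; the cross product is its
  electromagnetic part.\<close>

definition "flux t = cross3 (f t) (E t) + (4/3 * (rho t * u0 t)) *\<^sub>R (g t *v u t) + g t *v th0 t"

text \<open>Divergence of a left-invariant mixed tensor, evaluated on \<open>z\<close>; for
  \<open>Km\<close> this is \<open>divK_eq\<close> made linear in the direction.\<close>

definition "cdiv X z = a \<bullet> (X *v z) + trace (B ** sk z ** X)"

text \<open>The defect of (C2) tested against a constant vector, so that the uniqueness argument for
  scalar equations applies.\<close>

definition "mom z t = cdiv (Km t) z - 8 * pi * (flux t \<bullet> z)"

lemma cdiv_linear: "cdiv (X + Y) z = cdiv X z + cdiv Y z" "cdiv (X - Y) z = cdiv X z - cdiv Y z"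
  "cdiv (r *\<^sub>R X) z = r * cdiv X z"
  by (simp_all add: cdiv_def mat_linear inner_add_right inner_diff_right algebra_simps)

lemma cdiv_mat1: "cdiv (mat 1) z = 0"
proof -
  have "trace (S ** sk z) = 0"
    using trace_sk_symmetric[OF str_sym_transpose[OF lie], of z] trace_mul_sym[of "sk z"] by simp
  then show ?thesis by (simp add: cdiv_def B_def mat_linear trace_sk_sk)
qed

lemma cdiv_outer: "cdiv (outer x y) z = (a \<bullet> x) * (y \<bullet> z) + cross3 x (transpose B *v y) \<bullet> z"
proof -
  have "y \<bullet> (B *v cross3 z x) = (transpose B *v y) \<bullet> cross3 z x" by (simp add: dot_transpose)
  also have "\<dots> = cross3 x (transpose B *v y) \<bullet> z" by (metis cross_triple inner_commute)
  finally show ?thesis by (simp add: cdiv_def trace_mult_sk_outer outer_mult)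
qed

lemma deriv_flux:
  assumes t: "t \<in> I"
  shows "(flux has_vector_derivative H t *\<^sub>R flux t
      + cross3 (f t) (transpose B *v \<phi> t) - cross3 (transpose B *v (g t *v E t)) (E t)
      + (a \<bullet> E t) *\<^sub>R (g t *v E t) - (4/3 * rho t) *\<^sub>R cross3 (u t) (w t) - (4/3 * rho t * (a \<bullet> u t)) *\<^sub>R (g t *v u t))
    (at t within I)"
proof -
  have nz: "u0 t \<noteq> 0" "rho t \<noteq> 0" using u0_pos[OF t] rho_pos[OF t] by auto
  have 1: "((\<lambda>t. cross3 (f t) (E t)) has_vector_derivative H t *\<^sub>R cross3 (f t) (E t)
      - (a \<bullet> E t / u0 t) *\<^sub>R cross3 (f t) (u t) + cross3 (f t) (transpose B *v \<phi> t)
      - cross3 (transpose B *v (g t *v E t)) (E t)) (at t within I)"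
    by (rule has_vector_derivative_eq_rhs[OF cr.has_vector_derivative[OF deriv_f[OF t] derivs(3)[OF t]]])
      (simp add: cr.add_right cr.diff_right cr.scaleR_right cr.minus_left)
  have 2: "((\<lambda>t. (4/3 * (rho t * u0 t)) *\<^sub>R (g t *v u t)) has_vector_derivative
      (4/3 * (rho t * u0 t)) *\<^sub>R ((- (1 / u0 t)) *\<^sub>R cross3 (u t) (w t)
     + (3 / (4 * rho t * u0 t) * (a \<bullet> E t)) *\<^sub>R (g t *v E t)
     + (3 / (4 * rho t * (u0 t)\<^sup>2) * (a \<bullet> E t)) *\<^sub>R cross3 (f t) (u t))
     + (4/3 * (- 3/4 * rho t + H t * (rho t * u0 t) - (a \<bullet> u t) * rho t)) *\<^sub>R (g t *v u t)) (at t within I)"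
    by (rule has_vector_derivative_eq_rhs[OF bounded_bilinear.has_vector_derivative[OF bounded_bilinear_scaleR
        bounded_bilinear.has_vector_derivative[OF bounded_bilinear_mult has_vector_derivative_const deriv_rho_u0[OF t]] deriv_gu[OF t]]])
      simp
  show ?thesis
    unfolding flux_def[abs_def]
    by (rule has_vector_derivative_eq_rhs[OF has_vector_derivative_add[OF has_vector_derivative_add[OF 1 2] deriv_gth[OF t]]])
      (use nz in \<open>simp add: vec_eq_iff field_simps power2_eq_square\<close>)
qed

text \<open>Curvature drops out by \<open>contracted_bianchi\<close> and multiples of the identity
  are divergence free. The divergence of the stress matches the source terms of
  \<open>deriv_flux\<close> except for a multiple of \<open>a . f\<close>.\<close>

lemma deriv_mom:
  assumes t: "t \<in> I" and af: "a \<bullet> f t = 0"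
  shows "(mom z has_vector_derivative H t * mom z t) (at t within I)"
proof -
  have lin: "bounded_linear (\<lambda>X. cdiv X z)"
    unfolding linear_conv_bounded_linear[symmetric] by (simp add: linear_iff cdiv_linear)
  have ric: "cdiv (G t ** Ric_mat C (g t)) z = 0"
    unfolding cdiv_def B_def G_def by (rule contracted_bianchi[OF lie posdef_g[OF t]])
  show ?thesis
    unfolding mom_def[abs_def]
    by (rule has_vector_derivative_eq_rhs[OF has_vector_derivative_diff[OF
        bounded_linear.has_vector_derivative[OF lin deriv_Km[OF t]]
        bounded_bilinear.has_vector_derivative[OF bounded_bilinear_mult has_vector_derivative_const
          bounded_bilinear.has_vector_derivative[OF bounded_bilinear_inner deriv_flux[OF t] has_vector_derivative_const]]]])
      (simp add: cdiv_linear ric cdiv_mat1 G_st[OF t] cdiv_outer af w_def inner_add_left inner_diff_left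
        inner_minus_left cross_skew[of "E t"] algebra_simps)
qed

subsubsection \<open>Hamiltonian constraint\<close>

definition "ham t = Rscal C (g t) - trace (Km t ** Km t) + (H t)\<^sup>2 - 16 * pi * (tau t + Td t) - 2 * \<Lambda>"

text \<open>First variation of scalar curvature for \<open>g' = - 2 K\<close>: the Laplacian of the
  trace vanishes by homogeneity, and the double divergence of \<open>K\<close> is the divergence of
  a left-invariant field, hence a contraction with \<open>a\<close>. The proof differentiates
  \<open>Rscal_formula\<close> instead.\<close>

lemma deriv_Rscal:
  assumes t: "t \<in> I"
  shows "((\<lambda>t. Rscal C (g t)) has_vector_derivative
      2 * trace (G t ** Ric_mat C (g t) ** Km t) - 2 * cdiv (Km t) (G t *v a)) (at t within I)"
proof -
  let ?A = "sk a"
  have d: "det (g t) \<noteq> 0" using det_pos[OF t] by simp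
  have t2: "((\<lambda>t. trace (S ** g t ** S ** g t)) has_vector_derivative - 4 * trace (S ** g t ** S ** K t)) (at t within I)"
    by (rule has_vector_derivative_eq_rhs, (rule hvd_rules derivs(1)[OF t] has_vector_derivative_const)+)
      (use trace_mul_sym[of "S ** K t" "S ** g t"] in \<open>simp add: mat_linear matrix_mul_assoc\<close>)
  have t1: "((\<lambda>t. trace (S ** g t)) has_vector_derivative - 2 * trace (S ** K t)) (at t within I)"
    by (rule has_vector_derivative_eq_rhs, (rule hvd_rules derivs(1)[OF t] has_vector_derivative_const)+)
      (simp add: mat_linear)
  have n: "((\<lambda>t. trace (S ** g t ** S ** g t) - trace (S ** g t) * trace (S ** g t) * (1/2)) has_vector_derivative
      - 4 * trace (S ** g t ** S ** K t) + 2 * trace (S ** g t) * trace (S ** K t)) (at t within I)"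
    by (rule has_vector_derivative_eq_rhs, (rule hvd_rules t1 t2 has_vector_derivative_const)+) simp
  have q: "((\<lambda>t. a \<bullet> (G t *v a)) has_vector_derivative 2 * (a \<bullet> (Km t *v (G t *v a)))) (at t within I)"
    by (rule has_vector_derivative_eq_rhs, (rule hvd_rules deriv_G[OF t] has_vector_derivative_const)+)
      (simp add: mat_linear Km_def matrix_vector_mul_assoc)
  have R: "(\<lambda>t. - ((trace (S ** g t ** S ** g t) - trace (S ** g t) * trace (S ** g t) * (1/2)) / det (g t))
      - 3/2 * (a \<bullet> (G t *v a))) s = Rscal C (g s)" if "s \<in> I" for s
    unfolding Rscal_formula[OF lie posdef_g[OF that]] by (simp add: G_def power2_eq_square minus_divide_left)
  have "((\<lambda>t. Rscal C (g t)) has_vector_derivative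
      - (((- 4 * trace (S ** g t ** S ** K t) + 2 * trace (S ** g t) * trace (S ** K t)) * det (g t)
         - (trace (S ** g t ** S ** g t) - trace (S ** g t) * trace (S ** g t) * (1/2)) * (- 2 * H t * det (g t)))
         / (det (g t) * det (g t)))
      - (3/2 * (2 * (a \<bullet> (Km t *v (G t *v a)))) + 0 * (a \<bullet> (G t *v a)))) (at t within I)"
    by (rule has_vector_derivative_transform[OF t R[symmetric]], assumption)
      (intro has_vector_derivative_diff has_vector_derivative_minus vderiv_divide n deriv_det t d
        bounded_bilinear.has_vector_derivative[OF bounded_bilinear_mult] has_vector_derivative_const q)
  moreover have "2 * trace (G t ** Ric_mat C (g t) ** Km t) - 2 * cdiv (Km t) (G t *v a)
     = (4 * trace (S ** g t ** S ** K t) - 2 * trace (S ** g t) * trace (S ** K t)) / det (g t)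
       - 2 * H t * (trace (S ** g t ** S ** g t) - (trace (S ** g t))\<^sup>2 / 2) / det (g t)
       - 3 * (a \<bullet> (Km t *v (G t *v a)))"
  proof -
    have gK: "X ** g t ** Km t = X ** K t" for X
    proof -
      have "X ** g t ** Km t = X ** (g t ** G t) ** K t" by (simp only: Km_def matrix_mul_assoc)
      then show ?thesis by (simp add: gG[OF t])
    qed
    have anti: "trace (?A ** g t ** S ** K t) = - trace (S ** g t ** ?A ** K t)"
    proof -
      have "trace (?A ** g t ** S ** K t) = trace (transpose (?A ** g t ** S ** K t))" by (simp only: trace_transpose)
      also have "transpose (?A ** g t ** S ** K t) = - (K t ** (S ** g t ** ?A))"
        by (simp add: matrix_transpose_mul K_sym[OF t] gs[OF t] str_sym_transpose[OF lie] transpose_sk mat_linear matrix_mul_assoc)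
      finally show ?thesis using trace_mul_sym[of "K t" "S ** g t ** ?A"]
        by (simp add: linear_neg[OF linear_trace])
    qed
    have "G t ** Ric_mat C (g t) ** Km t = (1 / det (g t)) *\<^sub>R
      (2 *\<^sub>R (S ** g t ** S ** K t) - trace (S ** g t) *\<^sub>R (S ** K t)
       - (trace (S ** g t ** S ** g t) - (trace (S ** g t))\<^sup>2 / 2) *\<^sub>R Km t
       + (1/2) *\<^sub>R (S ** g t ** ?A ** K t - ?A ** g t ** S ** K t))
      - ((a \<bullet> (G t *v a)) / 2) *\<^sub>R Km t"
      unfolding G_def inv_Ric_mat[OF lie posdef_g[OF t]] by (simp add: mat_linear gK)
    then have r: "trace (G t ** Ric_mat C (g t) ** Km t) = (1 / det (g t)) *
      (2 * trace (S ** g t ** S ** K t) - trace (S ** g t) * trace (S ** K t)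
       - (trace (S ** g t ** S ** g t) - (trace (S ** g t))\<^sup>2 / 2) * H t
       + trace (S ** g t ** ?A ** K t)) - (a \<bullet> (G t *v a)) / 2 * H t"
      by (simp add: mat_linear anti H_Km[OF t])
    have "S ** sk (G t *v a) ** Km t = (1 / det (g t)) *\<^sub>R (S ** g t ** ?A ** K t)"
      unfolding G_def sk_vector_inv[OF posdef_g[OF t]] by (simp add: mat_linear matrix_mul_assoc gK)
    moreover have "?A ** sk (G t *v a) ** Km t = outer (G t *v a) a ** Km t - (a \<bullet> (G t *v a)) *\<^sub>R Km t"
      unfolding sk_sk by (simp add: mat_linear)
    moreover have "trace (outer (G t *v a) a ** Km t) = a \<bullet> (Km t *v (G t *v a))"
      using trace_mul_sym[of "Km t" "outer (G t *v a) a"] by (simp add: trace_mult_outer)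
    ultimately have cd: "cdiv (Km t) (G t *v a) = 3/2 * (a \<bullet> (Km t *v (G t *v a)))
        + trace (S ** g t ** ?A ** K t) / det (g t) - (a \<bullet> (G t *v a)) * H t / 2"
      unfolding cdiv_def B_def by (simp add: mat_linear H_Km[OF t] diff_divide_distrib)
    show ?thesis unfolding r cd using d by (simp add: field_simps)
  qed
  ultimately show ?thesis
    using d by (elim has_vector_derivative_eq_rhs) (simp add: field_simps power2_eq_square)
qed

lemma trace_outer_mult: "trace (outer x y ** X) = y \<bullet> (X *v x)"
  using trace_mul_sym[of X "outer x y"] by (simp add: trace_mult_outer)

text \<open>Poynting's theorem. The symmetric part of \<open>B\<close> cancels between the electric
  and the magnetic curl term; the antisymmetric part leaves the electromagnetic momentum contracted
  with \<open>a\<close>.\<close>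

lemma deriv_tau:
  assumes t: "t \<in> I"
  shows "(tau has_vector_derivative 2 * H t * tau t - E t \<bullet> (K t *v E t) - \<phi> t \<bullet> (Km t *v f t)
     - (a \<bullet> E t) * (u t \<bullet> (g t *v E t)) / u0 t - cross3 (f t) (E t) \<bullet> (G t *v a)) (at t within I)"
proof -
  have d: "det (g t) \<noteq> 0" using det_pos[OF t] by simp
  let ?bE = "transpose B *v (g t *v E t)" and ?b\<phi> = "transpose B *v \<phi> t"
  have sw: "E t \<bullet> (g t *v x) = x \<bullet> (g t *v E t)" for x
    using g_swap(1)[OF t, of x "E t"] by (simp add: inner_commute)
  have p: "((\<lambda>t. E t \<bullet> (g t *v E t)) has_vector_derivative
     2 * (H t * (E t \<bullet> (g t *v E t)) - (a \<bullet> E t / u0 t) * (u t \<bullet> (g t *v E t)) + ?b\<phi> \<bullet> (g t *v E t))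
     - 2 * (E t \<bullet> (K t *v E t))) (at t within I)"
    by (rule has_vector_derivative_eq_rhs, (rule hvd_rules derivs(1)[OF t] derivs(3)[OF t])+)
      (simp add: mat_linear inner_add_left inner_add_right inner_diff_left inner_diff_right
        sw[of "u t"] sw[of "transpose B *v \<phi> t"] algebra_simps)
  have hd: "((\<lambda>t. f t \<bullet> (g t *v f t) / det (g t)) has_vector_derivative
     ((- 2 * (?bE \<bullet> (g t *v f t)) - 2 * (f t \<bullet> (K t *v f t))) * det (g t)
       - f t \<bullet> (g t *v f t) * (- 2 * H t * det (g t))) / (det (g t) * det (g t))) (at t within I)"
  proof (rule vderiv_divide[OF _ deriv_det[OF t] d])
    show "((\<lambda>t. f t \<bullet> (g t *v f t)) has_vector_derivative - 2 * (?bE \<bullet> (g t *v f t)) - 2 * (f t \<bullet> (K t *v f t))) (at t within I)"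
      by (rule has_vector_derivative_eq_rhs, (rule hvd_rules derivs(1)[OF t] deriv_f[OF t])+)
        (use g_swap(1)[OF t, of "f t" "transpose B *v (g t *v E t)"] in
          \<open>simp add: mat_linear inner_diff_right inner_commute[of "g t *v f t"]\<close>)
  qed
  have \<phi>f: "(\<lambda>t. f t \<bullet> (g t *v f t) / det (g t)) = (\<lambda>t. \<phi> t \<bullet> f t)"
    by (simp add: \<phi>_def fun_eq_iff inner_commute)
  have e1: "(?bE \<bullet> (g t *v f t)) / det (g t) = ?bE \<bullet> \<phi> t"
    by (simp add: \<phi>_def)
  have e2: "f t \<bullet> (K t *v f t) / det (g t) = \<phi> t \<bullet> (Km t *v f t)"
    by (simp add: \<phi>_def Km_def matrix_vector_mul_assoc[symmetric] g_swap[OF t] gG_vec[OF t])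
  have e3: "f t \<bullet> (g t *v f t) / det (g t) = \<phi> t \<bullet> f t"
    using \<phi>f by meson
  have q: "((\<lambda>t. \<phi> t \<bullet> f t) has_vector_derivative
     2 * H t * (\<phi> t \<bullet> f t) - 2 * (?bE \<bullet> \<phi> t) - 2 * (\<phi> t \<bullet> (Km t *v f t))) (at t within I)"
  proof -
    have aux: "((- 2 * x - 2 * y) * D - z * (- 2 * h * D)) / (D * D) = 2 * h * (z / D) - 2 * (x / D) - 2 * (y / D)"
      if "D \<noteq> 0" for x y z h D :: real
      using that by (simp add: field_simps)
    show ?thesis
      using hd unfolding aux[OF d] e1 e2 e3 \<phi>f .
  qed
  have "?b\<phi> \<bullet> (g t *v E t) - ?bE \<bullet> \<phi> t = - (cross3 (f t) (E t) \<bullet> (G t *v a))"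
  proof -
    have "?b\<phi> \<bullet> (g t *v E t) - ?bE \<bullet> \<phi> t = - (cross3 a (\<phi> t) \<bullet> (g t *v E t))"
    proof -
      have 1: "(S *v \<phi> t) \<bullet> (g t *v E t) = (S *v (g t *v E t)) \<bullet> \<phi> t"
        using dot_transpose[of S "\<phi> t" "g t *v E t"] by (simp add: str_sym_transpose[OF lie] inner_commute)
      have 2: "cross3 a (g t *v E t) \<bullet> \<phi> t = - (cross3 a (\<phi> t) \<bullet> (g t *v E t))"
        by (metis cross_triple cross_skew inner_commute inner_minus_left)
      show ?thesis
        unfolding Bt[OF t] by (simp add: inner_diff_left 1 2)
    qed
    also have "\<dots> = - (cross3 (\<phi> t) (g t *v E t) \<bullet> a)"
      by (simp only: cross_triple[of a])
    also have "cross3 (\<phi> t) (g t *v E t) = G t *v cross3 (f t) (E t)"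
    proof -
      have "g t *v cross3 (g t *v f t) (g t *v E t) = det (g t) *\<^sub>R cross3 (f t) (E t)"
        using cross_matrix_mult[of "g t"] by (simp add: gs[OF t])
      then have "cross3 (g t *v f t) (g t *v E t) = det (g t) *\<^sub>R (G t *v cross3 (f t) (E t))"
        by (metis gG_vec(2)[OF t] mv.scaleR_right)
      then show ?thesis using d by (simp add: \<phi>_def cr.scaleR_left)
    qed
    finally show ?thesis by (simp add: g_swap[OF t])
  qed
  moreover have "(tau has_vector_derivative
     (2 * (H t * (E t \<bullet> (g t *v E t)) - (a \<bullet> E t / u0 t) * (u t \<bullet> (g t *v E t)) + ?b\<phi> \<bullet> (g t *v E t))
     - 2 * (E t \<bullet> (K t *v E t)) + (2 * H t * (\<phi> t \<bullet> f t) - 2 * (?bE \<bullet> \<phi> t) - 2 * (\<phi> t \<bullet> (Km t *v f t)))) * (1/2)) (at t within I)"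
    unfolding tau_def[abs_def]
    using bounded_linear.has_vector_derivative[OF bounded_linear_mult_left[of "1/2"] has_vector_derivative_add[OF p q]] by simp
  ultimately show ?thesis
    by (elim has_vector_derivative_eq_rhs) (simp add: tau_def field_simps)
qed

text \<open>The electric work term occurs with the opposite sign in \<open>deriv_tau\<close>, so the
  total energy does not see it.\<close>

lemma deriv_Td:
  assumes t: "t \<in> I"
  shows "(Td has_vector_derivative H t * Td t + 4/3 * rho t * (u t \<bullet> (K t *v u t)) + rho t * H t / 3
     + (a \<bullet> E t) * (u t \<bullet> (g t *v E t)) / u0 t
     - (4/3 * (rho t * u0 t)) * (a \<bullet> u t) - a \<bullet> th0 t) (at t within I)"
proof -
  have nz: "u0 t \<noteq> 0" "rho t \<noteq> 0" using u0_pos[OF t] rho_pos[OF t] by auto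
  have "((\<lambda>t. 4/3 * ((rho t * u0 t) * u0 t) + th00 t) has_vector_derivative
     4/3 * ((rho t * u0 t) * ((u t \<bullet> (K t *v u t)) / u0 t + 3 / (4 * rho t * (u0 t)\<^sup>2) * (a \<bullet> E t) * (u t \<bullet> (g t *v E t)))
       + (- 3/4 * rho t + H t * (rho t * u0 t) - (a \<bullet> u t) * rho t) * u0 t) + 0 * ((rho t * u0 t) * u0 t)
     + (H t * th00 t - a \<bullet> th0 t + 1/3 * rho t * H t + rho t * u0 t)) (at t within I)"
    by (intro has_vector_derivative_add bounded_bilinear.has_vector_derivative[OF bounded_bilinear_mult]
        has_vector_derivative_const deriv_rho_u0 deriv_u0 derivs t)
  moreover have "(\<lambda>t. 4/3 * ((rho t * u0 t) * u0 t) + th00 t) = Td"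
    by (simp add: Td_def fun_eq_iff power2_eq_square)
  ultimately have "(Td has_vector_derivative
     4/3 * ((rho t * u0 t) * ((u t \<bullet> (K t *v u t)) / u0 t + 3 / (4 * rho t * (u0 t)\<^sup>2) * (a \<bullet> E t) * (u t \<bullet> (g t *v E t)))
       + (- 3/4 * rho t + H t * (rho t * u0 t) - (a \<bullet> u t) * rho t) * u0 t) + 0 * ((rho t * u0 t) * u0 t)
     + (H t * th00 t - a \<bullet> th0 t + 1/3 * rho t * H t + rho t * u0 t)) (at t within I)"
    by (simp only:)
  then show ?thesis
    by (rule has_vector_derivative_eq_rhs) (use nz in \<open>simp add: Td_def field_simps power2_eq_square\<close>)
qed

text \<open>The divergence of \<open>K\<close> from \<open>deriv_Rscal\<close> combines with the
  momentum terms of the two energy balances into the momentum defect in the direction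
  \<open>G a\<close>. This source is why (C2) has to be propagated before (C1).\<close>

lemma deriv_ham:
  assumes t: "t \<in> I"
  shows "(ham has_vector_derivative 2 * H t * ham t - 2 * mom (G t *v a) t) (at t within I)"
proof -
  let ?c = "4 * pi * (- Td t + 4/3 * rho t * (u t \<bullet> (g t *v u t)) + rho t) - \<Lambda>"
  let ?X = "(tau t + rho t / 3) * H t - E t \<bullet> (K t *v E t) - \<phi> t \<bullet> (Km t *v f t) + 4/3 * rho t * (u t \<bullet> (K t *v u t))"
  have X: "trace (G t ** st t ** Km t) = ?X"
  proof -
    have "(g t *v x) \<bullet> (Km t *v x) = x \<bullet> (K t *v x)" for x
      by (simp add: Km_def matrix_vector_mul_assoc[symmetric] g_swap[OF t] gG_vec[OF t])
    then show ?thesis unfolding G_st[OF t] by (simp add: mat_linear trace_outer_mult H_Km[OF t])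
  qed
  have k2: "((\<lambda>t. trace (Km t ** Km t)) has_vector_derivative
      2 * (trace (G t ** Ric_mat C (g t) ** Km t) + H t * trace (Km t ** Km t) - 8 * pi * ?X + ?c * H t)) (at t within I)"
    (is "(_ has_vector_derivative ?r) _")
  proof (rule has_vector_derivative_eq_rhs[OF hvd_trace[OF mm.has_vector_derivative[OF deriv_Km[OF t] deriv_Km[OF t]]]])
    let ?D = "G t ** Ric_mat C (g t) + H t *\<^sub>R Km t - (8 * pi) *\<^sub>R (G t ** st t) + ?c *\<^sub>R mat 1"
    have "trace (Km t ** ?D + ?D ** Km t) = 2 * trace (?D ** Km t)"
      using trace_mul_sym[of "Km t" ?D] by (simp add: linear_add[OF linear_trace])
    also have "\<dots> = ?r"
      by (simp add: mm.add_left mm.diff_left mm.scaleR_left linear_add[OF linear_trace] linear_diff[OF linear_trace]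
          linear_scale[OF linear_trace] X H_Km[OF t])
    finally show "trace (Km t ** ?D + ?D ** Km t) = ?r" .
  qed
  have H2: "((\<lambda>t. H t * H t) has_vector_derivative 2 * H t * (Rscal C (g t) + (H t)\<^sup>2 - 8 * pi * tau t
    + 4 * pi * (rho t + 4/3 * rho t * (u t \<bullet> (g t *v u t))) - 12 * pi * Td t - 3 * \<Lambda>)) (at t within I)"
    by (rule has_vector_derivative_eq_rhs[OF bounded_bilinear.has_vector_derivative[OF bounded_bilinear_mult deriv_H[OF t] deriv_H[OF t]]]) simp
  have T: "((\<lambda>t. (tau t + Td t) * (16 * pi)) has_vector_derivative
     (2 * H t * tau t - E t \<bullet> (K t *v E t) - \<phi> t \<bullet> (Km t *v f t)
     - (a \<bullet> E t) * (u t \<bullet> (g t *v E t)) / u0 t - cross3 (f t) (E t) \<bullet> (G t *v a)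
     + (H t * Td t + 4/3 * rho t * (u t \<bullet> (K t *v u t)) + rho t * H t / 3
     + (a \<bullet> E t) * (u t \<bullet> (g t *v E t)) / u0 t
     - (4/3 * (rho t * u0 t)) * (a \<bullet> u t) - a \<bullet> th0 t)) * (16 * pi)) (at t within I)"
    using bounded_linear.has_vector_derivative[OF bounded_linear_mult_left[of "16 * pi"]
        has_vector_derivative_add[OF deriv_tau[OF t] deriv_Td[OF t]]] by simp
  have fl: "flux t \<bullet> (G t *v a) = cross3 (f t) (E t) \<bullet> (G t *v a) + 4/3 * (rho t * u0 t) * (a \<bullet> u t) + a \<bullet> th0 t"
    by (simp add: flux_def inner_add_left g_swap[OF t] gG_vec[OF t] inner_commute[of a])
  have "((\<lambda>t. Rscal C (g t) - trace (Km t ** Km t) + H t * H t - (tau t + Td t) * (16 * pi) - 2 * \<Lambda>)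
     has_vector_derivative
      (2 * trace (G t ** Ric_mat C (g t) ** Km t) - 2 * cdiv (Km t) (G t *v a))
      - 2 * (trace (G t ** Ric_mat C (g t) ** Km t) + H t * trace (Km t ** Km t) - 8 * pi * ?X + ?c * H t)
      + 2 * H t * (Rscal C (g t) + (H t)\<^sup>2 - 8 * pi * tau t
    + 4 * pi * (rho t + 4/3 * rho t * (u t \<bullet> (g t *v u t))) - 12 * pi * Td t - 3 * \<Lambda>)
     - (2 * H t * tau t - E t \<bullet> (K t *v E t) - \<phi> t \<bullet> (Km t *v f t)
     - (a \<bullet> E t) * (u t \<bullet> (g t *v E t)) / u0 t - cross3 (f t) (E t) \<bullet> (G t *v a)
     + (H t * Td t + 4/3 * rho t * (u t \<bullet> (K t *v u t)) + rho t * H t / 3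
     + (a \<bullet> E t) * (u t \<bullet> (g t *v E t)) / u0 t
     - (4/3 * (rho t * u0 t)) * (a \<bullet> u t) - a \<bullet> th0 t)) * (16 * pi) - 0) (at t within I)"
    by (intro has_vector_derivative_add has_vector_derivative_diff has_vector_derivative_const deriv_Rscal t k2 H2 T)
  moreover have "(\<lambda>t. Rscal C (g t) - trace (Km t ** Km t) + H t * H t - (tau t + Td t) * (16 * pi) - 2 * \<Lambda>) = ham"
    by (simp add: ham_def fun_eq_iff power2_eq_square)
  ultimately have "(ham has_vector_derivative
      (2 * trace (G t ** Ric_mat C (g t) ** Km t) - 2 * cdiv (Km t) (G t *v a))
      - 2 * (trace (G t ** Ric_mat C (g t) ** Km t) + H t * trace (Km t ** Km t) - 8 * pi * ?X + ?c * H t)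
      + 2 * H t * (Rscal C (g t) + (H t)\<^sup>2 - 8 * pi * tau t
    + 4 * pi * (rho t + 4/3 * rho t * (u t \<bullet> (g t *v u t))) - 12 * pi * Td t - 3 * \<Lambda>)
     - (2 * H t * tau t - E t \<bullet> (K t *v E t) - \<phi> t \<bullet> (Km t *v f t)
     - (a \<bullet> E t) * (u t \<bullet> (g t *v E t)) / u0 t - cross3 (f t) (E t) \<bullet> (G t *v a)
     + (H t * Td t + 4/3 * rho t * (u t \<bullet> (K t *v u t)) + rho t * H t / 3
     + (a \<bullet> E t) * (u t \<bullet> (g t *v E t)) / u0 t
     - (4/3 * (rho t * u0 t)) * (a \<bullet> u t) - a \<bullet> th0 t)) * (16 * pi) - 0) (at t within I)"
    by simp
  then show ?thesis
    by (rule has_vector_derivative_eq_rhs) (simp add: ham_def mom_def fl power2_eq_square algebra_simps)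
qed

end

subsection \<open>A priori bounds\<close>

text \<open>Polarization bounds every one of the nine entries by \<open>c\<close>.\<close>

lemma sym_entry_bound:
  fixes A :: "real^3^3"
  assumes A: "transpose A = A" and b: "\<And>x. \<bar>x \<bullet> (A *v x)\<bar> \<le> c * (x \<bullet> x)"
  shows "norm A \<le> 9 * c"
proof -
  have "\<bar>A $ i $ j\<bar> \<le> c" for i j
  proof -
    let ?x = "axis i 1 :: real^3" and ?y = "axis j 1 :: real^3"
    have sw: "?y \<bullet> (A *v ?x) = ?x \<bullet> (A *v ?y)"
      using dot_transpose[of A ?x ?y] A by (simp add: inner_commute)
    have "4 * (?x \<bullet> (A *v ?y)) = (?x + ?y) \<bullet> (A *v (?x + ?y)) - (?x - ?y) \<bullet> (A *v (?x - ?y))"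
      using sw by (simp add: mat_linear inner_add_left inner_add_right inner_diff_left inner_diff_right)
    moreover have "(?x + ?y) \<bullet> (?x + ?y) + (?x - ?y) \<bullet> (?x - ?y) = 4"
      by (simp add: inner_add_left inner_add_right inner_diff_left inner_diff_right inner_axis_axis)
    then have "c * ((?x + ?y) \<bullet> (?x + ?y)) + c * ((?x - ?y) \<bullet> (?x - ?y)) = 4 * c"
      by (metis distrib_left mult.commute)
    ultimately have "\<bar>4 * (?x \<bullet> (A *v ?y))\<bar> \<le> 4 * c"
      using b[of "?x + ?y"] b[of "?x - ?y"] by linarith
    then show ?thesis by (simp add: matrix_component[symmetric])
  qed
  then have "(\<Sum>j\<in>UNIV. \<bar>A $ i $ j\<bar>) \<le> (\<Sum>j\<in>(UNIV::3 set). c)" for i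
    by (intro sum_mono) simp
  then have "norm (A $ i) \<le> (\<Sum>j\<in>(UNIV::3 set). c)" for i
    by (rule order_trans[OF norm_le_l1_cart])
  then have "norm (A $ i) \<le> 3 * c" for i by simp
  moreover have "norm A \<le> (\<Sum>i\<in>UNIV. norm (A $ i))"
    unfolding norm_vec_def by (rule L2_set_le_sum) simp
  moreover have "(\<Sum>i\<in>UNIV. norm (A $ i)) \<le> (\<Sum>j\<in>(UNIV::3 set). 3 * c)"
    by (intro sum_mono) (rule calculation)
  ultimately show ?thesis by simp
qed

lemma posdef_lower_bound:
  assumes "posdef M"
  obtains l where "l > 0" "\<And>x. l * (x \<bullet> x) \<le> x \<bullet> (M *v x)"
proof -
  let ?q = "\<lambda>x. x \<bullet> (M *v x)"
  have c: "continuous_on (sphere 0 1) ?q"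
    by (intro continuous_on_inner continuous_on_id linear_continuous_on matrix_vector_mul_bounded_linear)
  have ne: "sphere (0::real^3) 1 \<noteq> {}" by simp
  obtain y where y: "y \<in> sphere 0 1" "\<And>x. x \<in> sphere 0 1 \<Longrightarrow> ?q y \<le> ?q x"
    using continuous_attains_inf[OF compact_sphere ne c] by blast
  have "?q y * (x \<bullet> x) \<le> ?q x" for x
  proof (cases "x = 0")
    case False
    have "?q y \<le> ?q (x /\<^sub>R norm x)" by (rule y(2)) (use False in simp)
    also have "\<dots> = ?q x / (norm x)\<^sup>2" by (simp add: mat_linear power2_eq_square divide_inverse)
    finally show ?thesis using False by (simp add: power2_norm_eq_inner field_simps)
  qed simp
  moreover have "y \<noteq> 0" using y(1) by auto
  then have "?q y > 0" using assms unfolding posdef_iff by blast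
  ultimately show ?thesis using that by blast
qed

lemma mv_norm_bound: obtains k where "k > 0" "\<And>A x. norm ((A::real^3^3) *v x) \<le> norm A * norm x * k"
  using mv.pos_bounded by blast

locale ebs_data = ebs_solution +
  assumes nIX: "\<not> bianchi_IX C" and Lpos: "\<Lambda> > 0"
    and constr0: "constraints C \<Lambda> (g 0) (K 0) (F 0) (E 0) (u 0) (th00 0) (th0 0) (rho 0) (e 0)"
    and H0: "Hmean (g 0) (K 0) < 0"
    and th00_nonneg: "\<And>t. t \<in> {0..<T} \<Longrightarrow> th00 t \<ge> 0"
begin

lemma af_zero: "t \<in> I \<Longrightarrow> a \<bullet> f t = 0"
proof (rule linear_vderiv_zero[OF refl deriv_af])
  have "(\<Sum>l\<in>UNIV. C l 1 2 * F 0 $ 3 $ l + C l 2 3 * F 0 $ 1 $ l + C l 3 1 * F 0 $ 2 $ l) = 0"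
    using constr0 unfolding constraints_def by blast
  then show "a \<bullet> f 0 = 0"
    unfolding F_eq[OF I(1)]
    by (simp add: comp3 str_vec_def trC_def sconst_antisym[OF lie] algebra_simps)
qed auto

lemma gauss_zero: "t \<in> I \<Longrightarrow> gauss t = 0"
proof (rule linear_vderiv_zero[OF refl deriv_gauss])
  show "continuous_on I (\<lambda>t. H t - (a \<bullet> u t) / u0 t + 3 * e t * (u t \<bullet> (g t *v E t)) / (4 * rho t * (u0 t)\<^sup>2))"
    using cont_nonzero by (intro continuous_intros cont mv.continuous_on) auto
  show "gauss 0 = 0"
    using constr0 unfolding constraints_def gauss_def sum_trC' u0_def by blast
qed

lemma aE: "t \<in> I \<Longrightarrow> a \<bullet> E t = - (e t * u0 t)"
  using gauss_zero[of t] by (simp add: gauss_def)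

lemma linear_cdiv: "linear (cdiv X)"
  by (simp add: linear_iff cdiv_def mat_linear inner_add_right algebra_simps)

lemma linear_mom: "linear (\<lambda>z. mom z t)"
  using linear_cdiv[of "Km t"] by (simp add: linear_iff mom_def inner_add_right algebra_simps)

lemma mom_zero: "t \<in> I \<Longrightarrow> mom z t = 0"
proof (rule linear_vderiv_zero[OF refl deriv_mom[OF _ af_zero] cont(7)])
  have "mom (axis j 1) 0 = 0" for j
  proof -
    have "divK C (g 0) (K 0) j = - 8 * pi * (tau0 (F 0) (E 0) j + Defs.T0 (g 0) (u 0) (th0 0) (rho 0) j)"
      using constr0 unfolding constraints_def by blast
    moreover have "divK C (g 0) (K 0) j = cdiv (Km 0) (axis j 1)"
      unfolding divK_eq[OF lie posdef_g[OF I(1)] symm_K[OF I(1)]] cdiv_def B_def Km_def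
      by (simp add: G_def[symmetric] g_swap[OF I(1)] matrix_vector_mul_assoc)
    moreover have "tau0 (F 0) (E 0) j + Defs.T0 (g 0) (u 0) (th0 0) (rho 0) j = - (flux 0 \<bullet> axis j 1)"
      unfolding tau0_eq F_eq[OF I(1)] sk_mult flux_def
      by (simp add: T0_def ulow_eq Theta0low_def u0_def inner_axis matrix_vector_mult_def[of "g 0" "th0 0"])
    ultimately show ?thesis by (simp add: mom_def)
  qed
  moreover have "mom z 0 = z $ 1 * mom (axis 1 1) 0 + z $ 2 * mom (axis 2 1) 0 + z $ 3 * mom (axis 3 1) 0"
    by (subst vec3_eq_axis[of z])
      (simp only: linear_add[OF linear_mom] linear_scale[OF linear_mom] real_scaleR_def)
  ultimately show "mom z 0 = 0" by simp
qed auto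

lemma ham_zero: "t \<in> I \<Longrightarrow> ham t = 0"
proof (rule linear_vderiv_zero[OF refl, where q = ham and c = "\<lambda>t. 2 * H t"])
  show "(ham has_vector_derivative 2 * H t * ham t) (at t within I)" if "t \<in> I" for t
    using deriv_ham[OF that] mom_zero[OF that] by simp
  show "continuous_on I (\<lambda>t. 2 * H t)" by (intro continuous_intros cont)
  have "Rscal C (g 0) - (\<Sum>i\<in>UNIV. \<Sum>j\<in>UNIV. K 0 $ i $ j * Kup (g 0) (K 0) i j) + (Hmean (g 0) (K 0))\<^sup>2
      = 16 * pi * (tau00 (g 0) (F 0) (E 0) + T00 (g 0) (u 0) (th00 0) (rho 0)) + 2 * \<Lambda>"
    using constr0 unfolding constraints_def by blast
  moreover have "tau00 (g 0) (F 0) (E 0) = tau 0"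
    unfolding F_eq[OF I(1)] tau_def
    by (rule tau00_eq[OF posdef_g[OF I(1)]]) (simp add: \<phi>_def)
  ultimately show "ham 0 = 0"
    unfolding Kup_eq[OF posdef_g[OF I(1)] symm_K[OF I(1)]] Hmean_eq[OF posdef_g[OF I(1)] symm_K[OF I(1)]]
    by (simp add: ham_def Km_def G_def H_def Td_def T00_def u0_def matrix_mul_assoc)
qed

definition "k2 t = trace (Km t ** Km t)"

text \<open>In an orthonormal frame \<open>K\<close> becomes a symmetric \<open>A\<close> with
  squared Frobenius norm \<open>k2 t\<close>; Cauchy-Schwarz against \<open>mat 1\<close> and
  against \<open>outer y y\<close> gives the estimates.\<close>

lemma K_bounds:
  assumes t: "t \<in> I"
  shows "(H t)\<^sup>2 \<le> 3 * k2 t" "k2 t \<ge> 0" "\<bar>x \<bullet> (K t *v x)\<bar> \<le> sqrt (k2 t) * (x \<bullet> (g t *v x))"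
proof -
  obtain P Q where fr: "frame (g t) P Q" using posdef_frame[OF posdef_g[OF t]] .
  have PQ: "P ** Q = mat 1" "Q ** P = mat 1" and gP: "g t = transpose P ** P"
    using fr by (auto simp: frame_def)
  have PQt: "transpose P ** transpose Q = mat 1"
    using PQ by (metis matrix_transpose_mul transpose_mat)
  define A where "A = transpose Q ** K t ** Q"
  have As: "transpose A = A" by (simp add: A_def matrix_transpose_mul K_sym[OF t] matrix_mul_assoc)
  have GQ: "G t = Q ** transpose Q" by (simp add: G_def frame_inv[OF fr])
  have trA: "trace A = H t"
    using trace_mul_sym[of "transpose Q ** K t" Q] by (simp add: A_def H_def GQ matrix_mul_assoc)
  have "A \<bullet> A = trace (A ** A)" by (rule inner_symmetric[OF As])
  then have trAA: "A \<bullet> A = k2 t"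
    using trace_mul_sym[of "transpose Q ** K t ** Q ** transpose Q ** K t" Q]
    by (simp only: A_def k2_def Km_def GQ matrix_mul_assoc)
  show "k2 t \<ge> 0" unfolding trAA[symmetric] by simp
  have "(A \<bullet> mat 1)\<^sup>2 \<le> (A \<bullet> A) * (mat 1 \<bullet> (mat 1 :: real^3^3))" by (rule Cauchy_Schwarz_ineq)
  then show "(H t)\<^sup>2 \<le> 3 * k2 t" by (simp add: inner_mat1 trA trAA trace_I)
  define y where "y = P *v x"
  have "K t = transpose P ** A ** P"
  proof -
    have "transpose P ** A ** P = (transpose P ** transpose Q) ** K t ** (Q ** P)"
      by (simp only: A_def matrix_mul_assoc)
    then show ?thesis by (simp add: PQ PQt)
  qed
  then have xK: "x \<bullet> (K t *v x) = A \<bullet> outer y y"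
    by (simp add: inner_outer y_def matrix_vector_mul_assoc[symmetric] dot_transpose')
  have "norm (outer y y) = y \<bullet> y"
    by (simp add: norm_eq_sqrt_inner inner_outer outer_mult)
  moreover have "norm A = sqrt (k2 t)" by (simp add: norm_eq_sqrt_inner trAA)
  moreover have "y \<bullet> y = x \<bullet> (g t *v x)"
    by (simp add: y_def gP matrix_vector_mul_assoc[symmetric] dot_transpose')
  ultimately show "\<bar>x \<bullet> (K t *v x)\<bar> \<le> sqrt (k2 t) * (x \<bullet> (g t *v x))"
    using Cauchy_Schwarz_ineq2[of A "outer y y"] xK by simp
qed

lemma tau_nonneg: "t \<in> I \<Longrightarrow> 0 \<le> tau t" and \<phi>f_nonneg: "t \<in> I \<Longrightarrow> 0 \<le> \<phi> t \<bullet> f t"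
proof -
  show "0 \<le> \<phi> t \<bullet> f t" if "t \<in> I" for t
    using g_quad_nonneg[OF that, of "f t"] det_pos[OF that] by (simp add: \<phi>_def inner_commute)
  then show "0 \<le> tau t" if "t \<in> I" for t
    using g_quad_nonneg[OF that, of "E t"] that by (simp add: tau_def)
qed

lemma Td_ge: "t \<in> I \<Longrightarrow> 4/3 * rho t * (u0 t)\<^sup>2 \<le> Td t" and Td_th00: "t \<in> I \<Longrightarrow> th00 t \<le> Td t"
  using th00_nonneg rho_pos by (auto simp: Td_def less_imp_le)

lemma Td_nonneg: "t \<in> I \<Longrightarrow> 0 \<le> Td t"
  using Td_th00[of t] th00_nonneg[of t] by simp

lemma H_ineq:
  assumes t: "t \<in> I"
  shows "k2 t + 16 * pi * (tau t + Td t) + 2 * \<Lambda> \<le> (H t)\<^sup>2" "k2 t \<le> (H t)\<^sup>2" "tau t \<le> (H t)\<^sup>2" "Td t \<le> (H t)\<^sup>2"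
    "3 * \<Lambda> \<le> (H t)\<^sup>2"
proof -
  have "Rscal C (g t) \<le> 0" by (rule Rscal_nonpos[OF lie posdef_g[OF t] nIX])
  then show 1: "k2 t + 16 * pi * (tau t + Td t) + 2 * \<Lambda> \<le> (H t)\<^sup>2"
    using ham_zero[OF t] by (simp add: ham_def k2_def)
  have nn: "0 \<le> tau t" "0 \<le> Td t" "0 \<le> k2 t" using tau_nonneg Td_nonneg K_bounds t by auto
  define p where "p = 16 * pi * (tau t + Td t)"
  have "1 * (tau t + Td t) \<le> p"
    unfolding p_def by (rule mult_right_mono) (use pi_gt3 nn in linarith)+
  moreover have "k2 t + p + 2 * \<Lambda> \<le> (H t)\<^sup>2" using 1 by (simp only: p_def)
  ultimately show "k2 t \<le> (H t)\<^sup>2" "tau t \<le> (H t)\<^sup>2" "Td t \<le> (H t)\<^sup>2" "3 * \<Lambda> \<le> (H t)\<^sup>2"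
    using nn Lpos K_bounds(1)[OF t] by auto
qed

lemma H_neg: "t \<in> I \<Longrightarrow> H t < 0"
proof (rule ccontr)
  assume t: "t \<in> I" and "\<not> H t < 0"
  have "H 0 < 0" using H0 Hmean_eq[OF posdef_g[OF I(1)] symm_K[OF I(1)]] by (simp add: H_def G_def)
  moreover have "continuous_on {0..t} H" by (rule continuous_on_subset[OF cont(7)]) (use t in auto)
  ultimately obtain s where s: "0 \<le> s" "s \<le> t" "H s = 0"
    using IVT'[of H 0 0 t] \<open>\<not> H t < 0\<close> t by auto
  then show False using H_ineq(5)[of s] Lpos t by simp
qed

text \<open>(C1) eliminates \<open>R + H^2\<close>, for which no lower bound on \<open>R\<close> is
  then needed; the derivative becomes \<open>k2 - \<Lambda>\<close> plus nonnegative matter terms,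
  and \<open>k2 >= H^2 / 3 >= \<Lambda>\<close>.\<close>

lemma H_mono: "t \<in> I \<Longrightarrow> H 0 \<le> H t"
proof (rule vderiv_nonneg_imp_mono[OF I(2) deriv_H _ I(1)])
  fix s assume s: "s \<in> I"
  have "0 \<le> 4 * pi * (rho s + 4/3 * rho s * (u s \<bullet> (g s *v u s)))"
    using rho_pos[OF s] g_quad_nonneg[OF s, of "u s"] by (intro mult_nonneg_nonneg add_nonneg_nonneg) auto
  moreover have "0 \<le> 8 * pi * tau s" "0 \<le> 4 * pi * Td s" using tau_nonneg[OF s] Td_nonneg[OF s] by auto
  moreover have "Rscal C (g s) + (H s)\<^sup>2 = k2 s + 16 * pi * tau s + 16 * pi * Td s + 2 * \<Lambda>"
    using ham_zero[OF s] by (simp add: ham_def k2_def algebra_simps)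
  moreover have "k2 s \<ge> \<Lambda>" using H_ineq(5)[OF s] K_bounds(1)[OF s] by linarith
  ultimately show "0 \<le> Rscal C (g s) + (H s)\<^sup>2 - 8 * pi * tau s
    + 4 * pi * (rho s + 4/3 * rho s * (u s \<bullet> (g s *v u s))) - 12 * pi * Td s - 3 * \<Lambda>"
    by linarith
qed auto

definition "h = - H 0"

lemma h: "h > 0" "t \<in> I \<Longrightarrow> \<bar>H t\<bar> \<le> h" "t \<in> I \<Longrightarrow> (H t)\<^sup>2 \<le> h\<^sup>2"
proof -
  show "h > 0" using H_neg[OF I(1)] by (simp add: h_def)
  show 1: "\<bar>H t\<bar> \<le> h" if "t \<in> I" for t using H_neg[OF that] H_mono[OF that] by (simp add: h_def)
  show "(H t)\<^sup>2 \<le> h\<^sup>2" if "t \<in> I" for t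
    using 1[OF that] by (metis abs_ge_zero power2_abs power_mono)
qed

lemma K_form_bound:
  assumes t: "t \<in> I"
  shows "\<bar>x \<bullet> (K t *v x)\<bar> \<le> h * (x \<bullet> (g t *v x))"
proof -
  have "sqrt (k2 t) \<le> h"
    using H_ineq(2)[OF t] h(1) h(3)[OF t] by (intro real_le_lsqrt) auto
  then show ?thesis
    using K_bounds(3)[OF t, of x] mult_right_mono[OF _ g_quad_nonneg[OF t, of x]] by force
qed

text \<open>For each fixed \<open>x\<close> the derivative of \<open>x . g x\<close> is at most
  \<open>2 h\<close> times the form in absolute value, so the form changes by a factor of at most
  \<open>exp (2 * h * T)\<close>.\<close>

lemma metric_bounds:
  obtains l m where "l > 0" "m > 0" "\<And>t x. t \<in> I \<Longrightarrow> l * (x \<bullet> x) \<le> x \<bullet> (g t *v x)"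
    "\<And>t x. t \<in> I \<Longrightarrow> x \<bullet> (g t *v x) \<le> m * (x \<bullet> x)"
proof -
  obtain l where l: "l > 0" "\<And>x. l * (x \<bullet> x) \<le> x \<bullet> (g 0 *v x)"
    using posdef_lower_bound[OF posdef_g[OF I(1)]] by blast
  obtain k where k: "k > 0" "\<And>A x. norm ((A::real^3^3) *v x) \<le> norm A * norm x * k" by (rule mv_norm_bound) blast
  define m where "m = norm (g 0) * k + 1"
  have m: "m > 0" "x \<bullet> (g 0 *v x) \<le> m * (x \<bullet> x)" for x
  proof -
    show "m > 0" using k by (simp add: m_def add_nonneg_pos)
    have "x \<bullet> (g 0 *v x) \<le> norm x * norm (g 0 *v x)" by (rule norm_cauchy_schwarz)
    also have "\<dots> \<le> norm x * (norm (g 0) * norm x * k)" by (intro mult_left_mono k) auto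
    also have "\<dots> = (norm (g 0) * k) * (x \<bullet> x)" by (simp add: power2_norm_eq_inner[symmetric] power2_eq_square)
    also have "\<dots> \<le> m * (x \<bullet> x)" by (intro mult_right_mono) (auto simp: m_def)
    finally show "x \<bullet> (g 0 *v x) \<le> m * (x \<bullet> x)" .
  qed
  have d: "((\<lambda>t. x \<bullet> (g t *v x)) has_vector_derivative - 2 * (x \<bullet> (K t *v x))) (at t within I)" if "t \<in> I" for t x
    by (rule has_vector_derivative_eq_rhs, (rule hvd_rules derivs(1)[OF that] has_vector_derivative_const)+)
      (simp add: mat_linear)
  have low: "l * exp (- (2 * h) * T) * (x \<bullet> x) \<le> x \<bullet> (g t *v x)" if t: "t \<in> I" for t x
  proof -
    have "exp (2 * h * 0) * (x \<bullet> (g 0 *v x)) \<le> exp (2 * h * t) * (x \<bullet> (g t *v x))"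
      by (rule vderiv_ge_imp_exp_lower[OF I(2) d _ I(1) t]) (use K_form_bound[of _ x] t in \<open>auto simp: abs_le_iff mult.assoc\<close>)
    then have "l * (x \<bullet> x) \<le> exp (2 * h * t) * (x \<bullet> (g t *v x))" using l(2)[of x] by simp
    also have "\<dots> \<le> exp (2 * h * T) * (x \<bullet> (g t *v x))"
      using h(1) t g_quad_nonneg[OF t] by (intro mult_right_mono) auto
    finally show ?thesis by (simp add: exp_minus field_simps)
  qed
  have up: "x \<bullet> (g t *v x) \<le> m * exp (2 * h * T) * (x \<bullet> x)" if t: "t \<in> I" for t x
  proof -
    have "exp (- (2 * h) * t) * (x \<bullet> (g t *v x)) \<le> exp (- (2 * h) * 0) * (x \<bullet> (g 0 *v x))"
      by (rule vderiv_le_imp_exp_upper[OF I(2) d _ I(1) t]) (use K_form_bound[of _ x] t in \<open>auto simp: abs_le_iff mult.assoc\<close>)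
    then have "exp (- (2 * h) * t) * (x \<bullet> (g t *v x)) \<le> m * (x \<bullet> x)" using m(2)[of x] by simp
    then have "x \<bullet> (g t *v x) \<le> exp (2 * h * t) * (m * (x \<bullet> x))" by (simp add: exp_minus field_simps)
    also have "\<dots> \<le> exp (2 * h * T) * (m * (x \<bullet> x))"
      using h(1) t m by (intro mult_right_mono) auto
    finally show ?thesis by (simp add: mult.commute mult.left_commute)
  qed
  show ?thesis
    by (rule that[of "l * exp (- (2 * h) * T)" "m * exp (2 * h * T)"]) (use l m low up in auto)
qed

end

section \<open>Bounds for the matter variables\<close>

lemma exp_minus_mult_le: "exp (- x) * y \<le> z \<Longrightarrow> y \<le> exp x * z" for x y z :: real
  by (simp add: exp_minus field_simps)

context ebs_data
begin

text \<open>After (C4) has replaced \<open>a . E\<close> by \<open>- e u0\<close>, the logarithmic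
  derivatives of \<open>e\<close> and \<open>rho\<close> share all terms except
  \<open>3 / (4 u0)\<close>, which is at most 3/4 because \<open>u0 >= 1\<close>.\<close>

lemma deriv_ratio:
  assumes t: "t \<in> I"
  shows "((\<lambda>t. e t / rho t) has_vector_derivative 3 / (4 * u0 t) * (e t / rho t)) (at t within I)"
proof -
  have nz: "u0 t \<noteq> 0" "rho t \<noteq> 0" using u0_pos[OF t] rho_pos[OF t] by auto
  show ?thesis
    by (rule has_vector_derivative_eq_rhs[OF vderiv_divide[OF derivs(8)[OF t] derivs(7)[OF t] nz(2)]])
      (use nz in \<open>simp add: aE[OF t] field_simps power2_eq_square power3_eq_cube\<close>)
qed

lemma deriv_rho:
  assumes t: "t \<in> I"
  shows "(rho has_vector_derivative - (3 / (4 * u0 t) + (u t \<bullet> (K t *v u t)) / (u0 t)\<^sup>2 - H t + (a \<bullet> u t) / u0 t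
     - 3/4 * ((e t / rho t) * ((u t \<bullet> (g t *v E t)) / (u0 t)\<^sup>2))) * rho t) (at t within I)"
proof -
  have nz: "u0 t \<noteq> 0" "rho t \<noteq> 0" using u0_pos[OF t] rho_pos[OF t] by auto
  show ?thesis
    by (rule has_vector_derivative_eq_rhs[OF derivs(7)[OF t]])
      (use nz in \<open>simp add: aE[OF t] field_simps power2_eq_square power3_eq_cube\<close>)
qed

lemma ratio_bound: "t \<in> I \<Longrightarrow> 0 \<le> e t / rho t \<and> e t / rho t \<le> exp (3/4 * T) * (e 0 / rho 0)"
proof
  assume t: "t \<in> I"
  have nn: "0 \<le> e s / rho s" if "s \<in> I" for s using e_nonneg[OF that] rho_pos[OF that] by simp
  then show "0 \<le> e t / rho t" using t .
  have "exp (- (3/4) * t) * (e t / rho t) \<le> exp (- (3/4) * 0) * (e 0 / rho 0)"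
  proof (rule vderiv_le_imp_exp_upper[OF I(2) deriv_ratio _ I(1) t])
    fix s assume s: "s \<in> I"
    have "3 / (4 * u0 s) \<le> 3/4" using u0_ge[OF s] by (simp add: field_simps)
    then show "3 / (4 * u0 s) * (e s / rho s) \<le> 3/4 * (e s / rho s)" using nn[OF s] by (rule mult_right_mono)
  qed (use t in auto)
  then have "e t / rho t \<le> exp (3/4 * t) * (e 0 / rho 0)"
    by (intro exp_minus_mult_le) (simp only: mult_minus_left mult_zero_right exp_zero minus_zero mult_1)
  also have "\<dots> \<le> exp (3/4 * T) * (e 0 / rho 0)" using t nn[OF I(1)] by (intro mult_right_mono) auto
  finally show "e t / rho t \<le> exp (3/4 * T) * (e 0 / rho 0)" .
qed

text \<open>The metric, \<open>K\<close>, \<open>E\<close> and \<open>F\<close> are bounded without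
  any information on \<open>u\<close>. The bound \<open>u_L\<close> for \<open>u / u0\<close>
  suffices to bound \<open>rho\<close> below, and then the bound on \<open>rho u0^2\<close> controls
  \<open>u\<close>.\<close>

theorem apriori_bounds:
  "\<exists>l>0. \<exists>r>0. (\<forall>t\<in>I. (\<forall>x. l * (x \<bullet> x) \<le> x \<bullet> (g t *v x)) \<and> r \<le> rho t) \<and>
    bounded (g ` I) \<and> bounded (K ` I) \<and> bounded (F ` I) \<and> bounded (E ` I) \<and> bounded (u ` I) \<and>
    bounded (th00 ` I) \<and> bounded (th0 ` I) \<and> bounded (rho ` I) \<and> bounded (e ` I)"
proof -
  obtain l m where l: "l > 0" and m: "m > 0" and lo: "\<And>t x. t \<in> I \<Longrightarrow> l * (x \<bullet> x) \<le> x \<bullet> (g t *v x)"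
    and up: "\<And>t x. t \<in> I \<Longrightarrow> x \<bullet> (g t *v x) \<le> m * (x \<bullet> x)"
    using metric_bounds by blast
  obtain k where k: "k > 0" "\<And>A x. norm ((A::real^3^3) *v x) \<le> norm A * norm x * k"
    using mv_norm_bound by blast
  have sq: "norm x \<le> sqrt (c / l)" if "t \<in> I" "x \<bullet> (g t *v x) \<le> c" for t x c
  proof -
    have "l * (x \<bullet> x) \<le> c" using lo[OF that(1), of x] that(2) by simp
    then have "x \<bullet> x \<le> c / l" using l by (simp add: field_simps)
    then show ?thesis by (simp add: norm_eq_sqrt_inner)
  qed
  have g_bd: "norm (g t) \<le> 9 * m" if t: "t \<in> I" for t
    by (rule sym_entry_bound[OF gs[OF t]]) (use up[OF t] g_quad_nonneg[OF t] in auto)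
  have K_bd: "norm (K t) \<le> 9 * (h * m)" if t: "t \<in> I" for t
  proof (rule sym_entry_bound[OF K_sym[OF t]])
    fix x
    have "h * (x \<bullet> (g t *v x)) \<le> h * (m * (x \<bullet> x))" using h(1) up[OF t, of x] by (intro mult_left_mono) auto
    then show "\<bar>x \<bullet> (K t *v x)\<bar> \<le> h * m * (x \<bullet> x)" using K_form_bound[OF t, of x] by simp
  qed
  have G_bd: "norm (G t) \<le> 9 * (1 / l)" if t: "t \<in> I" for t
  proof (rule sym_entry_bound[OF Gs[OF t]])
    fix x
    define y where "y = G t *v x"
    have xy: "x \<bullet> (G t *v x) = y \<bullet> (g t *v y)"
      by (simp add: y_def gG_vec[OF t] inner_commute)
    have "l * (norm y)\<^sup>2 \<le> y \<bullet> (g t *v y)" using lo[OF t, of y] by (simp add: power2_norm_eq_inner)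
    also have "\<dots> = x \<bullet> y" using xy by (simp add: y_def)
    also have "\<dots> \<le> norm x * norm y" by (rule norm_cauchy_schwarz)
    finally have "norm y * (l * norm y) \<le> norm y * norm x" by (simp add: power2_eq_square mult_ac)
    then have ly: "l * norm y \<le> norm x"
      by (cases "norm y = 0") (auto simp: mult_le_cancel_left)
    have "x \<bullet> y \<le> norm x * norm y" by (rule norm_cauchy_schwarz)
    also have "\<dots> \<le> norm x * (norm x / l)" using ly l by (intro mult_left_mono) (auto simp: field_simps)
    finally have "x \<bullet> y \<le> 1 / l * (x \<bullet> x)" by (simp add: power2_norm_eq_inner[symmetric] power2_eq_square)
    moreover have "0 \<le> x \<bullet> y" using xy g_quad_nonneg[OF t, of y] by (simp add: y_def)
    ultimately show "\<bar>x \<bullet> (G t *v x)\<bar> \<le> 1 / l * (x \<bullet> x)" by (simp add: y_def)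
  qed
  have tau_h: "tau t \<le> h\<^sup>2" "Td t \<le> h\<^sup>2" if "t \<in> I" for t
    using H_ineq[OF that] h(3)[OF that] by auto
  have E_bd: "norm (E t) \<le> sqrt (2 * h\<^sup>2 / l)" if t: "t \<in> I" for t
    by (rule sq[OF t]) (use tau_h[OF t] \<phi>f_nonneg[OF t] in \<open>simp add: tau_def\<close>)
  have det_bd: "det (g t) \<le> exp (2 * h * T) * det (g 0)" if t: "t \<in> I" for t
  proof -
    have "exp (- (2 * h) * t) * det (g t) \<le> exp (- (2 * h) * 0) * det (g 0)"
    proof (rule vderiv_le_imp_exp_upper[OF I(2) deriv_det _ I(1) t])
      fix s assume s: "s \<in> I"
      show "- 2 * H s * det (g s) \<le> 2 * h * det (g s)"
        using h(2)[OF s] det_pos[OF s] by (intro mult_right_mono) auto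
    qed (use t in auto)
    then have "det (g t) \<le> exp (2 * h * t) * det (g 0)" by (simp add: exp_minus field_simps)
    also have "\<dots> \<le> exp (2 * h * T) * det (g 0)"
      using t h(1) det_pos[OF I(1)] by (intro mult_right_mono) auto
    finally show ?thesis .
  qed
  have f_bd: "norm (f t) \<le> sqrt (2 * h\<^sup>2 * (exp (2 * h * T) * det (g 0)) / l)" if t: "t \<in> I" for t
  proof (rule sq[OF t])
    have "\<phi> t \<bullet> f t \<le> 2 * h\<^sup>2" using tau_h[OF t] g_quad_nonneg[OF t, of "E t"] by (simp add: tau_def)
    then have "f t \<bullet> (g t *v f t) \<le> 2 * h\<^sup>2 * det (g t)"
      using det_pos[OF t] by (simp add: \<phi>_def inner_commute field_simps)
    also have "\<dots> \<le> 2 * h\<^sup>2 * (exp (2 * h * T) * det (g 0))"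
      using det_bd[OF t] by (intro mult_left_mono) auto
    finally show "f t \<bullet> (g t *v f t) \<le> 2 * h\<^sup>2 * (exp (2 * h * T) * det (g 0))" .
  qed
  define L where "L = sqrt (1 / l)"
  have u_L: "norm (u t) \<le> L * u0 t" if t: "t \<in> I" for t
  proof -
    have "norm (u t) \<le> sqrt ((u0 t)\<^sup>2 / l)" by (rule sq[OF t]) (simp add: u0_sq[OF t])
    then show ?thesis using u0_pos[OF t] by (simp add: L_def real_sqrt_divide)
  qed
  have L0: "L \<ge> 0" using l by (simp add: L_def)
  define W where "W = exp (3/4 * T) * (e 0 / rho 0)"
  have W0: "0 \<le> W" using ratio_bound[OF I(1)] by (simp add: W_def)
  define M where "M = 9 * m * sqrt (2 * h\<^sup>2 / l) * k"
  have gE: "norm (g t *v E t) \<le> M" if t: "t \<in> I" for t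
  proof -
    have "norm (g t *v E t) \<le> norm (g t) * norm (E t) * k" by (rule k)
    also have "\<dots> \<le> 9 * m * sqrt (2 * h\<^sup>2 / l) * k"
      using g_bd[OF t] E_bd[OF t] k m by (intro mult_right_mono mult_mono) auto
    finally show ?thesis by (simp add: M_def)
  qed
  have M0: "0 \<le> M" using gE[OF I(1)] norm_ge_zero order_trans by blast
  \<comment> \<open>The summands bound, in this order, \<open>3 / (4 u0)\<close>,
    \<open>K(u, u) / u0^2\<close>, \<open>- H\<close>, \<open>(a . u) / u0\<close> and the electric
    term with the factor \<open>e / rho\<close>.\<close>
  define c where "c = 1 + h + h + norm a * L + 3/4 * (W * (L * M))"
  have rho_lower: "exp (- (c * T)) * rho 0 \<le> rho t" if t: "t \<in> I" for t
  proof -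
    have "exp (c * 0) * rho 0 \<le> exp (c * t) * rho t"
    proof (rule vderiv_ge_imp_exp_lower[OF I(2) deriv_rho _ I(1) t])
      fix s assume s: "s \<in> I"
      have u0: "u0 s \<ge> 1" "u0 s > 0" using u0_ge[OF s] by auto
      have 1: "3 / (4 * u0 s) \<le> 1" using u0 by (simp add: field_simps)
      have "u s \<bullet> (K s *v u s) \<le> h * (u s \<bullet> (g s *v u s))" using K_form_bound[OF s, of "u s"] by simp
      also have "\<dots> \<le> h * (u0 s)\<^sup>2" using u0_sq[OF s] h(1) by (intro mult_left_mono) auto
      finally have 2: "(u s \<bullet> (K s *v u s)) / (u0 s)\<^sup>2 \<le> h" using u0 by (simp add: field_simps)
      have 3: "- H s \<le> h" using h(2)[OF s] by simp
      have "a \<bullet> u s \<le> norm a * norm (u s)" by (rule norm_cauchy_schwarz)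
      also have "\<dots> \<le> norm a * (L * u0 s)" by (intro mult_left_mono u_L s) auto
      finally have 4: "(a \<bullet> u s) / u0 s \<le> norm a * L" using u0 by (simp add: field_simps)
      have "\<bar>u s \<bullet> (g s *v E s)\<bar> \<le> norm (u s) * norm (g s *v E s)" by (rule Cauchy_Schwarz_ineq2)
      also have "\<dots> \<le> (L * u0 s) * M" using u_L[OF s] gE[OF s] L0 u0 by (intro mult_mono) auto
      also have "\<dots> \<le> (L * M) * (u0 s)\<^sup>2"
        using mult_left_mono[of "u0 s" "(u0 s)\<^sup>2" "L * M"] u0 L0 M0 by (simp add: power2_eq_square mult_ac)
      finally have "\<bar>(u s \<bullet> (g s *v E s)) / (u0 s)\<^sup>2\<bar> \<le> L * M" using u0 by (simp add: field_simps)
      then have "\<bar>(e s / rho s) * ((u s \<bullet> (g s *v E s)) / (u0 s)\<^sup>2)\<bar> \<le> W * (L * M)"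
        unfolding abs_mult using ratio_bound[OF s] W0 by (intro mult_mono) (auto simp: W_def)
      then have 5: "- (3/4 * ((e s / rho s) * ((u s \<bullet> (g s *v E s)) / (u0 s)\<^sup>2))) \<le> 3/4 * (W * (L * M))"
        by linarith
      have "3 / (4 * u0 s) + (u s \<bullet> (K s *v u s)) / (u0 s)\<^sup>2 - H s + (a \<bullet> u s) / u0 s
         - 3/4 * ((e s / rho s) * ((u s \<bullet> (g s *v E s)) / (u0 s)\<^sup>2)) \<le> c"
        using 1 2 3 4 5 unfolding c_def by linarith
      from mult_right_mono[OF this less_imp_le[OF rho_pos[OF s]]] show "- (c * rho s) \<le> - (3 / (4 * u0 s) + (u s \<bullet> (K s *v u s)) / (u0 s)\<^sup>2 - H s + (a \<bullet> u s) / u0 s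
         - 3/4 * ((e s / rho s) * ((u s \<bullet> (g s *v E s)) / (u0 s)\<^sup>2))) * rho s"
        by (simp only: mult_minus_left neg_le_iff_le)
    qed (use t in auto)
    also have "exp (c * t) * rho t \<le> exp (c * T) * rho t"
      using t rho_pos[OF t] h(1) L0 M0 W0 by (intro mult_right_mono) (auto simp: c_def intro!: mult_left_mono add_nonneg_nonneg)
    finally show ?thesis by (simp add: exp_minus field_simps)
  qed
  define r where "r = exp (- (c * T)) * rho 0"
  have r: "r > 0" using rho_pos[OF I(1)] by (simp add: r_def)
  have ru: "rho t * (u0 t)\<^sup>2 \<le> h\<^sup>2" if t: "t \<in> I" for t
  proof -
    have "0 \<le> rho t * (u0 t)\<^sup>2" using rho_pos[OF t] by simp
    then show ?thesis using Td_ge[OF t] tau_h(2)[OF t] by simp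
  qed
  have rho_bd: "rho t \<le> h\<^sup>2" if t: "t \<in> I" for t
  proof -
    have "rho t * 1 \<le> rho t * (u0 t)\<^sup>2"
      using rho_pos[OF t] u0_ge[OF t] by (intro mult_left_mono) (auto simp: one_le_power)
    then show ?thesis using ru[OF t] by simp
  qed
  have u0_bd: "u0 t \<le> sqrt (h\<^sup>2 / r)" if t: "t \<in> I" for t
  proof -
    have "r * (u0 t)\<^sup>2 \<le> rho t * (u0 t)\<^sup>2" using rho_lower[OF t] by (intro mult_right_mono) (auto simp: r_def)
    then have "(u0 t)\<^sup>2 \<le> h\<^sup>2 / r" using ru[OF t] r by (simp add: field_simps)
    then show ?thesis by (rule real_le_rsqrt)
  qed
  define Ru where "Ru = L * sqrt (h\<^sup>2 / r)"
  have u_bd: "norm (u t) \<le> Ru" if t: "t \<in> I" for t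
    using u_L[OF t] mult_left_mono[OF u0_bd[OF t] L0] by (simp add: Ru_def)
  have e_bd: "\<bar>e t\<bar> \<le> W * h\<^sup>2" if t: "t \<in> I" for t
  proof -
    have "e t = (e t / rho t) * rho t" using rho_pos[OF t] by simp
    also have "\<dots> \<le> W * h\<^sup>2"
      using ratio_bound[OF t] rho_bd[OF t] rho_pos[OF t] W0 by (intro mult_mono) (auto simp: W_def)
    finally show ?thesis using e_nonneg[OF t] by simp
  qed
  have "\<exists>R. \<forall>t\<in>I. norm (th0 t) \<le> R"
  proof -
    have "bilinear cdiv"
      unfolding bilinear_def using linear_cdiv by (auto simp: linear_iff cdiv_linear)
    then have "bounded_bilinear cdiv" by (simp add: bilinear_conv_bounded_bilinear)
    then obtain kc where kc: "kc > 0" "\<And>X z. norm (cdiv X z) \<le> norm X * norm z * kc"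
      using bounded_bilinear.pos_bounded by blast
    obtain kx where kx: "kx > 0" "\<And>x z. norm (cross3 x z) \<le> norm x * norm z * kx"
      using cr.pos_bounded by blast
    obtain km where km: "km > 0" "\<And>X Y. norm ((X::real^3^3) ** (Y::real^3^3)) \<le> norm X * norm Y * km"
      using mm.pos_bounded by blast
    define Rk where "Rk = 9 * (1 / l) * (9 * (h * m)) * km"
    define Rf where "Rf = sqrt (2 * h\<^sup>2 * (exp (2 * h * T) * det (g 0)) / l)"
    define RE where "RE = sqrt (2 * h\<^sup>2 / l)"
    define Rq where "Rq = Rk * kc / (8 * pi) + Rf * RE * kx + 4/3 * h\<^sup>2 * (9 * m * Ru * k)"
    have "norm (th0 t) \<le> Rq / l" if t: "t \<in> I" for t
    proof -
      let ?\<theta> = "th0 t"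
      have "norm (Km t) \<le> norm (G t) * norm (K t) * km" unfolding Km_def by (rule km)
      also have "\<dots> \<le> Rk" unfolding Rk_def using G_bd[OF t] K_bd[OF t] km l by (intro mult_right_mono mult_mono) auto
      finally have Rk: "norm (Km t) \<le> Rk" .
      have "\<bar>cdiv (Km t) ?\<theta>\<bar> \<le> norm (Km t) * norm ?\<theta> * kc" using kc(2)[of "Km t" ?\<theta>] by simp
      also have "\<dots> \<le> Rk * norm ?\<theta> * kc" using Rk kc by (intro mult_right_mono) auto
      finally have 1: "cdiv (Km t) ?\<theta> / (8 * pi) \<le> Rk * kc / (8 * pi) * norm ?\<theta>"
        using pi_gt_zero by (simp add: field_simps)
      have fE: "norm (cross3 (f t) (E t)) \<le> Rf * RE * kx"
      proof -
        have b: "norm (f t) \<le> Rf" "norm (E t) \<le> RE" using f_bd[OF t] E_bd[OF t] by (simp_all add: Rf_def RE_def)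
        then have "0 \<le> Rf" using norm_ge_zero order_trans by blast
        then have "norm (f t) * norm (E t) * kx \<le> Rf * RE * kx"
          using b kx(1) by (intro mult_right_mono mult_mono) auto
        then show ?thesis using kx(2) order_trans by blast
      qed
      have 2: "\<bar>cross3 (f t) (E t) \<bullet> ?\<theta>\<bar> \<le> Rf * RE * kx * norm ?\<theta>"
        by (intro order_trans[OF Cauchy_Schwarz_ineq2] mult_right_mono fE) auto
      have gu: "norm (g t *v u t) \<le> 9 * m * Ru * k"
      proof -
        have "norm (g t) * norm (u t) * k \<le> (9 * m) * Ru * k"
          using k(1) m by (intro mult_right_mono mult_mono g_bd[OF t] u_bd[OF t]) auto
        then show ?thesis using k(2) order_trans by blast
      qed
      have ru0: "0 \<le> 4/3 * (rho t * u0 t)" "4/3 * (rho t * u0 t) \<le> 4/3 * h\<^sup>2"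
      proof -
        show "0 \<le> 4/3 * (rho t * u0 t)" using rho_pos[OF t] u0_pos[OF t] by simp
        have "rho t * u0 t \<le> rho t * (u0 t)\<^sup>2"
          using rho_pos[OF t] u0_ge[OF t] by (intro mult_left_mono) (auto simp: power2_eq_square)
        then show "4/3 * (rho t * u0 t) \<le> 4/3 * h\<^sup>2" using ru[OF t] by simp
      qed
      have "\<bar>(g t *v u t) \<bullet> ?\<theta>\<bar> \<le> (9 * m * Ru * k) * norm ?\<theta>"
        by (intro order_trans[OF Cauchy_Schwarz_ineq2] mult_right_mono gu) auto
      then have "4/3 * (rho t * u0 t) * \<bar>(g t *v u t) \<bullet> ?\<theta>\<bar> \<le> 4/3 * h\<^sup>2 * ((9 * m * Ru * k) * norm ?\<theta>)"
        using ru0 by (intro mult_mono) auto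
      moreover have "- (4/3 * (rho t * u0 t) * ((g t *v u t) \<bullet> ?\<theta>)) \<le> 4/3 * (rho t * u0 t) * \<bar>(g t *v u t) \<bullet> ?\<theta>\<bar>"
        using mult_left_mono[OF abs_ge_minus_self ru0(1)] by (simp only: mult_minus_right)
      ultimately have 3: "- (4/3 * (rho t * u0 t) * ((g t *v u t) \<bullet> ?\<theta>)) \<le> 4/3 * h\<^sup>2 * (9 * m * Ru * k) * norm ?\<theta>"
        by linarith
      \<comment> \<open>(C2) tested with \<open>th0\<close> itself: \<open>flux\<close> contains
        \<open>g th0\<close>, so the positive form \<open>th0 . g th0\<close> is expressed by terms
        linear in \<open>th0\<close>, and one factor of the norm can be cancelled.\<close>
      have "flux t \<bullet> ?\<theta> = cdiv (Km t) ?\<theta> / (8 * pi)"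
        using mom_zero[OF t, of ?\<theta>] by (simp add: mom_def)
      then have "?\<theta> \<bullet> (g t *v ?\<theta>) = cdiv (Km t) ?\<theta> / (8 * pi) - cross3 (f t) (E t) \<bullet> ?\<theta>
          - 4/3 * (rho t * u0 t) * ((g t *v u t) \<bullet> ?\<theta>)"
        by (simp add: flux_def inner_add_left inner_commute[of ?\<theta>])
      also have "\<dots> \<le> Rk * kc / (8 * pi) * norm ?\<theta> + Rf * RE * kx * norm ?\<theta> + 4/3 * h\<^sup>2 * (9 * m * Ru * k) * norm ?\<theta>"
        using 1 2 3 by linarith
      also have "\<dots> = Rq * norm ?\<theta>" by (simp add: Rq_def distrib_right)
      finally have "l * norm ?\<theta> * norm ?\<theta> \<le> Rq * norm ?\<theta>"
        using lo[OF t, of ?\<theta>] by (simp add: power2_norm_eq_inner[symmetric] power2_eq_square)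
      then have "?\<theta> = 0 \<or> l * norm ?\<theta> \<le> Rq" by (auto simp: mult_le_cancel_right)
      moreover have "0 \<le> Rq"
      proof -
        have "0 \<le> Rk" "0 \<le> Rf * RE * kx" "0 \<le> 9 * m * Ru * k"
          using order_trans[OF norm_ge_zero Rk] order_trans[OF norm_ge_zero fE]
            order_trans[OF norm_ge_zero gu] by auto
        then show ?thesis using kc(1) pi_gt_zero unfolding Rq_def
          by (intro add_nonneg_nonneg mult_nonneg_nonneg[of "4/3 * h\<^sup>2"]) simp_all
      qed
      ultimately show ?thesis using l by (auto simp: field_simps)
    qed
    then show ?thesis by blast
  qed
  then obtain Rt where th0_bd: "\<And>t. t \<in> I \<Longrightarrow> norm (th0 t) \<le> Rt" by blast
  obtain ks where ks: "\<And>v. norm (sk v) \<le> ks * norm v" "ks > 0"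
    using linear_bounded_pos[OF linear_sk] by blast
  have F_bd: "norm (F t) \<le> ks * sqrt (2 * h\<^sup>2 * (exp (2 * h * T) * det (g 0)) / l)" if t: "t \<in> I" for t
    unfolding F_eq[OF t] using ks f_bd[OF t] by (intro order_trans[OF ks(1)] mult_left_mono) auto
  have th00_bd: "\<bar>th00 t\<bar> \<le> h\<^sup>2" if t: "t \<in> I" for t
    using th00_nonneg[OF t] Td_th00[OF t] tau_h(2)[OF t] by simp
  have bdI: "bounded (X ` I)" if "\<And>t. t \<in> I \<Longrightarrow> norm (X t) \<le> R" for X :: "real \<Rightarrow> 'b::real_normed_vector" and R
    unfolding bounded_iff using that by blast
  show ?thesis
  proof (rule exI[of _ l], rule conjI[OF l], rule exI[of _ r], rule conjI[OF r], intro conjI ballI allI)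
    show "bounded (g ` I)" by (rule bdI[OF g_bd])
    show "bounded (K ` I)" by (rule bdI[OF K_bd])
    show "bounded (F ` I)" by (rule bdI[OF F_bd])
    show "bounded (E ` I)" by (rule bdI[OF E_bd])
    show "bounded (u ` I)" by (rule bdI[OF u_bd])
    show "bounded (th00 ` I)" by (rule bdI[of th00 "h\<^sup>2"]) (simp add: th00_bd)
    show "bounded (th0 ` I)" by (rule bdI[OF th0_bd])
    show "bounded (rho ` I)" by (rule bdI[of rho "h\<^sup>2"]) (use rho_bd rho_pos in \<open>simp add: less_imp_le\<close>)
    show "bounded (e ` I)" by (rule bdI[of e "W * h\<^sup>2"]) (simp add: e_bd)
    show "l * (x \<bullet> x) \<le> x \<bullet> (g t *v x)" if "t \<in> I" for t x by (rule lo[OF that])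
    show "r \<le> rho t" if "t \<in> I" for t using rho_lower[OF that] by (simp add: r_def)
  qed
qed

end

subsection \<open>Locally Lipschitz functions\<close>

lemma ll_iff:
  "locally_lipschitz_on U f \<longleftrightarrow> (\<forall>x\<in>U. \<exists>r>0. \<exists>L\<ge>0. \<forall>y\<in>cball x r \<inter> U. \<forall>z\<in>cball x r \<inter> U.
     dist (f y) (f z) \<le> L * dist y z)"
  unfolding locally_lipschitz_on_def lipschitz_on_def by blast

lemma ll_const: "locally_lipschitz_on U (\<lambda>x. c)"
  unfolding ll_iff by (auto intro!: exI[of _ 1])

lemma ll_cong:
  assumes "locally_lipschitz_on U f" "\<And>x. x \<in> U \<Longrightarrow> f x = g x"
  shows "locally_lipschitz_on U g"
  using assms unfolding ll_iff by (metis IntD2)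

lemma ll_compose:
  assumes f: "locally_lipschitz_on U f" and h: "locally_lipschitz_on V h" and "\<And>x. x \<in> U \<Longrightarrow> f x \<in> V"
  shows "locally_lipschitz_on U (\<lambda>x. h (f x))"
  unfolding ll_iff
proof
  fix x assume x: "x \<in> U"
  obtain r L where r: "r > 0" "L \<ge> 0" "\<And>y z. y \<in> cball x r \<inter> U \<Longrightarrow> z \<in> cball x r \<inter> U \<Longrightarrow> dist (f y) (f z) \<le> L * dist y z"
    using f x unfolding ll_iff by metis
  obtain s M where s: "s > 0" "M \<ge> 0" "\<And>y z. y \<in> cball (f x) s \<inter> V \<Longrightarrow> z \<in> cball (f x) s \<inter> V \<Longrightarrow> dist (h y) (h z) \<le> M * dist y z"
    using h assms(3)[OF x] unfolding ll_iff by metis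
  \<comment> \<open>On this ball \<open>f\<close> moves by at most \<open>s\<close>, so the
    Lipschitz bound for \<open>h\<close> applies to its values; \<open>L + 1\<close> avoids division
    by zero.\<close>
  define d where "d = min r (s / (L + 1))"
  have d: "d > 0" "d \<le> r" using r s by (auto simp: d_def)
  have in_V: "f y \<in> cball (f x) s \<inter> V" if y: "y \<in> cball x d \<inter> U" for y
  proof -
    have "dist (f x) (f y) \<le> L * dist x y" using r(3)[of x y] y x d by auto
    also have "\<dots> \<le> (L + 1) * (s / (L + 1))" using y r(2) by (intro mult_mono) (auto simp: d_def)
    also have "\<dots> = s" using r(2) by simp
    finally show ?thesis using assms(3) y by auto
  qed
  show "\<exists>r>0. \<exists>L\<ge>0. \<forall>y\<in>cball x r \<inter> U. \<forall>z\<in>cball x r \<inter> U. dist (h (f y)) (h (f z)) \<le> L * dist y z"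
  proof (intro exI conjI ballI)
    fix y z assume yz: "y \<in> cball x d \<inter> U" "z \<in> cball x d \<inter> U"
    have "dist (h (f y)) (h (f z)) \<le> M * dist (f y) (f z)" by (intro s(3) in_V yz)
    also have "\<dots> \<le> M * (L * dist y z)" using yz d s(2) by (intro mult_left_mono r(3)) auto
    finally show "dist (h (f y)) (h (f z)) \<le> M * L * dist y z" by simp
  qed (use d r s in auto)
qed

lemma ll_bounded_linear:
  assumes h: "bounded_linear h" and f: "locally_lipschitz_on U f"
  shows "locally_lipschitz_on U (\<lambda>x. h (f x))"
proof (rule ll_compose[OF f, of UNIV])
  interpret bounded_linear h by fact
  obtain k where k: "\<And>x. norm (h x) \<le> norm x * k" "k \<ge> 0" using nonneg_bounded by blast
  have "dist (h y) (h z) \<le> k * dist y z" for y z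
    using k(1)[of "y - z"] by (simp add: dist_norm diff mult.commute)
  then show "locally_lipschitz_on UNIV h" unfolding ll_iff using k(2) by (meson zero_less_one)
qed simp

lemma ll_Pair:
  assumes "locally_lipschitz_on U f" "locally_lipschitz_on U g"
  shows "locally_lipschitz_on U (\<lambda>x. (f x, g x))"
  unfolding ll_iff
proof
  fix x assume x: "x \<in> U"
  obtain r L where r: "r > 0" "L \<ge> 0" "\<And>y z. y \<in> cball x r \<inter> U \<Longrightarrow> z \<in> cball x r \<inter> U \<Longrightarrow> dist (f y) (f z) \<le> L * dist y z"
    using assms(1) x unfolding ll_iff by metis
  obtain s M where s: "s > 0" "M \<ge> 0" "\<And>y z. y \<in> cball x s \<inter> U \<Longrightarrow> z \<in> cball x s \<inter> U \<Longrightarrow> dist (g y) (g z) \<le> M * dist y z"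
    using assms(2) x unfolding ll_iff by metis
  show "\<exists>r>0. \<exists>L\<ge>0. \<forall>y\<in>cball x r \<inter> U. \<forall>z\<in>cball x r \<inter> U. dist (f y, g y) (f z, g z) \<le> L * dist y z"
  proof (intro exI conjI ballI)
    fix y z assume yz: "y \<in> cball x (min r s) \<inter> U" "z \<in> cball x (min r s) \<inter> U"
    have "dist (f y, g y) (f z, g z) \<le> dist (f y) (f z) + dist (g y) (g z)"
      unfolding dist_Pair_Pair by (rule sqrt_sum_squares_le_sum) auto
    also have "\<dots> \<le> L * dist y z + M * dist y z" using yz by (intro add_mono r s) auto
    finally show "dist (f y, g y) (f z, g z) \<le> (L + M) * dist y z" by (simp add: distrib_right)
  qed (use r s in auto)
qed

lemma ll_bilinear:
  fixes p :: "'b::real_normed_vector \<Rightarrow> 'c::real_normed_vector \<Rightarrow> 'd::real_normed_vector"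
  assumes p: "bounded_bilinear p" and f: "locally_lipschitz_on U f" and g: "locally_lipschitz_on U g"
  shows "locally_lipschitz_on U (\<lambda>x. p (f x) (g x))"
proof -
  interpret bounded_bilinear p by fact
  obtain k where k: "\<And>a b. norm (p a b) \<le> norm a * norm b * k" "k \<ge> 0" using nonneg_bounded by blast
  have "locally_lipschitz_on UNIV (\<lambda>z. p (fst z) (snd z))"
    unfolding ll_iff
  proof
    fix x :: "'b \<times> 'c"
    define R where "R = norm x + 1"
    have bd: "norm (fst y) \<le> R" "norm (snd y) \<le> R" if "y \<in> cball x 1 \<inter> UNIV" for y
      using that norm_triangle_ineq2[of y x] norm_fst_le[of "fst y" "snd y"] norm_snd_le[of "snd y" "fst y"]
      by (auto simp: R_def dist_norm norm_minus_commute)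
    show "\<exists>r>0. \<exists>L\<ge>0. \<forall>y\<in>cball x r \<inter> UNIV. \<forall>z\<in>cball x r \<inter> UNIV.
       dist (p (fst y) (snd y)) (p (fst z) (snd z)) \<le> L * dist y z"
    proof (rule exI[of _ 1], rule conjI[OF zero_less_one], rule exI[of _ "2 * R * k"], intro conjI ballI)
      fix y z assume yz: "y \<in> cball x 1 \<inter> UNIV" "z \<in> cball x 1 \<inter> UNIV"
      have n: "norm (fst y - fst z) \<le> dist y z" "norm (snd y - snd z) \<le> dist y z"
        using dist_fst_le[of y z] dist_snd_le[of y z] by (auto simp: dist_norm)
      have "p (fst y) (snd y) - p (fst z) (snd z) = p (fst y - fst z) (snd y) + p (fst z) (snd y - snd z)"
        by (simp add: diff_left diff_right)
      also have "norm \<dots> \<le> norm (fst y - fst z) * norm (snd y) * k + norm (fst z) * norm (snd y - snd z) * k"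
        by (intro norm_triangle_le add_mono k)
      also have "\<dots> \<le> dist y z * R * k + R * dist y z * k"
        using bd[OF yz(1)] bd[OF yz(2)] n k(2) order_trans[OF norm_ge_zero bd(1)[OF yz(1)]]
        by (intro add_mono mult_right_mono mult_mono) auto
      finally show "dist (p (fst y) (snd y)) (p (fst z) (snd z)) \<le> 2 * R * k * dist y z"
        by (simp add: dist_norm mult_ac)
    qed (use k in \<open>auto simp: R_def\<close>)
  qed
  from ll_compose[OF ll_Pair[OF f g] this] show ?thesis by simp
qed

lemma ll_add: "locally_lipschitz_on U f \<Longrightarrow> locally_lipschitz_on U g \<Longrightarrow> locally_lipschitz_on U (\<lambda>x. f x + g x)"
  and ll_diff: "locally_lipschitz_on U f \<Longrightarrow> locally_lipschitz_on U g \<Longrightarrow> locally_lipschitz_on U (\<lambda>x. f x - g x)"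
  for f g :: "_ \<Rightarrow> 'b::real_normed_vector"
proof -
  have "bounded_linear (\<lambda>z::'b \<times> 'b. fst z + snd z)" "bounded_linear (\<lambda>z::'b \<times> 'b. fst z - snd z)"
    by (intro bounded_linear_add bounded_linear_sub bounded_linear_fst bounded_linear_snd)+
  then show "locally_lipschitz_on U f \<Longrightarrow> locally_lipschitz_on U g \<Longrightarrow> locally_lipschitz_on U (\<lambda>x. f x + g x)"
    "locally_lipschitz_on U f \<Longrightarrow> locally_lipschitz_on U g \<Longrightarrow> locally_lipschitz_on U (\<lambda>x. f x - g x)"
    using ll_bounded_linear[OF _ ll_Pair[of U f g]] by fastforce+
qed

lemma ll_minus: "locally_lipschitz_on U f \<Longrightarrow> locally_lipschitz_on U (\<lambda>x. - f x)"
  for f :: "_ \<Rightarrow> 'b::real_normed_vector"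
  by (rule ll_bounded_linear[OF bounded_linear_minus[OF bounded_linear_ident]])

lemma ll_mult: "locally_lipschitz_on U f \<Longrightarrow> locally_lipschitz_on U g \<Longrightarrow> locally_lipschitz_on U (\<lambda>x. f x * g x)"
  for f g :: "_ \<Rightarrow> real"
  by (rule ll_bilinear[OF bounded_bilinear_mult])

lemma ll_power: "locally_lipschitz_on U f \<Longrightarrow> locally_lipschitz_on U (\<lambda>x. f x ^ n)"
  for f :: "_ \<Rightarrow> real"
  by (induction n) (auto intro: ll_const ll_mult)

lemma ll_sum:
  fixes f :: "'i \<Rightarrow> _ \<Rightarrow> 'b::real_normed_vector"
  shows "(\<And>i. i \<in> A \<Longrightarrow> locally_lipschitz_on U (f i)) \<Longrightarrow> locally_lipschitz_on U (\<lambda>x. \<Sum>i\<in>A. f i x)"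
  by (induction A rule: infinite_finite_induct) (auto intro: ll_const ll_add)

lemma ll_nth: "locally_lipschitz_on U f \<Longrightarrow> locally_lipschitz_on U (\<lambda>x. f x $ i)"
  for f :: "_ \<Rightarrow> 'b::real_normed_vector ^ 'n"
  by (rule ll_bounded_linear[OF bounded_linear_vec_nth])

lemma ll_vec:
  fixes f :: "_ \<Rightarrow> 3 \<Rightarrow> 'b::euclidean_space"
  assumes "\<And>i. locally_lipschitz_on U (\<lambda>x. f x i)"
  shows "locally_lipschitz_on U (\<lambda>x. \<chi> i. f x i)"
proof -
  have "linear (axis i :: 'b \<Rightarrow> 'b^3)" for i
    by (auto simp: linear_iff axis_def vec_eq_iff)
  then have "locally_lipschitz_on U (\<lambda>x. \<Sum>i\<in>UNIV. axis i (f x i) :: 'b^3)"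
    using assms by (intro ll_sum ll_bounded_linear[of "axis _"]) (auto simp: linear_conv_bounded_linear)
  moreover have "(\<Sum>i\<in>UNIV. axis i (f x i)) = (\<chi> i. f x i)" for x
    by (simp add: vec_eq_iff sum_3 forall_3 axis_def)
  ultimately show ?thesis by simp
qed

lemma ll_inverse:
  fixes f :: "_ \<Rightarrow> real"
  assumes "locally_lipschitz_on U f" "\<And>x. x \<in> U \<Longrightarrow> f x \<noteq> 0"
  shows "locally_lipschitz_on U (\<lambda>x. inverse (f x))"
proof (rule ll_compose[OF assms(1), of "- {0}"])
  show "locally_lipschitz_on (- {0}) (inverse :: real \<Rightarrow> real)"
    unfolding ll_iff
  proof
    fix x :: real assume "x \<in> - {0}"
    then have x: "\<bar>x\<bar> > 0" by simp
    have big: "\<bar>y\<bar> \<ge> \<bar>x\<bar> / 2" if "y \<in> cball x (\<bar>x\<bar> / 2) \<inter> - {0}" for y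
      using that abs_triangle_ineq2[of x y] by (simp add: dist_real_def)
    show "\<exists>r>0. \<exists>L\<ge>0. \<forall>y\<in>cball x r \<inter> - {0}. \<forall>z\<in>cball x r \<inter> - {0}. dist (inverse y) (inverse z) \<le> L * dist y z"
    proof (rule exI[of _ "\<bar>x\<bar> / 2"], rule conjI, use x in simp, rule exI[of _ "4 / (\<bar>x\<bar> * \<bar>x\<bar>)"], intro conjI ballI)
      fix y z assume yz: "y \<in> cball x (\<bar>x\<bar> / 2) \<inter> - {0}" "z \<in> cball x (\<bar>x\<bar> / 2) \<inter> - {0}"
      have "(\<bar>x\<bar> / 2) * (\<bar>x\<bar> / 2) \<le> \<bar>y\<bar> * \<bar>z\<bar>" using big[OF yz(1)] big[OF yz(2)] by (intro mult_mono) auto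
      then have "\<bar>z - y\<bar> / (\<bar>y\<bar> * \<bar>z\<bar>) \<le> \<bar>z - y\<bar> / ((\<bar>x\<bar> / 2) * (\<bar>x\<bar> / 2))"
        using x by (intro divide_left_mono mult_pos_pos) (use yz in auto)
      moreover have "inverse y - inverse z = (z - y) / (y * z)" using yz by (auto simp: field_simps)
      ultimately show "dist (inverse y) (inverse z) \<le> 4 / (\<bar>x\<bar> * \<bar>x\<bar>) * dist y z"
        by (simp add: dist_real_def abs_mult abs_minus_commute mult.commute)
    qed (use x in auto)
  qed
qed (use assms in auto)

lemma ll_divide: "locally_lipschitz_on U f \<Longrightarrow> locally_lipschitz_on U g \<Longrightarrow> (\<And>x. x \<in> U \<Longrightarrow> g x \<noteq> 0) \<Longrightarrow>
    locally_lipschitz_on U (\<lambda>x. f x / g x)" for f g :: "_ \<Rightarrow> real"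
  unfolding divide_inverse by (intro ll_mult ll_inverse)

lemma ll_sqrt:
  fixes f :: "_ \<Rightarrow> real"
  assumes "locally_lipschitz_on U f" "\<And>x. x \<in> U \<Longrightarrow> f x > 0"
  shows "locally_lipschitz_on U (\<lambda>x. sqrt (f x))"
proof (rule ll_compose[OF assms(1), of "{0<..}"])
  show "locally_lipschitz_on {0<..} sqrt"
    unfolding ll_iff
  proof
    fix x :: real assume "x \<in> {0<..}"
    then have x: "x > 0" by simp
    show "\<exists>r>0. \<exists>L\<ge>0. \<forall>y\<in>cball x r \<inter> {0<..}. \<forall>z\<in>cball x r \<inter> {0<..}. dist (sqrt y) (sqrt z) \<le> L * dist y z"
    proof (rule exI[of _ "x / 2"], rule conjI, use x in simp, rule exI[of _ "1 / sqrt (x / 2)"], intro conjI ballI)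
      fix y z assume yz: "y \<in> cball x (x/2) \<inter> {0<..}" "z \<in> cball x (x/2) \<inter> {0<..}"
      then have "y \<ge> x / 2" "z > 0" "y > 0"
        using abs_ge_self[of "x - y"] by (simp_all add: dist_real_def)
      then have s: "sqrt (x / 2) \<le> sqrt y + sqrt z"
        by (meson add_increasing2 real_sqrt_ge_zero real_sqrt_le_mono less_imp_le)
      have "(sqrt y - sqrt z) * (sqrt y + sqrt z) = y - z" using \<open>z > 0\<close> \<open>y > 0\<close> by (simp add: algebra_simps)
      then have "\<bar>sqrt y - sqrt z\<bar> * (sqrt y + sqrt z) = \<bar>y - z\<bar>"
        using \<open>z > 0\<close> \<open>y > 0\<close> by (metis abs_mult abs_of_nonneg add_nonneg_nonneg less_imp_le real_sqrt_ge_zero)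
      then have "\<bar>sqrt y - sqrt z\<bar> * sqrt (x / 2) \<le> \<bar>y - z\<bar>"
        using mult_left_mono[OF s, of "\<bar>sqrt y - sqrt z\<bar>"] by simp
      then show "dist (sqrt y) (sqrt z) \<le> 1 / sqrt (x / 2) * dist y z"
        using x by (simp add: dist_real_def field_simps)
    qed (use x in auto)
  qed
qed (use assms in auto)

lemmas ll_intros = ll_const ll_add ll_diff ll_minus ll_mult ll_power ll_sum ll_nth ll_vec ll_divide

subsection \<open>Regularity of the vector field\<close>

context
  fixes U :: "'a::metric_space set"
    and g K F :: "'a \<Rightarrow> real^3^3" and E u th0 :: "'a \<Rightarrow> real^3" and th00 rho e :: "'a \<Rightarrow> real"
  assumes ll: "locally_lipschitz_on U g" "locally_lipschitz_on U K" "locally_lipschitz_on U F"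
    "locally_lipschitz_on U E" "locally_lipschitz_on U u" "locally_lipschitz_on U th0"
    "locally_lipschitz_on U th00" "locally_lipschitz_on U rho" "locally_lipschitz_on U e"
    and pd: "\<And>x. x \<in> U \<Longrightarrow> posdef (g x)" and rho_pos: "\<And>x. x \<in> U \<Longrightarrow> rho x > 0"
begin

text \<open>By Cramer's rule the entries of the inverse are rational functions of those of
  \<open>g\<close>.\<close>

lemma ll_gi: "locally_lipschitz_on U (\<lambda>x. gi (g x) i j)"
proof -
  have d: "det (g x) \<noteq> 0" if "x \<in> U" for x using posdef_det_pos[OF pd[OF that]] by simp
  have "locally_lipschitz_on U (\<lambda>x. adj3 (g x) $ i $ j / det (g x))"
    unfolding adj3_def det_eq_traces trace_def matrix_matrix_mult_def
    by (intro ll_intros ll ll_bilinear[OF bounded_bilinear_scaleR])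
      (use d in \<open>simp_all add: det_eq_traces trace_def matrix_matrix_mult_def\<close>)
  then show ?thesis
    by (rule ll_cong) (simp add: gi_def matrix_inv_adj3 d)
qed

lemma uzero_pos: "x \<in> U \<Longrightarrow> uzero (g x) (u x) > 0"
  using pd[of x] unfolding uzero_eq posdef_iff by (cases "u x = 0") (auto intro: add_pos_pos)

lemma ll_uzero: "locally_lipschitz_on U (\<lambda>x. uzero (g x) (u x))"
  unfolding uzero_def
proof (rule ll_sqrt)
  show "0 < 1 + (\<Sum>i\<in>UNIV. \<Sum>j\<in>UNIV. g x $ i $ j * u x $ i * u x $ j)" if "x \<in> U" for x
    using uzero_pos[OF that] by (simp add: uzero_def)
qed (intro ll_intros ll)

lemma nz: "x \<in> U \<Longrightarrow> uzero (g x) (u x) \<noteq> 0" "x \<in> U \<Longrightarrow> rho x \<noteq> 0"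
  using uzero_pos rho_pos by force+

lemma ll_gam: "locally_lipschitz_on U (\<lambda>x. gam C (g x) l i j)"
  unfolding gam_def by (intro ll_intros ll ll_gi)

lemma ll_Ric: "locally_lipschitz_on U (\<lambda>x. Ric C (g x) i j)"
  unfolding Ric_def by (intro ll_intros ll_gam)

lemma ll_H: "locally_lipschitz_on U (\<lambda>x. Hmean (g x) (K x))"
  unfolding Hmean_def by (intro ll_intros ll ll_gi)

lemma ll_Kmix: "locally_lipschitz_on U (\<lambda>x. Kmix (g x) (K x) i j)"
  unfolding Kmix_def by (intro ll_intros ll ll_gi)

lemma ll_rhs:
  "locally_lipschitz_on U (\<lambda>x. rhs_g (K x))"
  "locally_lipschitz_on U (\<lambda>x. rhs_K C \<Lambda> (g x) (K x) (F x) (E x) (u x) (th00 x) (rho x))"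
  "locally_lipschitz_on U (\<lambda>x. rhs_F C (g x) (E x))"
  "locally_lipschitz_on U (\<lambda>x. rhs_E C (g x) (K x) (F x) (E x) (u x))"
  "locally_lipschitz_on U (\<lambda>x. rhs_u C (g x) (K x) (F x) (E x) (u x) (rho x))"
  "locally_lipschitz_on U (\<lambda>x. rhs_th00 C (g x) (K x) (u x) (th00 x) (th0 x) (rho x))"
  "locally_lipschitz_on U (\<lambda>x. rhs_th0 C (g x) (K x) (u x) (th0 x) (rho x))"
  "locally_lipschitz_on U (\<lambda>x. rhs_rho C (g x) (K x) (E x) (u x) (rho x))"
  "locally_lipschitz_on U (\<lambda>x. rhs_e C (g x) (K x) (E x) (u x) (rho x) (e x))"
  unfolding rhs_g_def rhs_K_def rhs_F_def rhs_E_def rhs_u_def rhs_th00_def rhs_th0_def rhs_rho_def rhs_e_def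
    tauij_def Tij_def T00_def ulow_def
  by (intro ll_intros ll ll_gi ll_uzero ll_gam ll_Ric ll_H ll_Kmix; (simp add: nz)?)+

end

subsection \<open>The evolution system as an autonomous equation\<close>

text \<open>Symmetry of \<open>g\<close>, \<open>K\<close> and antisymmetry of \<open>F\<close> do not cut out an open set of matrices, so the
  vector field is precomposed with the projection \<open>state_proj\<close> onto the admissible states; by
  uniqueness solutions starting at admissible states stay admissible.\<close>

type_synonym ebs_state = "(real^3^3) \<times> (real^3^3) \<times> (real^3^3) \<times> (real^3) \<times> (real^3) \<times> real \<times> (real^3) \<times> real \<times> real"

lemma ebs_state_cases:
  obtains g K F E u th00 th0 rho e where "x = ((g, K, F, E, u, th00, th0, rho, e) :: ebs_state)"
proof -
  obtain g K F E u y where "x = (g, K, F, E, u, y)" by (cases x rule: prod_cases6) blast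
  moreover obtain th00 th0 rho e where "y = (th00, th0, rho, e)" by (cases y rule: prod_cases4) blast
  ultimately show ?thesis using that by blast
qed

definition sym_part :: "real^3^3 \<Rightarrow> real^3^3" where
  "sym_part M = (1/2) *\<^sub>R (M + transpose M)"

definition antisym_part :: "real^3^3 \<Rightarrow> real^3^3" where
  "antisym_part M = (1/2) *\<^sub>R (M - transpose M)"

definition state_proj :: "ebs_state \<Rightarrow> ebs_state" where
  "state_proj = (\<lambda>(g, K, F, E, u, th00, th0, rho, e).
     (sym_part g, sym_part K, antisym_part F, E, u, th00, th0, rho, e))"

definition raw_field :: "sconst \<Rightarrow> real \<Rightarrow> ebs_state \<Rightarrow> ebs_state" where
  "raw_field C \<Lambda> = (\<lambda>(g, K, F, E, u, th00, th0, rho, e).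
     (rhs_g K, rhs_K C \<Lambda> g K F E u th00 rho, rhs_F C g E, rhs_E C g K F E u, rhs_u C g K F E u rho,
      rhs_th00 C g K u th00 th0 rho, rhs_th0 C g K u th0 rho, rhs_rho C g K E u rho, rhs_e C g K E u rho e))"

definition ebs_field :: "sconst \<Rightarrow> real \<Rightarrow> ebs_state \<Rightarrow> ebs_state" where
  "ebs_field C \<Lambda> x = raw_field C \<Lambda> (state_proj x)"

text \<open>Positivity of the form is required without symmetry, and no sign is required of
  \<open>e\<close>, in order to have an open set; both properties are recovered in
  \<open>ode_solution_imp_solves_S\<close>.\<close>

definition ebs_dom :: "ebs_state set" where
  "ebs_dom = {(g, K, F, E, u, th00, th0, rho, e). (\<forall>y. y \<noteq> 0 \<longrightarrow> y \<bullet> (g *v y) > 0) \<and> rho > 0}"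

lemma sym_part_sym: "transpose (sym_part M) = sym_part M"
  by (simp add: sym_part_def mat_linear add.commute)

lemma sym_part_id: "transpose M = M \<Longrightarrow> sym_part M = M"
  by (simp add: sym_part_def scaleR_2[symmetric])

lemma antisym_part_antisym: "transpose (antisym_part M) = - antisym_part M"
  by (simp add: antisym_part_def mat_linear scaleR_diff_right)

lemma antisym_part_id: "transpose M = - M \<Longrightarrow> antisym_part M = M"
  by (simp add: antisym_part_def scaleR_2[symmetric])

lemma sym_part_form: "y \<bullet> (sym_part M *v y) = y \<bullet> (M *v y)"
proof -
  have "y \<bullet> (transpose M *v y) = y \<bullet> (M *v y)" by (simp add: dot_transpose' inner_commute)
  then show ?thesis by (simp add: sym_part_def mat_linear inner_add_right)
qed

lemma linear_state_proj: "linear state_proj"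
  unfolding linear_iff state_proj_def sym_part_def antisym_part_def
  by (auto simp: mat_linear vec_eq_iff algebra_simps)

lemma state_proj_idem: "state_proj (state_proj x) = state_proj x"
  by (cases x rule: ebs_state_cases)
    (simp add: state_proj_def sym_part_id sym_part_sym antisym_part_id antisym_part_antisym)

lemma state_proj_dom: "x \<in> ebs_dom \<Longrightarrow> state_proj x \<in> ebs_dom"
  by (cases x rule: ebs_state_cases) (simp add: state_proj_def ebs_dom_def sym_part_form)

lemma open_ebs_dom: "open ebs_dom"
proof -
  let ?V = "{M :: real^3^3. \<forall>y. y \<noteq> 0 \<longrightarrow> y \<bullet> (M *v y) > 0}"
  obtain k where k: "k > 0" "\<And>A x. norm ((A::real^3^3) *v x) \<le> norm A * norm x * k"
    using mv_norm_bound by blast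
  have "open ?V"
    unfolding open_contains_ball
  proof
    fix M assume "M \<in> ?V"
    then have "posdef (sym_part M)" unfolding posdef_iff by (simp add: sym_part_sym sym_part_form)
    then obtain l where l: "l > 0" "\<And>x. l * (x \<bullet> x) \<le> x \<bullet> (M *v x)"
      using posdef_lower_bound[of "sym_part M"] by (auto simp: sym_part_form)
    \<comment> \<open>A perturbation smaller than \<open>l / k\<close> changes the form by less than
      \<open>l * (y . y)\<close>.\<close>
    have "ball M (l / k) \<subseteq> ?V"
    proof (intro subsetI CollectI allI impI)
      fix N y assume N: "N \<in> ball M (l / k)" and y: "y \<noteq> (0 :: real^3)"
      have "\<bar>y \<bullet> ((M - N) *v y)\<bar> \<le> norm y * (norm (M - N) * norm y * k)"
        by (intro order_trans[OF Cauchy_Schwarz_ineq2] mult_left_mono k) auto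
      also have "\<dots> = norm (M - N) * k * (y \<bullet> y)"
        by (simp add: power2_norm_eq_inner[symmetric] power2_eq_square)
      also have "\<dots> < l * (y \<bullet> y)"
        using N k y by (intro mult_strict_right_mono) (auto simp: dist_norm field_simps)
      finally show "y \<bullet> (N *v y) > 0"
        using l(2)[of y] by (simp add: mat_linear inner_diff_right abs_less_iff)
    qed
    then show "\<exists>e>0. ball M e \<subseteq> ?V" using l k by (intro exI[of _ "l / k"]) auto
  qed
  then have "open (?V \<times> (UNIV \<times> UNIV \<times> UNIV \<times> UNIV \<times> UNIV \<times> UNIV \<times> {0<..} \<times> UNIV) :: ebs_state set)"
    by (intro open_Times) auto
  moreover have "ebs_dom = ?V \<times> (UNIV \<times> UNIV \<times> UNIV \<times> UNIV \<times> UNIV \<times> UNIV \<times> {0<..} \<times> UNIV)"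
    unfolding ebs_dom_def by auto
  ultimately show ?thesis by simp
qed

lemma ebs_field_lipschitz: "locally_lipschitz_on ebs_dom (ebs_field C \<Lambda>)"
proof -
  define c1 c2 c3 c4 c5 c6 c7 c8 c9 where
    "c1 = (\<lambda>x::ebs_state. sym_part (fst x))" and
    "c2 = (\<lambda>x::ebs_state. sym_part (fst (snd x)))" and
    "c3 = (\<lambda>x::ebs_state. antisym_part (fst (snd (snd x))))" and
    "c4 = (\<lambda>x::ebs_state. fst (snd (snd (snd x))))" and
    "c5 = (\<lambda>x::ebs_state. fst (snd (snd (snd (snd x)))))" and
    "c6 = (\<lambda>x::ebs_state. fst (snd (snd (snd (snd (snd x))))))" and
    "c7 = (\<lambda>x::ebs_state. fst (snd (snd (snd (snd (snd (snd x)))))))" and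
    "c8 = (\<lambda>x::ebs_state. fst (snd (snd (snd (snd (snd (snd (snd x))))))))" and
    "c9 = (\<lambda>x::ebs_state. snd (snd (snd (snd (snd (snd (snd (snd x))))))))"
  note c_defs = c1_def c2_def c3_def c4_def c5_def c6_def c7_def c8_def c9_def
  have id: "locally_lipschitz_on ebs_dom (\<lambda>x. x)"
    unfolding ll_iff by (auto intro!: exI[of _ 1])
  have s: "bounded_linear sym_part" "bounded_linear antisym_part"
    unfolding linear_conv_bounded_linear[symmetric] sym_part_def antisym_part_def
    by (simp_all add: linear_iff mat_linear vec_eq_iff algebra_simps)
  have ll: "locally_lipschitz_on ebs_dom c1" "locally_lipschitz_on ebs_dom c2" "locally_lipschitz_on ebs_dom c3"
    "locally_lipschitz_on ebs_dom c4" "locally_lipschitz_on ebs_dom c5" "locally_lipschitz_on ebs_dom c6"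
    "locally_lipschitz_on ebs_dom c7" "locally_lipschitz_on ebs_dom c8" "locally_lipschitz_on ebs_dom c9"
    unfolding c_defs
    by (intro ll_bounded_linear[OF s(1)] ll_bounded_linear[OF s(2)] ll_bounded_linear[OF bounded_linear_fst]
        ll_bounded_linear[OF bounded_linear_snd] id)+
  have pd: "posdef (c1 x)" "c8 x > 0" if "x \<in> ebs_dom" for x
    using that unfolding c_defs by (cases x rule: ebs_state_cases; simp add: ebs_dom_def posdef_iff sym_part_sym sym_part_form)+
  note r = ll_rhs[OF ll(1,2,3,4,5,7,6,8,9) pd]
  have "locally_lipschitz_on ebs_dom (\<lambda>x. (rhs_g (c2 x), rhs_K C \<Lambda> (c1 x) (c2 x) (c3 x) (c4 x) (c5 x) (c6 x) (c8 x),
      rhs_F C (c1 x) (c4 x), rhs_E C (c1 x) (c2 x) (c3 x) (c4 x) (c5 x),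
      rhs_u C (c1 x) (c2 x) (c3 x) (c4 x) (c5 x) (c8 x),
      rhs_th00 C (c1 x) (c2 x) (c5 x) (c6 x) (c7 x) (c8 x), rhs_th0 C (c1 x) (c2 x) (c5 x) (c7 x) (c8 x),
      rhs_rho C (c1 x) (c2 x) (c4 x) (c5 x) (c8 x), rhs_e C (c1 x) (c2 x) (c4 x) (c5 x) (c8 x) (c9 x)))"
    by (intro ll_Pair r)
  then show ?thesis
  proof (rule ll_cong)
    fix x :: ebs_state
    show "(rhs_g (c2 x), rhs_K C \<Lambda> (c1 x) (c2 x) (c3 x) (c4 x) (c5 x) (c6 x) (c8 x),
      rhs_F C (c1 x) (c4 x), rhs_E C (c1 x) (c2 x) (c3 x) (c4 x) (c5 x),
      rhs_u C (c1 x) (c2 x) (c3 x) (c4 x) (c5 x) (c8 x),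
      rhs_th00 C (c1 x) (c2 x) (c5 x) (c6 x) (c7 x) (c8 x), rhs_th0 C (c1 x) (c2 x) (c5 x) (c7 x) (c8 x),
      rhs_rho C (c1 x) (c2 x) (c4 x) (c5 x) (c8 x), rhs_e C (c1 x) (c2 x) (c4 x) (c5 x) (c8 x) (c9 x)) = ebs_field C \<Lambda> x"
      by (cases x rule: ebs_state_cases) (simp add: ebs_field_def raw_field_def state_proj_def c_defs)
  qed
qed

text \<open>The field is tangent to the linear space of admissible states, so projecting a solution
  gives a solution again.\<close>

lemma ebs_field_admissible:
  assumes lie: "lie_structure C" and x: "x \<in> ebs_dom"
  shows "state_proj (ebs_field C \<Lambda> x) = ebs_field C \<Lambda> x"
proof -
  obtain g K F E u th00 th0 rho e where xx: "x = (g, K, F, E, u, th00, th0, rho, e)"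
    by (cases x rule: ebs_state_cases)
  define g1 K1 F1 where d: "g1 = sym_part g" "K1 = sym_part K" "F1 = antisym_part F"
  have pd: "posdef g1" using x by (simp add: xx d ebs_dom_def posdef_iff sym_part_sym sym_part_form)
  have K1: "symm K1" "transpose K1 = K1" by (simp_all add: d symm_iff_transpose sym_part_sym)
  have "antisymm F1" by (simp add: d antisymm_iff_transpose antisym_part_antisym)
  then obtain f1 where F1: "F1 = sk f1" using sk_axial by metis
  have "transpose (rhs_g K1) = rhs_g K1" by (simp add: rhs_g_eq mat_linear K1)
  moreover have "transpose (rhs_K C \<Lambda> g1 K1 F1 E u th00 rho) = rhs_K C \<Lambda> g1 K1 F1 E u th00 rho"
    unfolding F1 rhs_K_eq[OF pd refl K1(1)]
    by (simp add: mat_linear matrix_transpose_mul K1 metric_sym[OF pd] Ric_mat_sym[OF lie pd]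
        stress_sym[OF pd refl] matrix_mul_assoc)
  moreover have "transpose (rhs_F C g1 E) = - rhs_F C g1 E"
    by (simp add: rhs_F_eq[OF lie pd] mat_linear transpose_sk)
  ultimately show ?thesis
    by (simp add: xx ebs_field_def raw_field_def state_proj_def d[symmetric] sym_part_id antisym_part_id)
qed

lemma solves_S_imp_ode_solution:
  assumes sol: "solves_S C \<Lambda> I g K F E u th00 th0 rho e"
    and init: "init_data g K F E u th00 th0 rho e g0 K0 F0 E0 U0 th00i th0i rho0 e0"
  shows "ode_solution (ebs_field C \<Lambda>) ebs_dom (g0, K0, F0, E0, U0, th00i, th0i, rho0, e0) I
    (\<lambda>t. (g t, K t, F t, E t, u t, th00 t, th0 t, rho t, e t))"
  unfolding ode_solution_def
proof (intro conjI ballI)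
  show "(g 0, K 0, F 0, E 0, u 0, th00 0, th0 0, rho 0, e 0) = (g0, K0, F0, E0, U0, th00i, th0i, rho0, e0)"
    using init by (simp add: init_data_def)
  fix t assume t: "t \<in> I"
  note s = sol[unfolded solves_S_def, rule_format, OF t]
  show "(g t, K t, F t, E t, u t, th00 t, th0 t, rho t, e t) \<in> ebs_dom"
    using s by (simp add: ebs_dom_def posdef_iff)
  have "state_proj (g t, K t, F t, E t, u t, th00 t, th0 t, rho t, e t) = (g t, K t, F t, E t, u t, th00 t, th0 t, rho t, e t)"
    using s by (simp add: state_proj_def posdef_iff symm_iff_transpose antisymm_iff_transpose sym_part_id antisym_part_id)
  then show "((\<lambda>t. (g t, K t, F t, E t, u t, th00 t, th0 t, rho t, e t)) has_vector_derivative
      ebs_field C \<Lambda> (g t, K t, F t, E t, u t, th00 t, th0 t, rho t, e t)) (at t within I)"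
    using s by (simp add: ebs_field_def raw_field_def has_vector_derivative_Pair)
qed

text \<open>A negative value would be preceded by a zero, and from a zero Gronwall makes
  \<open>q\<close> vanish on the whole of \<open>{0..t}\<close>.\<close>

lemma linear_homogeneous_nonneg:
  fixes q c :: "real \<Rightarrow> real"
  assumes I: "is_interval I" "0 \<in> I" and d: "\<And>t. t \<in> I \<Longrightarrow> (q has_vector_derivative c t * q t) (at t within I)"
    and c: "continuous_on I c" and q0: "q 0 \<ge> 0" and t: "t \<in> I" "t \<ge> 0"
  shows "q t \<ge> 0"
proof (rule ccontr)
  assume neg: "\<not> 0 \<le> q t"
  have sub: "{0..t} \<subseteq> I" using I t unfolding is_interval_1 by (meson atLeastAtMost_iff subsetI)
  have d': "(q has_vector_derivative c s * q s) (at s within {0..t})" if "s \<in> {0..t}" for s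
    using d sub that by (meson has_vector_derivative_within_subset subsetD)
  have "continuous_on {0..t} q"
    unfolding continuous_on_eq_continuous_within using d' has_vector_derivative_continuous by blast
  then obtain s where s: "0 \<le> s" "s \<le> t" "q s = 0"
    using IVT2'[of q t 0 0] neg q0 t by auto
  have "bounded (c ` {0..t})"
    by (intro compact_imp_bounded compact_continuous_image continuous_on_subset[OF c sub]) auto
  then obtain k where k: "\<And>s. s \<in> {0..t} \<Longrightarrow> \<bar>c s\<bar> \<le> k" unfolding bounded_iff real_norm_def by blast
  have "q t * q t = 0"
  proof (rule gronwall_zero[of "{0..t}" "\<lambda>t. q t * q t" "\<lambda>t. 2 * (c t * (q t * q t))" "2 * k" s])
    fix s assume s: "s \<in> {0..t}"
    from bounded_bilinear.has_vector_derivative[OF bounded_bilinear_mult d'[OF s] d'[OF s]]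
    show "((\<lambda>t. q t * q t) has_vector_derivative 2 * (c s * (q s * q s))) (at s within {0..t})"
      by (simp add: mult.commute mult.left_commute)
    have "\<bar>c s\<bar> * (q s * q s) \<le> k * (q s * q s)" by (intro mult_right_mono k s) simp
    then show "\<bar>2 * (c s * (q s * q s))\<bar> \<le> 2 * k * (q s * q s)" by (simp add: abs_mult)
  qed (use t s in \<open>auto simp: is_interval_cc\<close>)
  then show False using neg by simp
qed

lemma ode_solution_imp_solves_S:
  fixes x :: "real \<Rightarrow> ebs_state"
  assumes lie: "lie_structure C" and I: "is_interval I" "0 \<in> I" "I \<subseteq> {0..}"
    and adm: "posdef g0" "symm K0" "antisymm F0" "rho0 > 0" "e0 \<ge> 0"
    and x: "ode_solution (ebs_field C \<Lambda>) ebs_dom (g0, K0, F0, E0, U0, th00i, th0i, rho0, e0) I x"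
  obtains g K F E u th00 th0 rho e where "x = (\<lambda>t. (g t, K t, F t, E t, u t, th00 t, th0 t, rho t, e t))"
    "solves_S C \<Lambda> I g K F E u th00 th0 rho e"
    "init_data g K F E u th00 th0 rho e g0 K0 F0 E0 U0 th00i th0i rho0 e0"
proof -
  define x0 :: ebs_state where "x0 = (g0, K0, F0, E0, U0, th00i, th0i, rho0, e0)"
  note xs = x[folded x0_def, unfolded ode_solution_def]
  have x0: "state_proj x0 = x0"
    using adm by (simp add: x0_def state_proj_def posdef_iff symm_iff_transpose antisymm_iff_transpose sym_part_id antisym_part_id)
  \<comment> \<open>The projected curve solves the same initial value problem; uniqueness then shows
    that \<open>x\<close> consists of admissible states.\<close>
  have ps: "ode_solution (ebs_field C \<Lambda>) ebs_dom x0 I (\<lambda>t. state_proj (x t))"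
    unfolding ode_solution_def
  proof (intro conjI ballI)
    show "state_proj (x 0) = x0" using xs x0 by simp
    fix t assume t: "t \<in> I"
    show "state_proj (x t) \<in> ebs_dom" using xs t state_proj_dom by blast
    have "((\<lambda>t. state_proj (x t)) has_vector_derivative state_proj (ebs_field C \<Lambda> (x t))) (at t within I)"
      by (rule bounded_linear.has_vector_derivative) (use linear_state_proj xs t in \<open>auto simp: linear_conv_bounded_linear\<close>)
    moreover have "state_proj (ebs_field C \<Lambda> (x t)) = ebs_field C \<Lambda> (x t)"
      using ebs_field_admissible[OF lie] xs t by blast
    ultimately show "((\<lambda>t. state_proj (x t)) has_vector_derivative ebs_field C \<Lambda> (state_proj (x t))) (at t within I)"
      by (simp add: ebs_field_def state_proj_idem)
  qed
  have xp: "state_proj (x t) = x t" if "t \<in> I" for t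
    by (rule ode_solution_unique[OF ebs_field_lipschitz open_ebs_dom I(1,2) ps x[folded x0_def] that])
  define g K F E u th00 th0 rho e where
    "g = (\<lambda>t. fst (x t))" and
    "K = (\<lambda>t. fst (snd (x t)))" and
    "F = (\<lambda>t. fst (snd (snd (x t))))" and
    "E = (\<lambda>t. fst (snd (snd (snd (x t)))))" and
    "u = (\<lambda>t. fst (snd (snd (snd (snd (x t))))))" and
    "th00 = (\<lambda>t. fst (snd (snd (snd (snd (snd (x t)))))))" and
    "th0 = (\<lambda>t. fst (snd (snd (snd (snd (snd (snd (x t))))))))" and
    "rho = (\<lambda>t. fst (snd (snd (snd (snd (snd (snd (snd (x t)))))))))" and
    "e = (\<lambda>t. snd (snd (snd (snd (snd (snd (snd (snd (x t)))))))))"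
  note c_defs = g_def K_def F_def E_def u_def th00_def th0_def rho_def e_def
  have xt: "x t = (g t, K t, F t, E t, u t, th00 t, th0 t, rho t, e t)" for t
    by (simp add: c_defs)
  have adm_t: "posdef (g t)" "symm (K t)" "antisymm (F t)" "rho t > 0" if t: "t \<in> I" for t
  proof -
    have "x t \<in> ebs_dom" using xs t by blast
    then have 1: "\<forall>y. y \<noteq> 0 \<longrightarrow> y \<bullet> (g t *v y) > 0" "rho t > 0" unfolding xt ebs_dom_def by auto
    have "sym_part (g t) = g t" "sym_part (K t) = K t" "antisym_part (F t) = F t"
      using xp[OF t] unfolding xt state_proj_def by auto
    then have "transpose (g t) = g t" "transpose (K t) = K t" "transpose (F t) = - F t"
      using sym_part_sym[of "g t"] sym_part_sym[of "K t"] antisym_part_antisym[of "F t"] by simp_all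
    then show "posdef (g t)" "symm (K t)" "antisymm (F t)" "rho t > 0"
      using 1 by (auto simp: posdef_iff symm_iff_transpose antisymm_iff_transpose)
  qed
  have dx: "(x has_vector_derivative raw_field C \<Lambda> (g t, K t, F t, E t, u t, th00 t, th0 t, rho t, e t)) (at t within I)"
    if t: "t \<in> I" for t
  proof -
    have "ebs_field C \<Lambda> (x t) = raw_field C \<Lambda> (x t)" using xp[OF t] by (simp add: ebs_field_def)
    moreover have "(x has_vector_derivative ebs_field C \<Lambda> (x t)) (at t within I)" using xs t by blast
    ultimately show ?thesis unfolding xt[symmetric] by simp
  qed
  note fs = bounded_linear.has_vector_derivative[OF bounded_linear_fst]
    and sn = bounded_linear.has_vector_derivative[OF bounded_linear_snd]
  have ds: "(g has_vector_derivative rhs_g (K t)) (at t within I)"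
    "(K has_vector_derivative rhs_K C \<Lambda> (g t) (K t) (F t) (E t) (u t) (th00 t) (rho t)) (at t within I)"
    "(F has_vector_derivative rhs_F C (g t) (E t)) (at t within I)"
    "(E has_vector_derivative rhs_E C (g t) (K t) (F t) (E t) (u t)) (at t within I)"
    "(u has_vector_derivative rhs_u C (g t) (K t) (F t) (E t) (u t) (rho t)) (at t within I)"
    "(th00 has_vector_derivative rhs_th00 C (g t) (K t) (u t) (th00 t) (th0 t) (rho t)) (at t within I)"
    "(th0 has_vector_derivative rhs_th0 C (g t) (K t) (u t) (th0 t) (rho t)) (at t within I)"
    "(rho has_vector_derivative rhs_rho C (g t) (K t) (E t) (u t) (rho t)) (at t within I)"
    "(e has_vector_derivative rhs_e C (g t) (K t) (E t) (u t) (rho t) (e t)) (at t within I)"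
    if t: "t \<in> I" for t
  proof -
    note 1 = dx[OF t]
    note 2 = sn[OF 1] note 3 = sn[OF 2] note 4 = sn[OF 3] note 5 = sn[OF 4] note 6 = sn[OF 5]
    note 7 = sn[OF 6] note 8 = sn[OF 7]
    note all = fs[OF 1] fs[OF 2] fs[OF 3] fs[OF 4] fs[OF 5] fs[OF 6] fs[OF 7] fs[OF 8] sn[OF 8]
    show "(g has_vector_derivative rhs_g (K t)) (at t within I)"
      "(K has_vector_derivative rhs_K C \<Lambda> (g t) (K t) (F t) (E t) (u t) (th00 t) (rho t)) (at t within I)"
      "(F has_vector_derivative rhs_F C (g t) (E t)) (at t within I)"
      "(E has_vector_derivative rhs_E C (g t) (K t) (F t) (E t) (u t)) (at t within I)"
      "(u has_vector_derivative rhs_u C (g t) (K t) (F t) (E t) (u t) (rho t)) (at t within I)"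
      "(th00 has_vector_derivative rhs_th00 C (g t) (K t) (u t) (th00 t) (th0 t) (rho t)) (at t within I)"
      "(th0 has_vector_derivative rhs_th0 C (g t) (K t) (u t) (th0 t) (rho t)) (at t within I)"
      "(rho has_vector_derivative rhs_rho C (g t) (K t) (E t) (u t) (rho t)) (at t within I)"
      "(e has_vector_derivative rhs_e C (g t) (K t) (E t) (u t) (rho t) (e t)) (at t within I)"
      using all unfolding raw_field_def c_defs[symmetric] by simp_all
  qed
  have cont: "continuous_on I x"
    unfolding continuous_on_eq_continuous_within using dx has_vector_derivative_continuous by blast
  have e_nonneg: "e t \<ge> 0" if t: "t \<in> I" for t
  proof (rule linear_homogeneous_nonneg[OF I(1,2) _ _ _ t])
    \<comment> \<open>The quadratic term of the equation for \<open>e\<close> is written as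
      \<open>e\<close> times a coefficient containing \<open>e / rho\<close>; along the given
      solution the equation is then linear and homogeneous.\<close>
    let ?c = "\<lambda>t. - ((\<Sum>i\<in>UNIV. \<Sum>j\<in>UNIV. K t $ i $ j * u t $ i * u t $ j) / (uzero (g t) (u t))\<^sup>2
         + (\<Sum>i\<in>UNIV. \<Sum>k\<in>UNIV. C i i k * u t $ k) / uzero (g t) (u t) - Hmean (g t) (K t))
      + 3/4 * (\<Sum>i\<in>UNIV. \<Sum>j\<in>UNIV. g t $ i $ j * u t $ i * E t $ j) / (uzero (g t) (u t))\<^sup>2 * e t / rho t"
    show "(e has_vector_derivative ?c s * e s) (at s within I)" if s: "s \<in> I" for s
      by (rule has_vector_derivative_eq_rhs[OF ds(9)[OF s]])
        (use adm_t(4)[OF s] in \<open>simp add: rhs_e_def algebra_simps power2_eq_square\<close>)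
    have c9: "continuous_on I g" "continuous_on I K" "continuous_on I E" "continuous_on I u" "continuous_on I rho" "continuous_on I e"
      unfolding c_defs by (intro continuous_intros cont)+
    have "uzero (g s) (u s) > 0" if "s \<in> I" for s
      using adm_t(1)[OF that] unfolding uzero_eq posdef_iff by (cases "u s = 0") (auto intro: add_pos_pos)
    then have nz: "\<forall>s\<in>I. uzero (g s) (u s) \<noteq> 0" "\<forall>s\<in>I. rho s \<noteq> 0" using adm_t(4) by force+
    have cu: "continuous_on I (\<lambda>s. uzero (g s) (u s))"
      unfolding uzero_def by (intro continuous_intros c9)
    have cgi: "continuous_on I (\<lambda>s. gi (g s) i j)" for i j
    proof -
      have d: "det (g s) \<noteq> 0" if "s \<in> I" for s using posdef_det_pos[OF adm_t(1)[OF that]] by simp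
      have "continuous_on I (\<lambda>s. adj3 (g s) $ i $ j / det (g s))"
        unfolding adj3_def det_3 trace_def matrix_matrix_mult_def
        using d by (intro continuous_intros c9) (auto simp: det_3)
      then show ?thesis
        by (rule continuous_on_eq) (simp add: gi_def matrix_inv_adj3 d)
    qed
    show "continuous_on I ?c"
      unfolding Hmean_def using nz by (intro continuous_intros c9 cu cgi) auto
    show "e 0 \<ge> 0" using xs adm(5) xt[of 0] by (simp add: x0_def)
    show "t \<ge> 0" using I(3) t by auto
  qed
  have "solves_S C \<Lambda> I g K F E u th00 th0 rho e"
    unfolding solves_S_def using adm_t ds e_nonneg by blast
  moreover have "init_data g K F E u th00 th0 rho e g0 K0 F0 E0 U0 th00i th0i rho0 e0"
    using xs xt[of 0] by (simp add: init_data_def x0_def)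
  moreover have "x = (\<lambda>t. (g t, K t, F t, E t, u t, th00 t, th0 t, rho t, e t))"
    using xt by (simp add: fun_eq_iff)
  ultimately show ?thesis using that by blast
qed

text \<open>The assumption \<open>model\<close> ranges over all solutions with the given data on
  bounded intervals, because the a priori bounds must hold for every such solution before the global
  one exists.\<close>

theorem theorem5p1:
  fixes C :: sconst and \<Lambda> :: real
    and g0 K0 F0 :: "real^3^3" and E0 U0 th0i :: "real^3"
    and th00i rho0 e0 :: real
  assumes bianchi: "bianchi_I_to_VIII C"
    and Lpos: "\<Lambda> > 0"
    and g0: "posdef g0" and K0: "symm K0" and F0: "antisymm F0"
    and rho0: "rho0 > 0" and e0: "e0 \<ge> 0"
    and constr: "constraints C \<Lambda> g0 K0 F0 E0 U0 th00i th0i rho0 e0"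
    and H0: "Hmean g0 K0 < 0"
    and model: "\<And>T g K F E u th00 th0 rho e.
        T > 0 \<Longrightarrow> solves_S C \<Lambda> {0..<T} g K F E u th00 th0 rho e \<Longrightarrow>
        init_data g K F E u th00 th0 rho e g0 K0 F0 E0 U0 th00i th0i rho0 e0 \<Longrightarrow>
        \<forall>t\<in>{0..<T}. th00 t \<ge> 0"
  shows "\<exists>g K F E u th00 th0 rho e.
           solves_S C \<Lambda> {0..} g K F E u th00 th0 rho e \<and>
           init_data g K F E u th00 th0 rho e g0 K0 F0 E0 U0 th00i th0i rho0 e0 \<and>
           (\<forall>g' K' F' E' u' th00' th0' rho' e'.
              solves_S C \<Lambda> {0..} g' K' F' E' u' th00' th0' rho' e' \<and>
              init_data g' K' F' E' u' th00' th0' rho' e' g0 K0 F0 E0 U0 th00i th0i rho0 e0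
              \<longrightarrow> (\<forall>t\<ge>0. g' t = g t \<and> K' t = K t \<and> F' t = F t \<and> E' t = E t \<and> u' t = u t \<and>
                          th00' t = th00 t \<and> th0' t = th0 t \<and> rho' t = rho t \<and> e' t = e t))"
proof -
  have lie: "lie_structure C" and nIX: "\<not> bianchi_IX C" using bianchi by (auto simp: bianchi_I_to_VIII_def)
  define x0 :: ebs_state where "x0 = (g0, K0, F0, E0, U0, th00i, th0i, rho0, e0)"
  have x0: "x0 \<in> ebs_dom" using g0 rho0 by (simp add: x0_def ebs_dom_def posdef_iff)
  have "\<exists>x. ode_solution (ebs_field C \<Lambda>) ebs_dom x0 {0..} x"
  proof (rule ode_solution_global[OF ebs_field_lipschitz open_ebs_dom x0])
    fix T x assume T: "(T::real) > 0" and x: "ode_solution (ebs_field C \<Lambda>) ebs_dom x0 {0..<T} x"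
    obtain g K F E u th00 th0 rho e where xt: "x = (\<lambda>t. (g t, K t, F t, E t, u t, th00 t, th0 t, rho t, e t))"
      and sol: "solves_S C \<Lambda> {0..<T} g K F E u th00 th0 rho e"
      and init: "init_data g K F E u th00 th0 rho e g0 K0 F0 E0 U0 th00i th0i rho0 e0"
      by (rule ode_solution_imp_solves_S[OF lie _ _ _ g0 K0 F0 rho0 e0 x[unfolded x0_def]])
        (use T in \<open>auto simp: is_interval_co\<close>)
    interpret ebs_data C \<Lambda> T g K F E u th00 th0 rho e
      by unfold_locales
        (use lie nIX T Lpos sol init constr H0 model[OF T sol init] in \<open>auto simp: init_data_def\<close>)
    obtain l r where l: "l > 0" and r: "r > 0"
      and lo: "\<And>t y. t \<in> {0..<T} \<Longrightarrow> l * (y \<bullet> y) \<le> y \<bullet> (g t *v y)" "\<And>t. t \<in> {0..<T} \<Longrightarrow> r \<le> rho t"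
      and bd: "bounded (g ` {0..<T})" "bounded (K ` {0..<T})" "bounded (F ` {0..<T})" "bounded (E ` {0..<T})"
        "bounded (u ` {0..<T})" "bounded (th00 ` {0..<T})" "bounded (th0 ` {0..<T})" "bounded (rho ` {0..<T})" "bounded (e ` {0..<T})"
      using apriori_bounds by blast
    \<comment> \<open>The bounds with the margins \<open>l\<close> and \<open>r\<close> are closed
      conditions, so they pass to the closure of the trajectory and keep it inside the open
      domain.\<close>
    let ?S = "{z :: ebs_state. (\<forall>y. l * (y \<bullet> y) \<le> y \<bullet> (fst z *v y)) \<and> r \<le> fst (snd (snd (snd (snd (snd (snd (snd z)))))))}"
    have "bounded (x ` {0..<T})"
    proof (rule bounded_subset)
      show "bounded (g ` {0..<T} \<times> K ` {0..<T} \<times> F ` {0..<T} \<times> E ` {0..<T} \<times> u ` {0..<T}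
          \<times> th00 ` {0..<T} \<times> th0 ` {0..<T} \<times> rho ` {0..<T} \<times> e ` {0..<T})"
        by (intro bounded_Times bd)
    qed (auto simp: xt)
    then have cmp: "compact (closure (x ` {0..<T}))" by simp
    have sub: "closure (x ` {0..<T}) \<subseteq> ?S"
    proof (rule closure_minimal)
      show "x ` {0..<T} \<subseteq> ?S" using lo by (auto simp: xt)
      have "closed {z :: ebs_state. l * (y \<bullet> y) \<le> y \<bullet> (fst z *v y)}" for y
        by (intro closed_Collect_le continuous_intros mv.continuous_on)
      moreover have "closed {z :: ebs_state. r \<le> fst (snd (snd (snd (snd (snd (snd (snd z)))))))}"
        by (intro closed_Collect_le continuous_intros)
      ultimately show "closed ?S" by (intro closed_Collect_conj closed_Collect_all)
    qed
    have dom: "?S \<subseteq> ebs_dom"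
    proof
      fix z assume z: "z \<in> ?S"
      have "y \<bullet> (fst z *v y) > 0" if "y \<noteq> 0" for y
      proof -
        have "0 < l * (y \<bullet> y)" using l that by simp
        also have "\<dots> \<le> y \<bullet> (fst z *v y)" using z by blast
        finally show ?thesis .
      qed
      moreover have "fst (snd (snd (snd (snd (snd (snd (snd z))))))) > 0" using z r by simp
      ultimately show "z \<in> ebs_dom" unfolding ebs_dom_def case_prod_beta by blast
    qed
    show "\<exists>K. compact K \<and> K \<subseteq> ebs_dom \<and> x ` {0..<T} \<subseteq> K"
      by (intro exI[of _ "closure (x ` {0..<T})"] conjI cmp order_trans[OF sub dom] closure_subset)
  qed
  then obtain x where x: "ode_solution (ebs_field C \<Lambda>) ebs_dom x0 {0..} x" by blast
  obtain g K F E u th00 th0 rho e where xt: "x = (\<lambda>t. (g t, K t, F t, E t, u t, th00 t, th0 t, rho t, e t))"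
    and sol: "solves_S C \<Lambda> {0..} g K F E u th00 th0 rho e"
    and init: "init_data g K F E u th00 th0 rho e g0 K0 F0 E0 U0 th00i th0i rho0 e0"
    by (rule ode_solution_imp_solves_S[OF lie _ _ _ g0 K0 F0 rho0 e0 x[unfolded x0_def]])
      (auto simp: is_interval_ci)
  show ?thesis
  proof (intro exI conjI allI impI)
    show "solves_S C \<Lambda> {0..} g K F E u th00 th0 rho e" by (rule sol)
    show "init_data g K F E u th00 th0 rho e g0 K0 F0 E0 U0 th00i th0i rho0 e0" by (rule init)
    fix g' K' F' E' u' th00' th0' rho' e' and t :: real
    assume s: "solves_S C \<Lambda> {0..} g' K' F' E' u' th00' th0' rho' e' \<and>
      init_data g' K' F' E' u' th00' th0' rho' e' g0 K0 F0 E0 U0 th00i th0i rho0 e0" and t: "t \<ge> 0"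
    have "(g' t, K' t, F' t, E' t, u' t, th00' t, th0' t, rho' t, e' t) = x t"
      by (rule ode_solution_unique[OF ebs_field_lipschitz open_ebs_dom _ _
          solves_S_imp_ode_solution[OF conjunct1[OF s] conjunct2[OF s]] x[unfolded x0_def]])
        (use t in \<open>auto simp: is_interval_ci\<close>)
    then show "g' t = g t" "K' t = K t" "F' t = F t" "E' t = E t" "u' t = u t"
      "th00' t = th00 t" "th0' t = th0 t" "rho' t = rho t" "e' t = e t"
      by (auto simp: xt)
  qed
qed

end
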